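(* Let $X^0\in L^2(\Omega,H^\gamma(\mathbb{S}^2))$ for some $\gamma\ge0$, let $X^{(\kappa)}$ be the spectral approximation of the stochastic heat equation on the sphere and $X^{(\kappa,h)}$ its forward or backward Euler--Maruyama approximation with step size $h=T/n$ on the grid $t_k=kh$ (both defined in the context), with $\kappa\in\mathbb{N}$ and $h$ coupled by $\kappa(\kappa+1)h\le C_c$. Let $\mu\in(0,1]$. Assume that one of the following holds: (a) $L\in L^2(\Omega,H^\eta(\mathbb{S}^2))$ for some $\eta\in(-1,\infty)$ with expansion $L(t)=\sum_{\ell,m}L_{\ell,m}(t)Y_{\ell,m}$ converging in $L^2(\Omega,H^\eta(\mathbb{S}^2))$, i.e. $\sum_{\ell=0}^\infty\sum_{m=-\ell}^\ell(1+\ell(\ell+1))^\eta(v_{\ell,m}+\widetilde m_{\ell,m}^2)<\infty$; in this case set $\beta=\eta+1$; (b) for some $\alpha>0$, $L_{\ell,m}=a_\ell\hat L_{\ell,m}$ for all $\ell,m$, where $a_0\ge0$, $|a_\ell|\le C'\ell^{-\alpha/2}$ for all $\ell\in\mathbb{N}$ and some constant $C'$, and $(\hat L_{\ell,m})_{\ell\in\mathbb{N}_0,m\in\{-\ell,\dots,\ell\}}$ is a sequence of identically distributed real-valued Lévy processes with mean $\mathbb{E}[\hat L_{\ell,m}(t)]=t\hat m$ and variance $\mathbb{E}[(\hat L_{\ell,m}(t)-\mathbb{E}[\hat L_{\ell,m}(t)])^2]=t\hat v$; in this case let $\beta<\alpha/2$ be arbitrary. Then there is a finite constant $C$, independent of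 $\kappa$, $h$ and $k$, such that for all $k\in\{1,\dots,n\}$ $$\|X^{(\kappa)}(t_k)-X^{(\kappa,h)}(t_k)\|_{L^2(\Omega,L^2(\mathbb{S}^2))}\le C\big(h^\mu t_k^{\min\{1,\gamma/2\}-\mu}\|X^0\|_{L^2(\Omega,H^{\min\{2,\gamma\}}(\mathbb{S}^2))}+h^{\min\{\beta/2,1\}}\big).$$
   Context: $\mathbb{S}^2$ is the unit sphere in $\mathbb{R}^3$ with surface measure, $\Delta_{\mathbb{S}^2}$ its Laplace--Beltrami operator, and $(Y_{\ell,m})_{\ell\in\mathbb{N}_0,\,m\in\{-\ell,\dots,\ell\}}$ the real-valued spherical harmonics, an orthonormal basis of $L^2(\mathbb{S}^2)$ with $\Delta_{\mathbb{S}^2}Y_{\ell,m}=-\ell(\ell+1)Y_{\ell,m}$. For $\eta\in\mathbb{R}$, $H^\eta(\mathbb{S}^2)=(\mathrm{Id}-\Delta_{\mathbb{S}^2})^{-\eta/2}L^2(\mathbb{S}^2)$ (distributions for $\eta<0$), with norm $\|f\|_{H^\eta(\mathbb{S}^2)}^2=\sum_{\ell,m}(1+\ell(\ell+1))^\eta f_{\ell,m}^2$ for $f=\sum_{\ell,m}f_{\ell,m}Y_{\ell,m}$; $H^0=L^2$. $\|Z\|_{L^p(\Omega,H^\eta(\mathbb{S}^2))}=\mathbb{E}[\|Z\|_{H^\eta(\mathbb{S}^2)}^p]^{1/p}$. $(\Omega,\mathcal{F},(\mathcal{F}_t)_{t\in[0,T]},\mathbb{P})$ is a complete filtered probability space,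 $T<\infty$. $L$ is a square-integrable Lévy process (stationary independent increments, stochastically continuous, $L(0)=0$, càdlàg) with values in $H^\eta(\mathbb{S}^2)$ for some $\eta\in(-1,\infty)$, expanded as $L(t)=\sum_{\ell,m}L_{\ell,m}(t)Y_{\ell,m}$ with real-valued càdlàg Lévy processes $L_{\ell,m}$ (in general not assumed independent). Set $\widetilde m_{\ell,m}=\mathbb{E}[L_{\ell,m}(1)]$ and $v_{\ell,m}=\mathbb{E}[(L_{\ell,m}(1)-\mathbb{E}[L_{\ell,m}(1)])^2]$. The initial value $X^0\in L^2(\Omega,L^2(\mathbb{S}^2))$ is $\mathcal{F}_0$-measurable and independent of $L$, and $X^0_{\ell,m}=\langle X^0,Y_{\ell,m}\rangle_{L^2(\mathbb{S}^2)}$. The equation is $\mathrm{d}X(t)=\Delta_{\mathbb{S}^2}X(t)\,\mathrm{d}t+\mathrm{d}L(t)$, $X(0)=X^0$. Spectral approximation: $X^{(\kappa)}(t)=\sum_{\ell=0}^\kappa\sum_{m=-\ell}^\ell\big(e^{-\ell(\ell+1)t}X^0_{\ell,m}+\int_0^te^{-\ell(\ell+1)(t-s)}\,\mathrm{d}L_{\ell,m}(s)\big)Y_{\ell,m}$. Euler--Maruyama schemes: for $n\in\mathbb{N}$, $h=T/n$, $t_k=kh$, $k\in\{0,\dots,n\}$, let $\Delta L_{\ell,m}(t_k)=L_{\ell,m}(t_k)-L_{\ell,m}(t_{k-1})$ and $$X^{(\kappa,h)}(t_k)=\sum_{\ell=0}^\kappa\sum_{m=-\ell}^\ell\Big(\xi_\ell(h)^kX^0_{\ell,m}+\sum_{j=1}^k\xi_\ell(h)^{k-j+\delta}\Delta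 L_{\ell,m}(t_j)\Big)Y_{\ell,m},$$ where $\xi_\ell(h)=1-\ell(\ell+1)h$, $\delta=0$ for the forward scheme and $\xi_\ell(h)=(1+\ell(\ell+1)h)^{-1}$, $\delta=1$ for the backward scheme. Standing coupling: $\ell(\ell+1)h\le C_c$ for all $\ell\le\kappa$, with $C_c\le1$ for the forward scheme and $C_c$ a fixed finite constant for the backward scheme. *)

theory Defs
  imports
    "HOL-Probability.Probability"
    "HOL-Computational_Algebra.Polynomial"
    "HOL-Library.Function_Algebras"
begin

section \<open>Norms with values in the extended nonnegative reals\<close>

text \<open>
  Norms take the value \<open>\<top>\<close> outside the space they belong to.  The square root must therefore
  preserve \<open>\<top>\<close>, which \<open>ennreal (sqrt (enn2real x))\<close> would not.
\<close>

definition ennsqrt :: "ennreal \<Rightarrow> ennreal" where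
  "ennsqrt x = (if x = \<top> then \<top> else ennreal (sqrt (enn2real x)))"

definition abs_norm :: "real \<Rightarrow> ennreal" where
  "abs_norm y = ennreal \<bar>y\<bar>"

definition L2_norm :: "'w measure \<Rightarrow> ('v \<Rightarrow> ennreal) \<Rightarrow> ('w \<Rightarrow> 'v) \<Rightarrow> ennreal" where
  "L2_norm M N Z = ennsqrt (\<integral>\<^sup>+\<omega>. (N (Z \<omega>))\<^sup>2 \<partial>M)"

text \<open>
  The Borel sigma-algebra of the topology induced on \<open>H\<close> by the seminorm \<open>N\<close>.  A seminorm is
  allowed because square-integrable functions are not identified almost everywhere.
\<close>

definition norm_borel :: "'v::minus set \<Rightarrow> ('v \<Rightarrow> ennreal) \<Rightarrow> 'v measure" where
  "norm_borel H N = sigma H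
     {U. U \<subseteq> H \<and> (\<forall>x\<in>U. \<exists>e>0. \<forall>y\<in>H. N (y - x) < ennreal e \<longrightarrow> y \<in> U)}"


section \<open>The unit sphere and real spherical harmonics\<close>

definition sphere_param :: "real \<times> real \<Rightarrow> real ^ 3" where
  "sphere_param = (\<lambda>(\<theta>, \<phi>). vector [sin \<theta> * cos \<phi>, sin \<theta> * sin \<phi>, cos \<theta>])"

text \<open>Surface measure, with area element \<open>sin \<theta> d\<theta> d\<phi>\<close>.\<close>

definition sphere_measure :: "(real ^ 3) measure" where
  "sphere_measure = distr
     (density lborel (\<lambda>(\<theta>, \<phi>). ennreal (sin \<theta>) * indicator ({0..pi} \<times> {0..<2 * pi}) (\<theta>, \<phi>)))
     (restrict_space borel (sphere 0 1)) sphere_param"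

text \<open>Legendre polynomials by Rodrigues' formula.\<close>

definition legendre :: "nat \<Rightarrow> real poly" where
  "legendre l = smult (1 / (2 ^ l * fact l)) ((pderiv ^^ l) ([:-1, 0, 1:] ^ l))"

text \<open>
  For \<open>x = sphere_param (\<theta>, \<phi>)\<close> and \<open>m \<ge> 0\<close> one has
  \<open>(x$1 + \<i> x$2)^m = (sin \<theta>)^m e^(\<i>m\<phi>)\<close>.  Hence, with the associated Legendre functions
  \<open>P_{l,m}(u) = (-1)^m (1 - u\<^sup>2)^(m/2) (d/du)^m P_l(u)\<close>, the definition below says that
  \<open>Y_{l,0} = c_{l,0} P_{l,0}(cos \<theta>)\<close> and, for \<open>m > 0\<close>,
  \<open>Y_{l,m} = \<surd>2 c_{l,m} P_{l,m}(cos \<theta>) cos (m\<phi>)\<close> and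
  \<open>Y_{l,-m} = \<surd>2 c_{l,m} P_{l,m}(cos \<theta>) sin (m\<phi>)\<close>, where
  \<open>c_{l,m}\<^sup>2 = (2l+1)/(4\<pi>) (l-m)!/(l+m)!\<close>.
  Only indices with \<open>\<bar>m\<bar> \<le> l\<close> are meaningful.
\<close>

definition sph_harm :: "nat \<Rightarrow> int \<Rightarrow> real ^ 3 \<Rightarrow> real" where
  "sph_harm l m x = (let k = nat \<bar>m\<bar>; z = Complex (x $ 1) (x $ 2) ^ k in
     sqrt ((2 * real l + 1) / (4 * pi) * (fact (l - k) / fact (l + k)))
     * ((- 1) ^ k * poly ((pderiv ^^ k) (legendre l)) (x $ 3))
     * (if m = 0 then 1 else if m > 0 then sqrt 2 * Re z else sqrt 2 * Im z))"


section \<open>Square-integrable functions and Sobolev spaces on the sphere\<close>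

definition sphere_L2_norm :: "(real ^ 3 \<Rightarrow> real) \<Rightarrow> ennreal" where
  "sphere_L2_norm f = L2_norm sphere_measure abs_norm f"

definition sphere_L2 :: "(real ^ 3 \<Rightarrow> real) set" where
  "sphere_L2 = {f \<in> borel_measurable sphere_measure. sphere_L2_norm f < \<top>}"

definition sphere_L2_borel :: "(real ^ 3 \<Rightarrow> real) measure" where
  "sphere_L2_borel = norm_borel sphere_L2 sphere_L2_norm"

text \<open>
  A (generalised) function \<open>f = \<Sum> f_{l,m} Y_{l,m}\<close> on the sphere is represented by its array
  \<open>(f_{l,m})\<close> of coefficients, set to \<open>0\<close> for the meaningless indices \<open>\<bar>m\<bar> > l\<close>; this
  covers the distributions in Sobolev spaces of negative order.
\<close>

type_synonym sph_series = "nat \<Rightarrow> int \<Rightarrow> real"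

definition sph_coeff :: "(real ^ 3 \<Rightarrow> real) \<Rightarrow> sph_series" where
  "sph_coeff f l m =
     (if \<bar>m\<bar> \<le> int l then (\<integral>x. f x * sph_harm l m x \<partial>sphere_measure) else 0)"

text \<open>\<open>lap_eig l\<close> is the eigenvalue of minus the Laplace-Beltrami operator on all \<open>Y_{l,m}\<close>.\<close>

definition lap_eig :: "nat \<Rightarrow> real" where
  "lap_eig l = real l * (real l + 1)"

text \<open>
  \<open>Sobolev \<eta> = (Id - \<Delta>)^(-\<eta>/2) L\<^sup>2\<close>, where the operator multiplies the
  coefficient of \<open>Y_{l,m}\<close> by \<open>(1 + l(l+1))^(-\<eta>/2)\<close>.
\<close>

definition Sobolev :: "real \<Rightarrow> sph_series set" where
  "Sobolev \<eta> = {a. \<exists>g\<in>sphere_L2. \<forall>l m. a l m = (1 + lap_eig l) powr (- \<eta> / 2) * sph_coeff g l m}"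

definition Sobolev_norm :: "real \<Rightarrow> sph_series \<Rightarrow> ennreal" where
  "Sobolev_norm \<eta> a =
     ennsqrt (\<Sum>l. \<Sum>m\<in>{- int l..int l}. ennreal ((1 + lap_eig l) powr \<eta> * (a l m)\<^sup>2))"

definition Sobolev_borel :: "real \<Rightarrow> sph_series measure" where
  "Sobolev_borel \<eta> = norm_borel (Sobolev \<eta>) (Sobolev_norm \<eta>)"


section \<open>Filtered probability spaces and Levy processes\<close>

definition complete_filtered_prob_space ::
    "'w measure \<Rightarrow> (real \<Rightarrow> 'w measure) \<Rightarrow> real \<Rightarrow> bool" where
  "complete_filtered_prob_space M F T \<longleftrightarrow>
     prob_space M \<and> complete_measure M
     \<and> (\<forall>t\<in>{0..T}. subalgebra M (F t))
     \<and> (\<forall>s\<in>{0..T}. \<forall>t\<in>{s..T}. sets (F s) \<subseteq> sets (F t))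
     \<and> null_sets M \<subseteq> sets (F 0)"

text \<open>
  The values lie in \<open>space B\<close>, where \<open>B\<close> is the Borel sigma-algebra belonging to the norm \<open>N\<close>.
  The time set is \<open>[0,\<infinity>)\<close> even when an equation is considered on \<open>[0,T]\<close> only, because the
  moments of the noise are taken at time \<open>1\<close>.
\<close>

definition levy_process ::
    "'w measure \<Rightarrow> 'v::{minus,zero} measure \<Rightarrow> ('v \<Rightarrow> ennreal) \<Rightarrow> (real \<Rightarrow> 'w \<Rightarrow> 'v) \<Rightarrow> bool" where
  "levy_process M B N L \<longleftrightarrow>
     (\<forall>t\<ge>0. L t \<in> measurable M B)
     \<and> (AE \<omega> in M. L 0 \<omega> = 0)
     \<and> (\<forall>n (t::nat \<Rightarrow> real). 0 \<le> t 0 \<and> (\<forall>i<n. t i < t (Suc i)) \<longrightarrow>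
          prob_space.indep_vars M (\<lambda>_. B) (\<lambda>i \<omega>. L (t (Suc i)) \<omega> - L (t i) \<omega>) {..<n})
     \<and> (\<forall>s\<ge>0. \<forall>t\<ge>0. distr M B (\<lambda>\<omega>. L (s + t) \<omega> - L s \<omega>) = distr M B (L t))
     \<and> (\<forall>s\<ge>0. \<forall>e>0.
          ((\<lambda>t. measure M {\<omega> \<in> space M. N (L t \<omega> - L s \<omega>) > ennreal e}) \<longlongrightarrow> 0) (at s within {0..}))
     \<and> (AE \<omega> in M. (\<forall>t\<ge>0. ((\<lambda>s. N (L s \<omega> - L t \<omega>)) \<longlongrightarrow> 0) (at_right t))
          \<and> (\<forall>t>0. \<exists>y\<in>space B. ((\<lambda>s. N (L s \<omega> - y)) \<longlongrightarrow> 0) (at_left t)))"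

definition square_integrable_process ::
    "'w measure \<Rightarrow> ('v \<Rightarrow> ennreal) \<Rightarrow> (real \<Rightarrow> 'w \<Rightarrow> 'v) \<Rightarrow> bool" where
  "square_integrable_process M N L \<longleftrightarrow> (\<forall>t\<ge>0. L2_norm M N (L t) < \<top>)"

definition independent_of_process ::
    "'w measure \<Rightarrow> 'u measure \<Rightarrow> ('w \<Rightarrow> 'u) \<Rightarrow> 'v measure \<Rightarrow> (real \<Rightarrow> 'w \<Rightarrow> 'v) \<Rightarrow> bool" where
  "independent_of_process M A Z B L \<longleftrightarrow>
     prob_space.indep_set M
       (sets (vimage_algebra (space M) Z A))
       (sets (vimage_algebra (space M) (\<lambda>\<omega>. \<lambda>t\<in>{0..}. L t \<omega>) (PiM {0..} (\<lambda>_. B))))"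

definition process_law :: "'w measure \<Rightarrow> (real \<Rightarrow> 'w \<Rightarrow> real) \<Rightarrow> (real \<Rightarrow> real) measure" where
  "process_law M Z = distr M (PiM {0..} (\<lambda>_. borel)) (\<lambda>\<omega>. \<lambda>t\<in>{0..}. Z t \<omega>)"


section \<open>Stochastic integrals of deterministic functions\<close>

text \<open>
  The integral of \<open>f\<close> over \<open>[0,t]\<close> with respect to a square-integrable real Levy process \<open>Z\<close>
  is the continuous extension of the elementary integral
  \<open>\<Sum>i<n. c i 1_(s i, s (i+1)] \<mapsto> \<Sum>i<n. c i (Z (s (i+1)) - Z (s i))\<close>
  from step functions to \<open>L\<^sup>2[0,t]\<close>, with values in \<open>L\<^sup>2(\<Omega>)\<close>.  It is determined up to null
  sets, so \<open>stoch_integral\<close> selects a version.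
\<close>

definition step_function :: "nat \<Rightarrow> (nat \<Rightarrow> real) \<Rightarrow> (nat \<Rightarrow> real) \<Rightarrow> real \<Rightarrow> real" where
  "step_function n s c r = (\<Sum>i<n. c i * indicator {s i<..s (Suc i)} r)"

definition step_integral ::
    "(real \<Rightarrow> 'w \<Rightarrow> real) \<Rightarrow> nat \<Rightarrow> (nat \<Rightarrow> real) \<Rightarrow> (nat \<Rightarrow> real) \<Rightarrow> 'w \<Rightarrow> real" where
  "step_integral Z n s c \<omega> = (\<Sum>i<n. c i * (Z (s (Suc i)) \<omega> - Z (s i) \<omega>))"

definition is_stoch_integral ::
    "'w measure \<Rightarrow> (real \<Rightarrow> 'w \<Rightarrow> real) \<Rightarrow> real \<Rightarrow> (real \<Rightarrow> real) \<Rightarrow> ('w \<Rightarrow> real) \<Rightarrow> bool" where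
  "is_stoch_integral M Z t f I \<longleftrightarrow> I \<in> borel_measurable M \<and>
     (\<exists>(n::nat \<Rightarrow> nat) (s::nat \<Rightarrow> nat \<Rightarrow> real) (c::nat \<Rightarrow> nat \<Rightarrow> real).
        (\<forall>j. 0 \<le> s j 0 \<and> (\<forall>i<n j. s j i \<le> s j (Suc i)) \<and> s j (n j) \<le> t)
        \<and> (\<lambda>j. \<integral>\<^sup>+r\<in>{0..t}. ennreal ((f r - step_function (n j) (s j) (c j) r)\<^sup>2) \<partial>lborel) \<longlonglongrightarrow> 0
        \<and> (\<lambda>j. L2_norm M abs_norm (\<lambda>\<omega>. I \<omega> - step_integral Z (n j) (s j) (c j) \<omega>)) \<longlonglongrightarrow> 0)"

definition stoch_integral ::
    "'w measure \<Rightarrow> (real \<Rightarrow> 'w \<Rightarrow> real) \<Rightarrow> real \<Rightarrow> (real \<Rightarrow> real) \<Rightarrow> 'w \<Rightarrow> real" where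
  "stoch_integral M Z t f = (SOME I. is_stoch_integral M Z t f I)"


section \<open>The spectral and the Euler-Maruyama approximations\<close>

definition spectral_approx ::
    "'w measure \<Rightarrow> (real \<Rightarrow> 'w \<Rightarrow> sph_series) \<Rightarrow> ('w \<Rightarrow> real ^ 3 \<Rightarrow> real)
      \<Rightarrow> nat \<Rightarrow> real \<Rightarrow> 'w \<Rightarrow> real ^ 3 \<Rightarrow> real" where
  "spectral_approx M L X0 \<kappa> t \<omega> x =
     (\<Sum>l\<le>\<kappa>. \<Sum>m\<in>{- int l..int l}.
        (exp (- lap_eig l * t) * sph_coeff (X0 \<omega>) l m
         + stoch_integral M (\<lambda>s \<omega>. L s \<omega> l m) t (\<lambda>s. exp (- lap_eig l * (t - s))) \<omega>)
        * sph_harm l m x)"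

datatype euler_scheme = Forward | Backward

fun em_factor :: "euler_scheme \<Rightarrow> real \<Rightarrow> nat \<Rightarrow> real" where
  "em_factor Forward h l = 1 - lap_eig l * h"
| "em_factor Backward h l = inverse (1 + lap_eig l * h)"

fun em_shift :: "euler_scheme \<Rightarrow> nat" where
  "em_shift Forward = 0"
| "em_shift Backward = 1"

definition em_approx ::
    "euler_scheme \<Rightarrow> (real \<Rightarrow> 'w \<Rightarrow> sph_series) \<Rightarrow> ('w \<Rightarrow> real ^ 3 \<Rightarrow> real)
      \<Rightarrow> nat \<Rightarrow> real \<Rightarrow> nat \<Rightarrow> 'w \<Rightarrow> real ^ 3 \<Rightarrow> real" where
  "em_approx S L X0 \<kappa> h k \<omega> x =
     (\<Sum>l\<le>\<kappa>. \<Sum>m\<in>{- int l..int l}.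
        (em_factor S h l ^ k * sph_coeff (X0 \<omega>) l m
         + (\<Sum>j=1..k. em_factor S h l ^ (k - j + em_shift S)
              * (L (real j * h) \<omega> l m - L (real (j - 1) * h) \<omega> l m)))
        * sph_harm l m x)"


section \<open>The two assumptions on the noise\<close>

definition levy_mean :: "'w measure \<Rightarrow> (real \<Rightarrow> 'w \<Rightarrow> sph_series) \<Rightarrow> sph_series" where
  "levy_mean M L l m = (\<integral>\<omega>. L 1 \<omega> l m \<partial>M)"

definition levy_var :: "'w measure \<Rightarrow> (real \<Rightarrow> 'w \<Rightarrow> sph_series) \<Rightarrow> sph_series" where
  "levy_var M L l m = (\<integral>\<omega>. (L 1 \<omega> l m - levy_mean M L l m)\<^sup>2 \<partial>M)"

definition noise_regular :: "'w measure \<Rightarrow> (real \<Rightarrow> 'w \<Rightarrow> sph_series) \<Rightarrow> real \<Rightarrow> bool" where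
  "noise_regular M L \<eta> \<longleftrightarrow>
     square_integrable_process M (Sobolev_norm \<eta>) L
     \<and> summable (\<lambda>l. \<Sum>m\<in>{- int l..int l}.
          (1 + lap_eig l) powr \<eta> * (levy_var M L l m + (levy_mean M L l m)\<^sup>2))"

definition noise_scaled :: "'w measure \<Rightarrow> (real \<Rightarrow> 'w \<Rightarrow> sph_series) \<Rightarrow> real \<Rightarrow> bool" where
  "noise_scaled M L \<alpha> \<longleftrightarrow>
     (\<exists>(a::nat \<Rightarrow> real) (C'::real) (Lh::nat \<Rightarrow> int \<Rightarrow> real \<Rightarrow> 'w \<Rightarrow> real) (mh::real) (vh::real).
        a 0 \<ge> 0
        \<and> (\<forall>l\<ge>1. \<bar>a l\<bar> \<le> C' * real l powr (- \<alpha> / 2))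
        \<and> (\<forall>l. \<forall>m\<in>{- int l..int l}. levy_process M borel abs_norm (Lh l m))
        \<and> (\<forall>l. \<forall>m\<in>{- int l..int l}. process_law M (Lh l m) = process_law M (Lh 0 0))
        \<and> (\<forall>l. \<forall>m\<in>{- int l..int l}. \<forall>t\<ge>0.
              integrable M (\<lambda>\<omega>. (Lh l m t \<omega>)\<^sup>2)
              \<and> (\<integral>\<omega>. Lh l m t \<omega> \<partial>M) = t * mh
              \<and> (\<integral>\<omega>. (Lh l m t \<omega> - (\<integral>\<omega>'. Lh l m t \<omega>' \<partial>M))\<^sup>2 \<partial>M) = t * vh)
        \<and> (\<forall>l. \<forall>m\<in>{- int l..int l}. \<forall>t\<ge>0. AE \<omega> in M. L t \<omega> l m = a l * Lh l m t \<omega>))"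

end

theory Submission
  imports Defs
begin

text \<open>
  By orthonormality of the spherical harmonics (\<open>sph_harm_orthonormal\<close>) the mean square error is
  the sum of the second moments of the errors in the coefficients with \<open>l \<le> \<kappa>\<close>.  Each of these
  consists of a multiple of an initial coefficient and a noise term
  (\<open>mean_square_error_split\<close>).  Write \<open>\<lambda> = l (l + 1)\<close>, \<open>t = k h\<close>, and \<open>\<xi>\<close> for the Euler factor.

  The initial coefficient is multiplied by \<open>exp (- \<lambda> t) - \<xi> ^ k\<close>.  The coupling keeps
  \<open>\<lambda> h\<close> bounded, so \<open>\<xi>\<close> agrees with \<open>exp (- \<lambda> h)\<close> up to \<open>(\<lambda> h)\<^sup>2\<close> and is at most
  \<open>exp (- c \<lambda> h)\<close> with one constant \<open>c > 0\<close> (\<open>em_factor_bounds\<close>).  Telescoping bounds the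
  multiplier by a constant times \<open>k (\<lambda> h)\<^sup>2 exp (- c \<lambda> t)\<close>, and the exponential decay
  absorbs every power of \<open>\<lambda> t\<close> beyond the one that the smoothness of the initial value
  controls (\<open>initial_error\<close>).

  The noise term is the stochastic integral of the difference of \<open>exp (- \<lambda> (t - s))\<close> and a step
  function on the time grid.  This difference is at most a constant times
  \<open>\<lambda> h exp (- c \<lambda> (t - s) / 2)\<close>, and its square integrates to the order \<open>\<lambda> h\<^sup>2\<close>
  (\<open>kernel_error_integral\<close>).  A square-integrable Levy process with variance \<open>v\<close> and mean \<open>m\<close>
  at time \<open>1\<close> has \<open>E[Z s Z t] = v min s t + m\<^sup>2 s t\<close> (\<open>covariance\<close>), so that the integral of
  a step function \<open>g\<close> has second moment at most \<open>(v + t m\<^sup>2) \<integral>g\<^sup>2\<close> (\<open>elementary_bound\<close>).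
  This passes to the limit that defines the stochastic integral
  (\<open>stoch_integral_elementary_bound\<close>).  As \<open>stoch_integral\<close> is a choice, an integral has to be
  constructed before anything is known about the chosen one (\<open>stoch_integral_exists\<close>).

  Altogether the noise contributes the sum of \<open>\<lambda> h\<^sup>2 (v + m\<^sup>2)\<close> over all coefficients with
  \<open>l \<le> \<kappa>\<close>.  Since \<open>\<lambda> h\<^sup>2\<close> is at most a constant times
  \<open>(1 + \<lambda>) powr \<eta> * h powr min (\<eta> + 1) 2\<close> (\<open>noise_rate\<close>), the regularity of order \<open>\<eta>\<close> of
  the noise gives the square of the asserted rate for \<open>\<beta> = \<eta> + 1\<close>.  Scaled, identically
  distributed coefficients have regularity of every order \<open>\<eta> < \<alpha> / 2 - 1\<close>
  (\<open>noise_scaled_summable\<close>), so both assumptions on the noise are treated alike.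
\<close>

section \<open>Norms and measurability\<close>

lemma ennsqrt_power2: "(ennsqrt x)\<^sup>2 = x"
  by (cases x) (auto simp: ennsqrt_def ennreal_power power2_eq_square ennreal_top_mult
      simp flip: ennreal_mult)

lemma ennsqrt_mono: "x \<le> y \<Longrightarrow> ennsqrt x \<le> ennsqrt y"
  by (cases x; cases y) (auto simp: ennsqrt_def top_unique)

lemma ennsqrt_of_power2: "ennsqrt (x\<^sup>2) = x"
  by (cases x) (auto simp: ennsqrt_def ennreal_power power2_eq_square ennreal_top_mult
      simp flip: ennreal_mult)

text \<open>
  All norms are handled through their squares, which are integrals or sums and hence additive; this
  is the way back.
\<close>

lemma ennreal_power2_le_imp_le: "x\<^sup>2 \<le> y\<^sup>2 \<Longrightarrow> x \<le> y" for x y :: ennreal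
  using ennsqrt_mono[of "x\<^sup>2" "y\<^sup>2"] by (simp add: ennsqrt_of_power2)

lemma ennsqrt_measurable [measurable]: "ennsqrt \<in> borel_measurable borel"
  unfolding ennsqrt_def by measurable

lemma L2_norm_power2: "(L2_norm M N Z)\<^sup>2 = (\<integral>\<^sup>+\<omega>. (N (Z \<omega>))\<^sup>2 \<partial>M)"
  by (simp add: L2_norm_def ennsqrt_power2)

lemma L2_norm_leI: "(\<integral>\<^sup>+\<omega>. (N (Z \<omega>))\<^sup>2 \<partial>M) \<le> r\<^sup>2 \<Longrightarrow> L2_norm M N Z \<le> r"
  by (rule ennreal_power2_le_imp_le) (simp add: L2_norm_power2)

lemma abs_norm_power2: "(abs_norm y)\<^sup>2 = ennreal (y\<^sup>2)"
  by (simp add: abs_norm_def ennreal_power)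

text \<open>
  The preimage of an open set under a functional that is Lipschitz for \<open>N\<close> is one of the open
  sets that generate the sigma-algebra.
\<close>

lemma norm_borel_measurableI:
  fixes \<phi> :: "'v::minus \<Rightarrow> real"
  assumes K: "K > 0"
    and lip: "\<And>x y. x \<in> H \<Longrightarrow> y \<in> H \<Longrightarrow> ennreal \<bar>\<phi> y - \<phi> x\<bar> \<le> ennreal K * N (y - x)"
  shows "\<phi> \<in> borel_measurable (norm_borel H N)"
proof (rule borel_measurableI)
  let ?G = "{U. U \<subseteq> H \<and> (\<forall>x\<in>U. \<exists>e>0. \<forall>y\<in>H. N (y - x) < ennreal e \<longrightarrow> y \<in> U)}"
  have G: "?G \<subseteq> Pow H" by auto
  fix S :: "real set" assume "open S"
  have "\<exists>e>0. \<forall>y\<in>H. N (y - x) < ennreal e \<longrightarrow> \<phi> y \<in> S" if x: "x \<in> H" "\<phi> x \<in> S" for x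
  proof -
    obtain d where d: "d > 0" "\<And>r. dist r (\<phi> x) < d \<Longrightarrow> r \<in> S"
      using \<open>open S\<close> x by (auto simp: open_dist)
    have "\<phi> y \<in> S" if y: "y \<in> H" "N (y - x) < ennreal (d / K)" for y
    proof -
      obtain r where r: "N (y - x) = ennreal r" "r \<ge> 0"
        using y(2) by (cases "N (y - x)") auto
      have "r < d / K" using y(2) r by (simp add: ennreal_less_iff)
      moreover have "\<bar>\<phi> y - \<phi> x\<bar> \<le> K * r"
        using lip[OF x(1) y(1)] r K by (simp flip: ennreal_mult)
      ultimately have "\<bar>\<phi> y - \<phi> x\<bar> < d" using K by (simp add: field_simps)
      then show ?thesis by (intro d) (simp add: dist_real_def)
    qed
    then show ?thesis using d(1) K by (intro exI[of _ "d / K"]) auto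
  qed
  then have "\<phi> -` S \<inter> H \<in> ?G" by auto
  then show "\<phi> -` S \<inter> space (norm_borel H N) \<in> sets (norm_borel H N)"
    unfolding norm_borel_def by (simp add: space_measure_of[OF G] sets_measure_of[OF G])
qed

lemma lap_eig_nonneg: "lap_eig l \<ge> 0"
  by (simp add: lap_eig_def)

lemma Sobolev_norm_power2: "(Sobolev_norm \<eta> a)\<^sup>2 =
    (\<Sum>l. \<Sum>m\<in>{- int l..int l}. ennreal ((1 + lap_eig l) powr \<eta> * (a l m)\<^sup>2))"
  by (simp add: Sobolev_norm_def ennsqrt_power2)

lemma sum_le_Sobolev_norm_power2:
  "(\<Sum>l\<le>\<kappa>. \<Sum>m\<in>{- int l..int l}. ennreal ((1 + lap_eig l) powr \<eta> * (a l m)\<^sup>2))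
     \<le> (Sobolev_norm \<eta> a)\<^sup>2"
  unfolding Sobolev_norm_power2 by (intro sum_le_suminf) auto

lemma coeff_le_Sobolev_norm:
  assumes m: "m \<in> {- int l..int l}"
  shows "ennreal \<bar>a l m\<bar> \<le> ennreal ((1 + lap_eig l) powr (- \<eta> / 2)) * Sobolev_norm \<eta> a"
proof -
  define w where "w = (1 + lap_eig l) powr (\<eta> / 2)"
  have pos: "1 + lap_eig l > 0" using lap_eig_nonneg[of l] by linarith
  have w: "w > 0" using pos by (simp add: w_def)
  have w2: "w\<^sup>2 = (1 + lap_eig l) powr \<eta>" 
    unfolding w_def by (simp add: power2_eq_square flip: powr_add)
  have "(ennreal (w * \<bar>a l m\<bar>))\<^sup>2 = ennreal ((1 + lap_eig l) powr \<eta> * (a l m)\<^sup>2)"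
    using w by (simp add: ennreal_power power_mult_distrib w2)
  also have "\<dots> \<le> (\<Sum>m\<in>{- int l..int l}. ennreal ((1 + lap_eig l) powr \<eta> * (a l m)\<^sup>2))"
    using m by (intro member_le_sum) auto
  also have "\<dots> \<le> (\<Sum>l\<le>l. \<Sum>m\<in>{- int l..int l}. ennreal ((1 + lap_eig l) powr \<eta> * (a l m)\<^sup>2))"
    by (rule member_le_sum) auto
  also have "\<dots> \<le> (Sobolev_norm \<eta> a)\<^sup>2" by (rule sum_le_Sobolev_norm_power2)
  finally have le: "ennreal (w * \<bar>a l m\<bar>) \<le> Sobolev_norm \<eta> a" by (rule ennreal_power2_le_imp_le)
  have inv: "(1 + lap_eig l) powr (- \<eta> / 2) = inverse w"
    unfolding w_def by (simp add: powr_minus)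
  have "ennreal \<bar>a l m\<bar> = ennreal (inverse w) * ennreal (w * \<bar>a l m\<bar>)"
    using w by (simp flip: ennreal_mult)
  also have "\<dots> \<le> ennreal (inverse w) * Sobolev_norm \<eta> a" by (intro mult_left_mono le) simp
  finally show ?thesis by (simp only: inv)
qed

lemma Sobolev_coeff_measurable:
  assumes "m \<in> {- int l..int l}"
  shows "(\<lambda>a. a l m) \<in> borel_measurable (Sobolev_borel \<eta>)"
  unfolding Sobolev_borel_def
proof (rule norm_borel_measurableI)
  show "(1 + lap_eig l) powr (- \<eta> / 2) > 0" using lap_eig_nonneg[of l] by simp
  show "ennreal \<bar>y l m - x l m\<bar> \<le> ennreal ((1 + lap_eig l) powr (- \<eta> / 2)) * Sobolev_norm \<eta> (y - x)"
    for x y using coeff_le_Sobolev_norm[OF assms, of "y - x" \<eta>] by simp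
qed

text \<open>
  Makes the events in the definition of stochastic continuity measurable, without which their
  \<open>measure\<close> would be the default value \<open>0\<close>.
\<close>

lemma Sobolev_norm_measurable:
  "Sobolev_norm \<eta> \<in> borel_measurable (Sobolev_borel \<eta>)"
proof -
  note [measurable] = Sobolev_coeff_measurable[where \<eta> = \<eta>]
  show ?thesis unfolding Sobolev_norm_def by measurable
qed


section \<open>Orthogonality of the associated Legendre functions\<close>

lemma coeff_higher_pderiv:
  "coeff ((pderiv ^^ n) p) i = fact (n + i) / fact i * coeff p (n + i)" for p :: "real poly"
proof (induction n arbitrary: i)
  case (Suc n)
  have "real (Suc i) * (fact (n + Suc i) / fact (Suc i) * coeff p (n + Suc i))
      = fact (n + Suc i) / fact i * coeff p (n + Suc i)"
    by (simp only: fact_Suc[of i]) (simp del: of_nat_Suc fact_Suc)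
  then show ?case by (simp add: coeff_pderiv Suc del: fact_Suc of_nat_Suc)
qed simp

lemma higher_pderiv_eq_0:
  fixes p :: "real poly"
  assumes "degree p < n" shows "(pderiv ^^ n) p = 0"
  using assms by (intro poly_eqI) (simp add: coeff_higher_pderiv coeff_eq_0)

lemma higher_pderiv_degree:
  fixes p :: "real poly"
  assumes "degree p \<le> n" shows "(pderiv ^^ n) p = [:fact n * coeff p n:]"
  using assms by (intro poly_eqI) (auto simp: coeff_higher_pderiv coeff_eq_0 coeff_pCons split: nat.split)

text \<open>
  A derivative lowers the multiplicity of a factor by at most one.
\<close>

lemma power_dvd_higher_pderiv:
  "w ^ n dvd p \<Longrightarrow> w ^ (n - j) dvd (pderiv ^^ j) p" for p w :: "real poly"
proof (induction j)
  case (Suc j)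
  show ?case
  proof (cases "n - j")
    case (Suc m)
    then obtain r where "(pderiv ^^ j) p = w ^ Suc m * r" using Suc.IH Suc.prems by (auto simp: dvd_def)
    then have "pderiv ((pderiv ^^ j) p) = w ^ m * (w * pderiv r + r * smult (real (Suc m)) (pderiv w))"
      by (simp only: pderiv_mult pderiv_power_Suc) (simp add: algebra_simps)
    moreover have "n - Suc j = m" using Suc by simp
    ultimately show ?thesis by simp
  qed simp
qed simp

lemma poly_higher_pderiv_root:
  fixes p w :: "real poly"
  assumes "w ^ n dvd p" "j < n" "poly w x = 0"
  shows "poly ((pderiv ^^ j) p) x = 0"
proof -
  have "w dvd (pderiv ^^ j) p"
    using power_dvd_higher_pderiv[OF assms(1), of j] assms(2)
    by (meson dvd_power dvd_trans zero_less_diff)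
  then show ?thesis using assms(3) by (auto simp: dvd_def)
qed

lemma higher_pderiv_smult: "(pderiv ^^ n) (smult c p) = smult c ((pderiv ^^ n) p)" for p :: "real poly"
  by (induction n) (simp_all add: pderiv_smult)

text \<open>The integral of \<open>p\<close> over \<open>[-1,1]\<close>, in the variable \<open>\<theta>\<close> with \<open>u = cos \<theta>\<close>.\<close>

definition cos_integral :: "real poly \<Rightarrow> real" where
  "cos_integral p = (LBINT \<theta>. poly p (cos \<theta>) * sin \<theta> * indicator {0..pi} \<theta>)"

lemma integrable_Icc:
  fixes f :: "real \<Rightarrow> real"
  assumes "continuous_on UNIV f"
  shows "integrable lborel (\<lambda>x. f x * indicator {a..b} x)"
  using borel_integrable_atLeastAtMost[of a b f] assms
  by (simp add: continuous_on_eq_continuous_at)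

lemma cos_integral_integrable:
  "integrable lborel (\<lambda>\<theta>. poly p (cos \<theta>) * sin \<theta> * indicator {0..pi} \<theta>)"
  by (intro integrable_Icc continuous_intros)

lemma cos_integral_add: "cos_integral (p + q) = cos_integral p + cos_integral q"
proof -
  have "cos_integral (p + q) = (LBINT \<theta>. poly p (cos \<theta>) * sin \<theta> * indicator {0..pi} \<theta>
     + poly q (cos \<theta>) * sin \<theta> * indicator {0..pi} \<theta>)"
    unfolding cos_integral_def by (simp add: algebra_simps)
  then show ?thesis unfolding cos_integral_def
    by (simp add: Bochner_Integration.integral_add cos_integral_integrable)
qed

lemma cos_integral_smult: "cos_integral (smult c p) = c * cos_integral p"
  unfolding cos_integral_def by (simp add: mult.assoc)

lemma cos_integral_pderiv: "cos_integral (pderiv p) = poly p 1 - poly p (-1)"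
proof -
  have "cos_integral (pderiv p) = (- poly p (cos pi)) - (- poly p (cos 0))"
    unfolding cos_integral_def
    by (rule integral_FTC_Icc_real)
       (auto intro!: derivative_eq_intros continuous_intros simp: poly_DERIV)
  then show ?thesis by simp
qed

text \<open>
  At each of the \<open>n\<close> integrations by parts a factor of the boundary term vanishes at both
  endpoints.
\<close>

lemma cos_integral_by_parts:
  assumes "\<And>j x. j < n \<Longrightarrow> x \<in> {-1, 1} \<Longrightarrow>
      poly ((pderiv ^^ j) q) x = 0 \<or> poly ((pderiv ^^ (n - 1 - j)) g) x = 0"
  shows "cos_integral (q * (pderiv ^^ n) g) = (-1) ^ n * cos_integral ((pderiv ^^ n) q * g)"
  using assms
proof (induction n arbitrary: q)
  case (Suc n)
  have "pderiv (q * (pderiv ^^ n) g) = q * (pderiv ^^ Suc n) g + pderiv q * (pderiv ^^ n) g"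
    by (simp add: pderiv_mult mult.commute)
  then have "cos_integral (q * (pderiv ^^ Suc n) g) + cos_integral (pderiv q * (pderiv ^^ n) g)
      = cos_integral (pderiv (q * (pderiv ^^ n) g))"
    by (simp only: cos_integral_add)
  also have "\<dots> = 0" using Suc.prems[of 0 1] Suc.prems[of 0 "-1"] by (auto simp: cos_integral_pderiv)
  finally have 1: "cos_integral (q * (pderiv ^^ Suc n) g) = - cos_integral (pderiv q * (pderiv ^^ n) g)"
    by simp
  have "cos_integral (pderiv q * (pderiv ^^ n) g)
      = (-1) ^ n * cos_integral ((pderiv ^^ n) (pderiv q) * g)"
  proof (rule Suc.IH)
    fix j and x :: real assume "j < n" "x \<in> {-1, 1}"
    then show "poly ((pderiv ^^ j) (pderiv q)) x = 0 \<or> poly ((pderiv ^^ (n - 1 - j)) g) x = 0"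
      using Suc.prems[of "Suc j" x] by (simp add: funpow_swap1)
  qed
  then show ?case unfolding 1 by (simp add: funpow_swap1)
qed simp

lemma cos_integral_power:
  "cos_integral ([:-1, 0, 1:] ^ l) = (-1) ^ l * (2 ^ (2 * l + 1) * (fact l)\<^sup>2 / fact (2 * l + 1))"
proof (induction l)
  case 0
  have "cos_integral (pderiv [:0, 1:]) = 2" by (subst cos_integral_pderiv) simp
  then show ?case by (simp add: pderiv_pCons one_pCons)
next
  case (Suc l)
  let ?w = "[:-1, 0, 1:] :: real poly"
  \<comment> \<open>With \<open>w = u\<^sup>2 - 1\<close>, the polynomial \<open>u w ^ (l + 1)\<close> vanishes at \<open>\<plusminus>1\<close>; integrating its derivative gives the recursion.\<close>
  have "pderiv ([:0, 1:] * ?w ^ Suc l) = smult (2 * real l + 3) (?w ^ Suc l) + smult (2 * (real l + 1)) (?w ^ l)"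
  proof (rule poly_ext)
    fix x :: real
    have 1: "pderiv [:0, 1:] = (1 :: real poly)" "pderiv ?w = [:0, 2:]"
      by (simp_all add: pderiv_pCons one_pCons)
    show "poly (pderiv ([:0, 1:] * ?w ^ Suc l)) x
      = poly (smult (2 * real l + 3) (?w ^ Suc l) + smult (2 * (real l + 1)) (?w ^ l)) x"
      by (simp only: pderiv_mult pderiv_power_Suc 1) (simp add: algebra_simps)
  qed
  then have "(2 * real l + 3) * cos_integral (?w ^ Suc l) + 2 * (real l + 1) * cos_integral (?w ^ l)
      = cos_integral (pderiv ([:0, 1:] * ?w ^ Suc l))"
    by (simp only: cos_integral_add cos_integral_smult)
  also have "\<dots> = 0" by (simp add: cos_integral_pderiv)
  finally have "cos_integral (?w ^ Suc l) = - (2 * (real l + 1) / (2 * real l + 3)) * cos_integral (?w ^ l)"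
    by (simp add: field_simps)
  also have "\<dots> = (-1) ^ Suc l * (2 ^ (2 * Suc l + 1) * (fact (Suc l))\<^sup>2 / fact (2 * Suc l + 1))"
  proof -
    have 1: "fact (2 * Suc l + 1) = (2 * real l + 3) * (2 * (real l + 1)) * (fact (2 * l + 1) :: real)"
      by (simp add: algebra_simps)
    have 2: "fact (Suc l) = (real l + 1) * (fact l :: real)" by (simp add: algebra_simps)
    have 3: "(2 :: real) ^ (2 * Suc l + 1) = 4 * 2 ^ (2 * l + 1)" by simp
    have 4: "- (2 * (a + 1) / (2 * a + 3)) * (s * (P * B\<^sup>2 / A))
        = (-1) * s * (4 * P * ((a + 1) * B)\<^sup>2 / ((2 * a + 3) * (2 * (a + 1)) * A))"
      if "a \<ge> 0" "A \<noteq> 0" for a s P A B :: real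
      using that by (simp add: divide_simps power2_eq_square) (simp add: algebra_simps)
    show ?thesis unfolding Suc power_Suc 1 2 3 by (rule 4) (simp_all del: fact_Suc)
  qed
  finally show ?case .
qed

text \<open>
  The derivatives in Rodrigues' formula for the polynomial of larger degree are moved to the other
  factor.  The boundary terms vanish because the powers of \<open>u\<^sup>2 - 1\<close> have zeros of high order at
  \<open>\<plusminus>1\<close>, and what remains is a derivative of order larger than the degree, or equal to it
  when \<open>l = l'\<close>.
\<close>

lemma legendre_orthogonal_le:
  assumes kl: "k \<le> l" "l \<le> l'"
  shows "cos_integral ([:1, 0, -1:] ^ k * ((pderiv ^^ k) (legendre l) * (pderiv ^^ k) (legendre l')))
    = (if l = l' then 2 / (2 * real l + 1) * (fact (l + k) / fact (l - k)) else 0)"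
proof -
  let ?w = "[:-1, 0, 1:] :: real poly"
  define c where "c l = 1 / (2 ^ l * fact l :: real)" for l
  define q where "q = ?w ^ k * (pderiv ^^ (l + k)) (?w ^ l)"
  have D: "(pderiv ^^ k) (legendre l) = smult (c l) ((pderiv ^^ (l + k)) (?w ^ l))" for l
    by (simp only: legendre_def c_def higher_pderiv_smult add.commute[of l k] funpow_add comp_apply)
  have neg: "[:1, 0, -1:] ^ k = smult ((-1) ^ k) (?w ^ k)"
  proof -
    have "[:1, 0, -1:] = smult (-1) ?w" by simp
    then show ?thesis by (simp only: smult_power)
  qed
  have deg_w: "degree (?w ^ j) = 2 * j" for j by (simp add: degree_power_eq)
  have lc_w: "coeff (?w ^ j) (2 * j) = 1" for j
    using lead_coeff_power[of ?w j] by (simp add: deg_w)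
  have deg_D: "degree ((pderiv ^^ (l + k)) (?w ^ l)) \<le> l - k"
    by (intro degree_le) (auto simp: coeff_higher_pderiv deg_w intro!: coeff_eq_0)
  have deg_q: "degree q \<le> l + k"
    unfolding q_def using degree_mult_le[of "?w ^ k" "(pderiv ^^ (l + k)) (?w ^ l)"] deg_D kl
    by (simp add: deg_w)
  have lc_q: "coeff q (l + k) = fact (2 * l) / fact (l - k)"
  proof -
    have lD: "coeff ((pderiv ^^ (l + k)) (?w ^ l)) (l - k) = fact (2 * l) / fact (l - k)"
      using kl lc_w[of l] by (simp add: coeff_higher_pderiv mult_2)
    then have "degree ((pderiv ^^ (l + k)) (?w ^ l)) = l - k"
      using deg_D le_degree[of "(pderiv ^^ (l + k)) (?w ^ l)" "l - k"] by simp
    then show ?thesis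
      using coeff_mult_degree_sum[of "?w ^ k" "(pderiv ^^ (l + k)) (?w ^ l)"] kl lD lc_w[of k]
      by (simp add: q_def deg_w) (metis add.commute)
  qed
  have "cos_integral (q * (pderiv ^^ (l' + k)) (?w ^ l'))
      = (-1) ^ (l' + k) * cos_integral ((pderiv ^^ (l' + k)) q * ?w ^ l')"
  proof (rule cos_integral_by_parts)
    fix j and x :: real assume j: "j < l' + k" and x: "x \<in> {-1, 1}"
    have x: "poly ?w x = 0" using x by auto
    show "poly ((pderiv ^^ j) q) x = 0 \<or> poly ((pderiv ^^ (l' + k - 1 - j)) (?w ^ l')) x = 0"
    proof (cases "j < k")
      case True
      then show ?thesis using poly_higher_pderiv_root[of ?w k q j x] x by (simp add: q_def)
    next
      case False
      then show ?thesis using poly_higher_pderiv_root[of ?w l' "?w ^ l'" "l' + k - 1 - j" x] x j by auto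
    qed
  qed
  also have "\<dots> = (if l = l' then (-1) ^ (l + k) * (fact (l + k) * (fact (2 * l) / fact (l - k)))
        * cos_integral (?w ^ l) else 0)"
  proof (cases "l = l'")
    case True
    show ?thesis using higher_pderiv_degree[OF deg_q] lc_q unfolding True[symmetric]
      by (simp add: cos_integral_smult)
  next
    case False
    then have "(pderiv ^^ (l' + k)) q = 0" using deg_q kl by (intro higher_pderiv_eq_0) simp
    then show ?thesis using False by (simp add: cos_integral_def)
  qed
  finally have q: "cos_integral (q * (pderiv ^^ (l' + k)) (?w ^ l')) = \<dots>" .
  have "[:1, 0, -1:] ^ k * ((pderiv ^^ k) (legendre l) * (pderiv ^^ k) (legendre l'))
      = smult ((-1) ^ k * c l * c l') (q * (pderiv ^^ (l' + k)) (?w ^ l'))"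
    unfolding D neg q_def by (simp add: mult_ac)
  then have *: "cos_integral ([:1, 0, -1:] ^ k * ((pderiv ^^ k) (legendre l) * (pderiv ^^ k) (legendre l')))
      = (-1) ^ k * c l * c l' * cos_integral (q * (pderiv ^^ (l' + k)) (?w ^ l'))"
    by (simp only: cos_integral_smult)
  show ?thesis
  proof (cases "l = l'")
    case True
    have sgn: "(-1) ^ k * (-1) ^ (l + k) * (-1) ^ l = (1 :: real)"
      by (cases "even k"; cases "even l") (simp_all add: power_add)
    have "cos_integral ([:1, 0, -1:] ^ k * ((pderiv ^^ k) (legendre l) * (pderiv ^^ k) (legendre l')))
      = ((-1) ^ k * (-1) ^ (l + k) * (-1) ^ l) * ((c l)\<^sup>2 * (fact (l + k) * (fact (2 * l) / fact (l - k)))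
         * (2 ^ (2 * l + 1) * (fact l)\<^sup>2 / fact (2 * l + 1)))"
      unfolding * q using True by (simp add: cos_integral_power power2_eq_square mult_ac)
    also have "\<dots> = 2 / (2 * real l + 1) * (fact (l + k) / fact (l - k))"
    proof -
      have 1: "(1 / (P * B))\<^sup>2 * (A * (F / D)) * (2 * P\<^sup>2 * B\<^sup>2 / (E * F)) = 2 / E * (A / D)"
        if "P \<noteq> 0" "B \<noteq> 0" "F \<noteq> 0" for P B A F D E :: real
        using that by (simp add: power2_eq_square mult.commute)
      have 2: "(2 :: real) ^ (2 * l + 1) = 2 * (2 ^ l)\<^sup>2" by (simp add: power_mult[symmetric] mult.commute)
      have 3: "fact (2 * l + 1) = (2 * real l + 1) * (fact (2 * l) :: real)" by (simp add: algebra_simps)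
      show ?thesis unfolding sgn c_def 2 3 mult_1_left by (rule 1) simp_all
    qed
    finally show ?thesis using True by simp
  next
    case False
    then show ?thesis unfolding * q by simp
  qed
qed

lemma legendre_orthogonal:
  assumes kl: "k \<le> l" "k \<le> l'"
  shows "cos_integral ([:1, 0, -1:] ^ k * ((pderiv ^^ k) (legendre l) * (pderiv ^^ k) (legendre l')))
    = (if l = l' then 2 / (2 * real l + 1) * (fact (l + k) / fact (l - k)) else 0)"
proof (cases "l \<le> l'")
  case False
  then show ?thesis using legendre_orthogonal_le[of k l' l] kl by (simp add: mult.commute)
qed (use legendre_orthogonal_le kl in simp)


section \<open>Orthonormality of the spherical harmonics\<close>

text \<open>
  The factor of \<open>Y_{l,m}\<close> that depends on the longitude, with the constant \<open>\<surd>2\<close> of the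
  definition of \<open>sph_harm\<close> included.
\<close>

definition azimuthal :: "int \<Rightarrow> real \<Rightarrow> real" where
  "azimuthal m \<phi> = (if m = 0 then 1 else if m > 0 then sqrt 2 * cos (real_of_int m * \<phi>)
     else sqrt 2 * sin (real_of_int (- m) * \<phi>))"

lemma azimuthal_continuous [continuous_intros]: "continuous_on A (azimuthal m)"
  unfolding azimuthal_def by (cases "m = 0"; cases "m > 0") (auto intro!: continuous_intros)

lemma integral_cos_period:
  "(LBINT \<phi>. cos (real_of_int j * \<phi>) * indicator {0..2*pi} \<phi>) = (if j = 0 then 2 * pi else 0)"
proof (cases "j = 0")
  case False
  have "(LBINT \<phi>. cos (real_of_int j * \<phi>) * indicator {0..2*pi} \<phi>)
      = sin (real_of_int j * (2 * pi)) / real_of_int j - sin (real_of_int j * 0) / real_of_int j"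
    using False by (intro integral_FTC_Icc_real) (auto intro!: derivative_eq_intros continuous_intros)
  then show ?thesis using False sin_int_2pin[of j] by (simp add: mult.commute mult.left_commute)
qed simp

lemma integral_sin_period:
  "(LBINT \<phi>. sin (real_of_int j * \<phi>) * indicator {0..2*pi} \<phi>) = 0"
proof (cases "j = 0")
  case False
  have "(LBINT \<phi>. sin (real_of_int j * \<phi>) * indicator {0..2*pi} \<phi>)
      = (- cos (real_of_int j * (2 * pi)) / real_of_int j) - (- cos (real_of_int j * 0) / real_of_int j)"
    using False by (intro integral_FTC_Icc_real) (auto intro!: derivative_eq_intros continuous_intros)
  then show ?thesis using False cos_int_2pin[of j] by (simp add: mult.commute mult.left_commute)
qed simp

text \<open>
  The product-to-sum formulas turn a product of two azimuthal factors into a combination of this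
  form.
\<close>

lemma integral_trig_period:
  fixes i j :: int and a b c d :: real
  shows "(LBINT \<phi>. (a * cos (real_of_int i * \<phi>) + b * cos (real_of_int j * \<phi>)
      + (c * sin (real_of_int i * \<phi>) + d * sin (real_of_int j * \<phi>))) * indicator {0..2*pi} \<phi>)
    = a * (if i = 0 then 2 * pi else 0) + b * (if j = 0 then 2 * pi else 0)"
proof -
  note int = integrable_Icc[of "\<lambda>\<phi>. cos (real_of_int i * \<phi>)" for i, OF continuous_on_cos[OF continuous_on_mult_left[OF continuous_on_id]]]
    integrable_Icc[of "\<lambda>\<phi>. sin (real_of_int i * \<phi>)" for i, OF continuous_on_sin[OF continuous_on_mult_left[OF continuous_on_id]]]
  show ?thesis
    by (simp add: distrib_right mult.assoc Bochner_Integration.integral_add Bochner_Integration.integrable_add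
        int integral_cos_period integral_sin_period)
qed

lemma azimuthal_orthogonal:
  "(LBINT \<phi>. azimuthal m \<phi> * azimuthal n \<phi> * indicator {0..2*pi} \<phi>) = (if m = n then 2 * pi else 0)"
proof -
  define s where "s = (\<lambda>m::int. if m = 0 then 1 else sqrt (2::real))"
  have az: "azimuthal m \<phi> = s m * (if m \<ge> 0 then cos (real_of_int \<bar>m\<bar> * \<phi>) else sin (real_of_int \<bar>m\<bar> * \<phi>))" for m \<phi>
    by (auto simp: azimuthal_def s_def)
  \<comment> \<open>Product-to-sum formulas in the form required by \<open>integral_trig_period\<close>, with explicit zero coefficients.\<close>
  have cc: "(p * cos x) * (q * cos y) = p * q / 2 * cos (x - y) + p * q / 2 * cos (x + y) + (0 * sin (x - y) + 0 * sin (x + y))"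
    and ss: "(p * sin x) * (q * sin y) = p * q / 2 * cos (x - y) + - (p * q / 2) * cos (x + y) + (0 * sin (x - y) + 0 * sin (x + y))"
    and sc: "(p * sin x) * (q * cos y) = 0 * cos (x - y) + 0 * cos (x + y) + (p * q / 2 * sin (x - y) + p * q / 2 * sin (x + y))"
    and cs: "(p * cos x) * (q * sin y) = 0 * cos (x - y) + 0 * cos (x + y) + (- (p * q / 2) * sin (x - y) + p * q / 2 * sin (x + y))"
    for x y p q :: real
    by (simp_all add: cos_add cos_diff sin_add sin_diff field_simps)
  have prod: "\<exists>a b c d. (\<forall>\<phi>. azimuthal m \<phi> * azimuthal n \<phi>
      = a * cos (real_of_int (\<bar>m\<bar> - \<bar>n\<bar>) * \<phi>) + b * cos (real_of_int (\<bar>m\<bar> + \<bar>n\<bar>) * \<phi>)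
      + (c * sin (real_of_int (\<bar>m\<bar> - \<bar>n\<bar>) * \<phi>) + d * sin (real_of_int (\<bar>m\<bar> + \<bar>n\<bar>) * \<phi>)))
      \<and> a * (if \<bar>m\<bar> - \<bar>n\<bar> = 0 then 2 * pi else 0) + b * (if \<bar>m\<bar> + \<bar>n\<bar> = 0 then 2 * pi else 0)
        = (if m = n then 2 * pi else 0)" (is "\<exists>a b c d. ?P a b c d")
  proof -
    note dist = of_int_diff of_int_add left_diff_distrib distrib_right
    consider "m \<ge> 0" "n \<ge> 0" | "m \<ge> 0" "n < 0" | "m < 0" "n \<ge> 0" | "m < 0" "n < 0" by linarith
    then show ?thesis
    proof cases
      case 1
      then have "?P (s m * s n / 2) (s m * s n / 2) 0 0"
        unfolding dist az cc[symmetric] by (auto simp: s_def)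
      then show ?thesis by blast
    next
      case 2
      then have "?P 0 0 (- (s m * s n / 2)) (s m * s n / 2)"
        unfolding dist az cs[symmetric] by auto
      then show ?thesis by blast
    next
      case 3
      then have "?P 0 0 (s m * s n / 2) (s m * s n / 2)"
        unfolding dist az sc[symmetric] by auto
      then show ?thesis by blast
    next
      case 4
      then have "?P (s m * s n / 2) (- (s m * s n / 2)) 0 0"
        unfolding dist az ss[symmetric] by (auto simp: s_def)
      then show ?thesis by blast
    qed
  qed
  then obtain a b c d where abcd: "\<And>\<phi>. azimuthal m \<phi> * azimuthal n \<phi>
      = a * cos (real_of_int (\<bar>m\<bar> - \<bar>n\<bar>) * \<phi>) + b * cos (real_of_int (\<bar>m\<bar> + \<bar>n\<bar>) * \<phi>)
      + (c * sin (real_of_int (\<bar>m\<bar> - \<bar>n\<bar>) * \<phi>) + d * sin (real_of_int (\<bar>m\<bar> + \<bar>n\<bar>) * \<phi>))"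
    "a * (if \<bar>m\<bar> - \<bar>n\<bar> = 0 then 2 * pi else 0) + b * (if \<bar>m\<bar> + \<bar>n\<bar> = 0 then 2 * pi else 0)
        = (if m = n then 2 * pi else 0)"
    by metis
  show ?thesis unfolding abcd(1) integral_trig_period abcd(2) ..
qed

lemma integral_lborel_product:
  fixes a b :: "real \<Rightarrow> real"
  assumes a: "integrable lborel a" and b: "integrable lborel b"
  shows "integrable lborel (\<lambda>(x, y). a x * b y)"
    and "(\<integral>p. (case p of (x, y) \<Rightarrow> a x * b y) \<partial>lborel) = (LBINT x. a x) * (LBINT y. b y)"
proof -
  have [measurable]: "a \<in> borel_measurable borel" "b \<in> borel_measurable borel"
    using a b by (auto dest: borel_measurable_integrable)
  have int: "integrable (lborel \<Otimes>\<^sub>M lborel) (\<lambda>(x, y). a x * b y)"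
    using a b by (intro lborel_pair.Fubini_integrable) (auto simp: abs_mult)
  then show "integrable lborel (\<lambda>(x, y). a x * b y)" by (simp add: lborel_prod)
  show "(\<integral>p. (case p of (x, y) \<Rightarrow> a x * b y) \<partial>lborel) = (LBINT x. a x) * (LBINT y. b y)"
    using lborel_pair.integral_fst'[OF int] by (simp add: lborel_prod)
qed

lemma sphere_param_measurable [measurable]:
  "sphere_param \<in> measurable borel (restrict_space borel (sphere 0 1))"
proof (rule measurable_restrict_space2)
  have "(norm (sphere_param p))\<^sup>2 = 1" for p
    by (cases p) (simp add: sphere_param_def norm_vec_def L2_set_def sum_3 power_mult_distrib
      sum_nonneg flip: distrib_left)
  then have "norm (sphere_param p) = 1" for p
    by (metis norm_ge_zero one_power2 power2_eq_imp_eq zero_le_one)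
  then show "sphere_param \<in> space borel \<rightarrow> sphere 0 1" by (intro Pi_I) (simp only: mem_sphere_0)
  have "continuous_on UNIV (\<lambda>p. sphere_param p \<bullet> i)" if i: "i \<in> Basis" for i
  proof -
    obtain j where j: "i = axis j 1" using i by (auto simp: Basis_vec_def)
    have p: "sphere_param p $ 1 = sin (fst p) * cos (snd p)"
      "sphere_param p $ 2 = sin (fst p) * sin (snd p)" "sphere_param p $ 3 = cos (fst p)" for p
      by (simp_all add: sphere_param_def split_beta)
    have "continuous_on UNIV (\<lambda>p. sphere_param p $ j)"
      using exhaust_3[of j] by (auto simp only: p intro!: continuous_on_mult continuous_on_sin
        continuous_on_cos continuous_on_fst continuous_on_snd continuous_on_id)
    then show ?thesis by (simp add: j inner_axis)
  qed
  then have "continuous_on UNIV sphere_param"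
    by (rule continuous_on_componentwise[THEN iffD2, rule_format])
  then show "sphere_param \<in> borel_measurable borel" by (rule borel_measurable_continuous_onI)
qed

lemma sets_sphere_measure [measurable_cong]:
  "sets sphere_measure = sets (restrict_space borel (sphere 0 1))"
  by (simp add: sphere_measure_def)

text \<open>
  Fubini's theorem in polar coordinates.  The longitude of the surface measure ranges over
  \<open>[0, 2\<pi>)\<close>; the endpoint \<open>2\<pi>\<close>, a null set, is added for the fundamental theorem of calculus.
\<close>

lemma sphere_integral_product:
  assumes f [measurable]: "f \<in> borel_measurable sphere_measure"
    and eq: "\<And>\<theta> \<phi>. f (sphere_param (\<theta>, \<phi>)) = a \<theta> * b \<phi>"
    and a: "continuous_on UNIV a" and b: "continuous_on UNIV b"
  shows "integrable sphere_measure f"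
    and "(\<integral>x. f x \<partial>sphere_measure)
      = (LBINT \<theta>. a \<theta> * sin \<theta> * indicator {0..pi} \<theta>) * (LBINT \<phi>. b \<phi> * indicator {0..2*pi} \<phi>)"
proof -
  define g where "g = (\<lambda>p::real \<times> real. sin (fst p) * indicator ({0..pi} \<times> {0..<2 * pi}) p)"
  have [measurable]: "f \<in> borel_measurable (restrict_space borel (sphere 0 1))"
    using f by (simp cong: measurable_cong_sets add: sets_sphere_measure)
  have [measurable]: "g \<in> borel_measurable borel"
    unfolding g_def
    by (intro borel_measurable_times borel_measurable_continuous_onI[of "\<lambda>p. sin (fst p)"]
        borel_measurable_indicator borel_Times continuous_intros) auto
  have dens: "(\<lambda>(\<theta>, \<phi>). ennreal (sin \<theta>) * indicator ({0..pi} \<times> {0..<2 * pi}) (\<theta>, \<phi>)) = (\<lambda>p. ennreal (g p))"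
    by (auto simp: g_def indicator_def fun_eq_iff)
  have g: "g p \<ge> 0" for p by (auto simp: g_def indicator_def sin_ge_zero)
  have b1: "integrable lborel (\<lambda>\<phi>. b \<phi> * indicator {0..<2 * pi} \<phi>)"
    and b2: "(LBINT \<phi>. b \<phi> * indicator {0..<2 * pi} \<phi>) = (LBINT \<phi>. b \<phi> * indicator {0..2*pi} \<phi>)"
  proof -
    have [measurable]: "b \<in> borel_measurable borel" using b by (rule borel_measurable_continuous_onI)
    have ae: "AE \<phi> in lborel. b \<phi> * indicator {0..<2 * pi} \<phi> = b \<phi> * indicator {0..2*pi} \<phi>"
      using AE_lborel_singleton[of "2 * pi"] by eventually_elim (auto simp: indicator_def)
    show "(LBINT \<phi>. b \<phi> * indicator {0..<2 * pi} \<phi>) = (LBINT \<phi>. b \<phi> * indicator {0..2*pi} \<phi>)"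
      by (rule integral_cong_AE) (use ae in auto)
    show "integrable lborel (\<lambda>\<phi>. b \<phi> * indicator {0..<2 * pi} \<phi>)"
      using integrable_Icc[OF b, of 0 "2 * pi"] ae by (subst integrable_cong_AE[OF _ _ ae]) auto
  qed
  have a1: "integrable lborel (\<lambda>\<theta>. a \<theta> * sin \<theta> * indicator {0..pi} \<theta>)"
    by (intro integrable_Icc continuous_intros a)
  have gf: "(\<lambda>p. g p * f (sphere_param p))
      = (\<lambda>(\<theta>, \<phi>). (a \<theta> * sin \<theta> * indicator {0..pi} \<theta>) * (b \<phi> * indicator {0..<2 * pi} \<phi>))"
    by (auto simp: fun_eq_iff g_def eq indicator_def)
  note prod = integral_lborel_product[OF a1 b1]
  let ?D = "density lborel (\<lambda>p. ennreal (g p))"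
  have T: "sphere_param \<in> measurable ?D (restrict_space borel (sphere 0 1))" by simp
  have fm: "f \<in> borel_measurable (restrict_space borel (sphere 0 1))" by measurable
  have fT: "(\<lambda>p. f (sphere_param p)) \<in> borel_measurable lborel" by measurable
  have gm: "g \<in> borel_measurable lborel" by simp
  have g0: "AE p in lborel. 0 \<le> g p" using g by simp
  have "integrable ?D (\<lambda>p. f (sphere_param p))"
    using prod(1) unfolding integrable_density[OF fT gm g0] real_scaleR_def gf .
  then show "integrable sphere_measure f"
    unfolding sphere_measure_def dens integrable_distr_eq[OF T fm] .
  have "(\<integral>p. f (sphere_param p) \<partial>?D)
      = (LBINT \<theta>. a \<theta> * sin \<theta> * indicator {0..pi} \<theta>) * (LBINT \<phi>. b \<phi> * indicator {0..2*pi} \<phi>)"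
    using prod(2) unfolding integral_density[OF fT gm g0] real_scaleR_def gf b2 .
  moreover have "(\<integral>x. f x \<partial>sphere_measure) = (\<integral>p. f (sphere_param p) \<partial>?D)"
    unfolding sphere_measure_def dens by (rule integral_distr[OF T fm])
  ultimately show "(\<integral>x. f x \<partial>sphere_measure)
      = (LBINT \<theta>. a \<theta> * sin \<theta> * indicator {0..pi} \<theta>) * (LBINT \<phi>. b \<phi> * indicator {0..2*pi} \<phi>)"
    by (rule trans[rotated])
qed

lemma sph_harm_measurable [measurable]: "sph_harm l m \<in> borel_measurable sphere_measure"
proof -
  have z: "continuous_on UNIV (\<lambda>x :: real ^ 3. Complex (x $ 1) (x $ 2) ^ k)" for k
    unfolding Complex_eq
    by (intro continuous_on_power continuous_on_add continuous_on_mult continuous_on_of_real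
        continuous_on_const continuous_on_component continuous_on_id)
  have "continuous_on UNIV (\<lambda>x :: real ^ 3. Re (Complex (x $ 1) (x $ 2) ^ k))"
    "continuous_on UNIV (\<lambda>x :: real ^ 3. Im (Complex (x $ 1) (x $ 2) ^ k))" for k
    by (intro continuous_on_Re continuous_on_Im z)+
  then have "continuous_on UNIV (\<lambda>x :: real ^ 3. if m = 0 then 1 else if m > 0
      then sqrt 2 * Re (Complex (x $ 1) (x $ 2) ^ k) else sqrt 2 * Im (Complex (x $ 1) (x $ 2) ^ k))" for k
    by (cases "m = 0"; cases "m > 0") (simp_all add: continuous_on_mult_left)
  then have "continuous_on UNIV (sph_harm l m)"
    unfolding sph_harm_def Let_def by (intro continuous_on_mult continuous_on_const continuous_on_poly continuous_on_component continuous_on_id)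
  then have "sph_harm l m \<in> borel_measurable (restrict_space borel (sphere 0 1))"
    by (intro measurable_restrict_space1 borel_measurable_continuous_onI)
  then show ?thesis by (simp cong: measurable_cong_sets add: sets_sphere_measure)
qed

lemma sph_harm_polar:
  fixes l :: nat and m :: int
  defines "k \<equiv> nat \<bar>m\<bar>"
  shows "sph_harm l m (sphere_param (\<theta>, \<phi>))
    = (sqrt ((2 * real l + 1) / (4 * pi) * (fact (l - k) / fact (l + k)))
       * ((- 1) ^ k * poly ((pderiv ^^ k) (legendre l)) (cos \<theta>)) * sin \<theta> ^ k) * azimuthal m \<phi>"
proof -
  have "Complex (sin \<theta> * cos \<phi>) (sin \<theta> * sin \<phi>) = of_real (sin \<theta>) * cis \<phi>"
    by (simp add: complex_eq_iff)
  then have z: "Complex (sin \<theta> * cos \<phi>) (sin \<theta> * sin \<phi>) ^ k = of_real (sin \<theta> ^ k) * cis (real k * \<phi>)"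
    by (simp add: power_mult_distrib Complex.DeMoivre)
  have k: "m > 0 \<Longrightarrow> real_of_int m = real k" "m < 0 \<Longrightarrow> real_of_int m = - real k" "m = 0 \<Longrightarrow> k = 0"
    by (auto simp: k_def)
  show ?thesis
    unfolding sph_harm_def Let_def k_def[symmetric] sphere_param_def azimuthal_def
    using k by (auto simp: z simp del: of_real_power)
qed

text \<open>
  In polar coordinates the product of two spherical harmonics separates.  The longitude decides
  whether the orders \<open>m\<close> agree; if they do, the latitude integral is the one of the associated
  Legendre functions.
\<close>

lemma sph_harm_orthonormal:
  assumes m: "m \<in> {- int l..int l}" and m': "m' \<in> {- int l'..int l'}"
  shows "integrable sphere_measure (\<lambda>x. sph_harm l m x * sph_harm l' m' x)"
    and "(\<integral>x. sph_harm l m x * sph_harm l' m' x \<partial>sphere_measure) = (if l = l' \<and> m = m' then 1 else 0)"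
proof -
  define N where "N l k = sqrt ((2 * real l + 1) / (4 * pi) * (fact (l - k) / fact (l + k)))" for l k
  define A where "A l k \<theta> = N l k * ((- 1) ^ k * poly ((pderiv ^^ k) (legendre l)) (cos \<theta>)) * sin \<theta> ^ k"
    for l k \<theta>
  let ?k = "nat \<bar>m\<bar>" and ?k' = "nat \<bar>m'\<bar>"
  have cont: "continuous_on UNIV (\<lambda>\<theta>. A l ?k \<theta> * A l' ?k' \<theta>)"
    "continuous_on UNIV (\<lambda>\<phi>. azimuthal m \<phi> * azimuthal m' \<phi>)"
    unfolding A_def by (intro continuous_intros)+
  have sep: "sph_harm l m (sphere_param (\<theta>, \<phi>)) * sph_harm l' m' (sphere_param (\<theta>, \<phi>))
      = (A l ?k \<theta> * A l' ?k' \<theta>) * (azimuthal m \<phi> * azimuthal m' \<phi>)" for \<theta> \<phi>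
    by (simp add: sph_harm_polar A_def N_def)
  have meas: "(\<lambda>x. sph_harm l m x * sph_harm l' m' x) \<in> borel_measurable sphere_measure" by measurable
  note int = sphere_integral_product[OF meas sep cont]
  show "integrable sphere_measure (\<lambda>x. sph_harm l m x * sph_harm l' m' x)" by (rule int(1))
  show "(\<integral>x. sph_harm l m x * sph_harm l' m' x \<partial>sphere_measure) = (if l = l' \<and> m = m' then 1 else 0)"
  proof (cases "m = m'")
    case False
    then show ?thesis unfolding int(2) azimuthal_orthogonal by simp
  next
    case True
    have k: "?k \<le> l" "?k \<le> l'" using m m' True by auto
    let ?p = "[:1, 0, -1:] ^ ?k * ((pderiv ^^ ?k) (legendre l) * (pderiv ^^ ?k) (legendre l'))"
    have "A l ?k \<theta> * A l' ?k \<theta> = N l ?k * N l' ?k * poly ?p (cos \<theta>)" for \<theta>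
    proof -
      have "sin \<theta> ^ ?k * sin \<theta> ^ ?k = (1 - cos \<theta> * cos \<theta>) ^ ?k"
        by (metis power_mult_distrib sin_squared_eq power2_eq_square)
      moreover have "(- 1) ^ ?k * (- 1) ^ ?k = (1 :: real)" by (simp flip: power_mult_distrib)
      moreover have "A l ?k \<theta> * A l' ?k \<theta> = N l ?k * N l' ?k * (((- 1) ^ ?k * (- 1) ^ ?k) * (sin \<theta> ^ ?k * sin \<theta> ^ ?k) *
         (poly ((pderiv ^^ ?k) (legendre l)) (cos \<theta>) * poly ((pderiv ^^ ?k) (legendre l')) (cos \<theta>)))"
        by (simp add: A_def)
      ultimately show ?thesis by (simp add: poly_power)
    qed
    then have "(LBINT \<theta>. A l ?k \<theta> * A l' ?k \<theta> * sin \<theta> * indicator {0..pi} \<theta>)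
        = N l ?k * N l' ?k * cos_integral ?p"
      unfolding cos_integral_def by (simp add: mult.assoc)
    also have "\<dots> = (if l = l' then (N l ?k)\<^sup>2 * (2 / (2 * real l + 1) * (fact (l + ?k) / fact (l - ?k))) else 0)"
      by (simp add: legendre_orthogonal[OF k] power2_eq_square)
    also have "\<dots> = (if l = l' then 1 / (2 * pi) else 0)"
    proof -
      have "c / (4 * p) * (a / b) * (2 / c * (b / a)) = 1 / (2 * p)"
        if "c > 0" "a \<noteq> 0" "b \<noteq> 0" for a b c p :: real
        using that by (simp add: field_simps)
      then show ?thesis by (simp add: N_def)
    qed
    finally show ?thesis unfolding int(2) azimuthal_orthogonal using True by auto
  qed
qed


lemma sphere_L2_norm_power2: "(sphere_L2_norm f)\<^sup>2 = (\<integral>\<^sup>+x. ennreal ((f x)\<^sup>2) \<partial>sphere_measure)"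
  unfolding sphere_L2_norm_def L2_norm_power2 abs_norm_power2 ..

text \<open>
  Parseval's identity for a finite expansion.
\<close>

lemma sphere_L2_norm_sph_harm_sum:
  "(sphere_L2_norm (\<lambda>x. \<Sum>l\<le>\<kappa>. \<Sum>m\<in>{- int l..int l}. c l m * sph_harm l m x))\<^sup>2
    = (\<Sum>l\<le>\<kappa>. \<Sum>m\<in>{- int l..int l}. ennreal ((c l m)\<^sup>2))"
proof -
  define I where "I = Sigma {..\<kappa>} (\<lambda>l. {- int l..int l})"
  have fin: "finite I" by (simp add: I_def)
  have I: "i \<in> I \<Longrightarrow> snd i \<in> {- int (fst i)..int (fst i)}" for i by (auto simp: I_def)
  have S: "(\<Sum>l\<le>\<kappa>. \<Sum>m\<in>{- int l..int l}. u l m) = (\<Sum>i\<in>I. u (fst i) (snd i))"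
    for u :: "nat \<Rightarrow> int \<Rightarrow> real"
    unfolding I_def by (subst sum.Sigma) (auto simp: split_beta)
  let ?Y = "\<lambda>i x. sph_harm (fst i) (snd i) x" and ?c = "\<lambda>i. c (fst i) (snd i)"
  have sq: "(\<Sum>i\<in>I. ?c i * ?Y i x)\<^sup>2 = (\<Sum>i\<in>I. \<Sum>j\<in>I. ?c i * ?c j * (?Y i x * ?Y j x))" for x
    unfolding power2_eq_square sum_product by (simp add: mult_ac)
  have orth: "integrable sphere_measure (\<lambda>x. ?Y i x * ?Y j x)"
    "(\<integral>x. ?Y i x * ?Y j x \<partial>sphere_measure) = (if i = j then 1 else 0)" if "i \<in> I" "j \<in> I" for i j
    using sph_harm_orthonormal[OF I I, OF that] by (auto simp: prod_eq_iff)
  have int: "integrable sphere_measure (\<lambda>x. (\<Sum>i\<in>I. ?c i * ?Y i x)\<^sup>2)"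
    unfolding sq by (intro Bochner_Integration.integrable_sum integrable_mult_right orth)
  have "(\<integral>x. (\<Sum>i\<in>I. ?c i * ?Y i x)\<^sup>2 \<partial>sphere_measure)
      = (\<Sum>i\<in>I. \<Sum>j\<in>I. ?c i * ?c j * (if i = j then 1 else 0))"
    unfolding sq by (simp add: orth Bochner_Integration.integral_sum Bochner_Integration.integrable_sum
        cong: sum.cong)
  also have "\<dots> = (\<Sum>i\<in>I. (?c i)\<^sup>2)" using fin by (simp add: power2_eq_square if_distrib cong: if_cong)
  finally have "(\<integral>\<^sup>+x. ennreal ((\<Sum>i\<in>I. ?c i * ?Y i x)\<^sup>2) \<partial>sphere_measure) = ennreal (\<Sum>i\<in>I. (?c i)\<^sup>2)"
    using int by (subst nn_integral_eq_integral) auto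
  then show ?thesis
    unfolding sphere_L2_norm_power2 S using S[of "\<lambda>l m. (c l m)\<^sup>2"] by (simp add: sum_nonneg)
qed

lemma integrable_mult_of_squares:
  fixes f g :: "'a \<Rightarrow> real"
  assumes [measurable]: "f \<in> borel_measurable M" "g \<in> borel_measurable M"
    and "integrable M (\<lambda>x. (f x)\<^sup>2)" "integrable M (\<lambda>x. (g x)\<^sup>2)"
  shows "integrable M (\<lambda>x. f x * g x)"
proof (rule Bochner_Integration.integrable_bound)
  show "integrable M (\<lambda>x. (f x)\<^sup>2 + (g x)\<^sup>2)" using assms by simp
  have "\<bar>f x * g x\<bar> \<le> (f x)\<^sup>2 + (g x)\<^sup>2" for x
  proof -
    have "2 * (\<bar>f x\<bar> * \<bar>g x\<bar>) \<le> (f x)\<^sup>2 + (g x)\<^sup>2"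
      using sum_squares_bound[of "\<bar>f x\<bar>" "\<bar>g x\<bar>"] by simp
    moreover have "0 \<le> \<bar>f x\<bar> * \<bar>g x\<bar>" by simp
    ultimately show ?thesis unfolding abs_mult by linarith
  qed
  then show "AE x in M. norm (f x * g x) \<le> norm ((f x)\<^sup>2 + (g x)\<^sup>2)" by simp
qed measurable

text \<open>
  By the Cauchy--Schwarz inequality and the normalisation of \<open>Y_{l,m}\<close>, the coefficient is
  Lipschitz with constant \<open>1\<close> for the norm of \<open>L\<^sup>2\<close>.
\<close>

lemma sph_coeff_measurable:
  assumes m: "m \<in> {- int l..int l}"
  shows "(\<lambda>f. sph_coeff f l m) \<in> borel_measurable sphere_L2_borel"
  unfolding sphere_L2_borel_def
proof (rule norm_borel_measurableI[of 1])
  fix f g assume "f \<in> sphere_L2" "g \<in> sphere_L2"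
  then have [measurable]: "f \<in> borel_measurable sphere_measure" "g \<in> borel_measurable sphere_measure"
    and fin: "sphere_L2_norm f < \<top>" "sphere_L2_norm g < \<top>"
    by (auto simp: sphere_L2_def)
  have Y2: "integrable sphere_measure (\<lambda>x. (sph_harm l m x)\<^sup>2)"
    "(\<integral>\<^sup>+x. ennreal ((sph_harm l m x)\<^sup>2) \<partial>sphere_measure) = 1"
    using sph_harm_orthonormal[OF m m] by (auto simp: power2_eq_square nn_integral_eq_integral)
  have int: "integrable sphere_measure (\<lambda>x. u x * sph_harm l m x)"
    if [measurable]: "u \<in> borel_measurable sphere_measure" and u: "sphere_L2_norm u < \<top>" for u
  proof (rule integrable_mult_of_squares)
    have "(sphere_L2_norm u)\<^sup>2 < \<top>" using u by (simp add: power_less_top_ennreal)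
    then show "integrable sphere_measure (\<lambda>x. (u x)\<^sup>2)"
      unfolding sphere_L2_norm_power2 by (intro integrableI_nonneg) auto
  qed (use Y2 in auto)
  have d: "integrable sphere_measure (\<lambda>x. (g x - f x) * sph_harm l m x)"
    using int[of f] int[of g] fin by (simp add: left_diff_distrib)
  have eq: "sph_coeff g l m - sph_coeff f l m = (\<integral>x. (g x - f x) * sph_harm l m x \<partial>sphere_measure)"
    using int[of f] int[of g] fin m by (simp add: left_diff_distrib sph_coeff_def abs_le_iff)
  have "(ennreal \<bar>sph_coeff g l m - sph_coeff f l m\<bar>)\<^sup>2
      \<le> (\<integral>\<^sup>+x. ennreal \<bar>g x - f x\<bar> * ennreal \<bar>sph_harm l m x\<bar> \<partial>sphere_measure)\<^sup>2"
    unfolding eq using integral_norm_bound_ennreal[OF d]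
    by (intro power_mono) (simp_all add: abs_mult ennreal_mult)
  also have "\<dots> \<le> (\<integral>\<^sup>+x. (ennreal \<bar>g x - f x\<bar>)\<^sup>2 \<partial>sphere_measure)
      * (\<integral>\<^sup>+x. (ennreal \<bar>sph_harm l m x\<bar>)\<^sup>2 \<partial>sphere_measure)"
    by (rule Cauchy_Schwarz_nn_integral) measurable
  also have "\<dots> = (sphere_L2_norm (g - f))\<^sup>2"
    unfolding sphere_L2_norm_power2 by (simp add: ennreal_power Y2)
  finally show "ennreal \<bar>sph_coeff g l m - sph_coeff f l m\<bar> \<le> ennreal 1 * sphere_L2_norm (g - f)"
    by (auto intro: ennreal_power2_le_imp_le)
qed simp


section \<open>Second moments of square-integrable Levy processes\<close>

text \<open>
  Additivity determines \<open>f\<close> on the rationals; boundedness near \<open>0\<close> excludes the pathological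
  solutions of Cauchy's functional equation.
\<close>

lemma additive_bounded_imp_linear:
  fixes f :: "real \<Rightarrow> real"
  assumes add: "\<And>s t. 0 \<le> s \<Longrightarrow> 0 \<le> t \<Longrightarrow> f (s + t) = f s + f t"
    and d: "d > 0" and bd: "\<And>t. 0 < t \<Longrightarrow> t < d \<Longrightarrow> \<bar>f t\<bar> \<le> B" and t: "0 \<le> t"
  shows "f t = t * f 1"
proof -
  \<comment> \<open>Subtracting the linear part leaves an additive function that vanishes on the nonnegative rationals.\<close>
  define g where "g t = f t - t * f 1" for t
  have gadd: "g (s + t) = g s + g t" if "0 \<le> s" "0 \<le> t" for s t
    using add[OF that] by (simp add: g_def algebra_simps)
  have g0: "g 0 = 0" using gadd[of 0 0] by simp
  have gn: "g (real n * t) = real n * g t" if "0 \<le> t" for n t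
  proof (induction n)
    case (Suc n)
    have "g (real n * t + t) = g (real n * t) + g t" using that by (intro gadd) auto
    then show ?case using Suc by (simp add: algebra_simps)
  qed (simp add: g0)
  obtain m where m: "m > 0" "inverse (real m) < d" using reals_Archimedean[OF d] by (metis zero_less_Suc)
  have grat: "g (real k / real m) = 0" for k
  proof -
    have "real m * g (real k / real m) = g (real k)" using gn[of "real k / real m" m] m by simp
    also have "\<dots> = real k * g 1" using gn[of 1 k] by simp
    finally show ?thesis using m by (simp add: g_def)
  qed
  have bound: "\<bar>g u\<bar> \<le> B + d * \<bar>f 1\<bar>" if u: "0 \<le> u" for u
  proof -
    \<comment> \<open>A multiple of \<open>1/m\<close> within distance \<open>d\<close> below \<open>u\<close>, so that \<open>g u\<close> equals a value of \<open>g\<close> near \<open>0\<close>.\<close>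
    define k where "k = nat \<lfloor>u * real m\<rfloor>"
    define r where "r = u - real k / real m"
    have k: "real k \<le> u * real m" "u * real m < real k + 1"
      using u by (simp_all add: k_def)
    then have r: "0 \<le> r" "r < d" using m by (simp_all add: r_def field_simps) 
    have "g u = g (real k / real m) + g r" using gadd[of "real k / real m" r] r by (simp add: r_def)
    then have gu: "g u = g r" by (simp add: grat)
    have "B \<ge> 0" using bd[of "d / 2"] d by auto
    show ?thesis
    proof (cases "r = 0")
      case True then show ?thesis using gu g0 \<open>B \<ge> 0\<close> d by simp
    next
      case False
      have "\<bar>g r\<bar> \<le> \<bar>f r\<bar> + \<bar>r * f 1\<bar>" unfolding g_def by (rule abs_triangle_ineq4)
      moreover have "\<bar>f r\<bar> \<le> B" using bd[of r] r False by simp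
      moreover have "\<bar>r * f 1\<bar> \<le> d * \<bar>f 1\<bar>" using r by (simp add: abs_mult mult_right_mono)
      ultimately show ?thesis using gu by simp
    qed
  qed
  have "g t = 0"
  proof (rule ccontr)
    assume "g t \<noteq> 0"
    \<comment> \<open>\<open>g\<close> is bounded on all of \<open>[0,\<infinity>)\<close>, but grows linearly along the multiples of \<open>t\<close>.\<close>
    then obtain n where n: "real n * \<bar>g t\<bar> > B + d * \<bar>f 1\<bar>"
      using ex_less_of_nat_mult[of "\<bar>g t\<bar>" "B + d * \<bar>f 1\<bar>"] by auto
    have "real n * \<bar>g t\<bar> = \<bar>g (real n * t)\<bar>" by (simp add: gn[OF t] abs_mult)
    also have "\<dots> \<le> B + d * \<bar>f 1\<bar>" using t by (intro bound) auto
    finally show False using n by simp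
  qed
  then show ?thesis by (simp add: g_def)
qed

text \<open>
  The part of the definition of a Levy process that determines its first two moments.  Stochastic
  continuity at time \<open>0\<close> rules out means that are not linear in time.
\<close>

locale square_integrable_levy = prob_space M for M :: "'w measure" +
  fixes Z :: "real \<Rightarrow> 'w \<Rightarrow> real"
  assumes meas: "t \<ge> 0 \<Longrightarrow> Z t \<in> borel_measurable M"
    and zero: "AE \<omega> in M. Z 0 \<omega> = 0"
    and sq_int: "t \<ge> 0 \<Longrightarrow> integrable M (\<lambda>\<omega>. (Z t \<omega>)\<^sup>2)"
    and indep: "0 < s \<Longrightarrow> s < t \<Longrightarrow> indep_var borel (\<lambda>\<omega>. Z s \<omega> - Z 0 \<omega>) borel (\<lambda>\<omega>. Z t \<omega> - Z s \<omega>)"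
    and stationary: "s \<ge> 0 \<Longrightarrow> t \<ge> 0 \<Longrightarrow> distr M borel (\<lambda>\<omega>. Z (s + t) \<omega> - Z s \<omega>) = distr M borel (Z t)"
    and small: "e > 0 \<Longrightarrow> ((\<lambda>t. prob {\<omega> \<in> space M. \<bar>Z t \<omega>\<bar> > e}) \<longlongrightarrow> 0) (at_right 0)"
begin

lemma integrable_Z: "t \<ge> 0 \<Longrightarrow> integrable M (Z t)"
  using square_integrable_imp_integrable[OF meas sq_int] by simp

lemma integrable_ZZ: "s \<ge> 0 \<Longrightarrow> t \<ge> 0 \<Longrightarrow> integrable M (\<lambda>\<omega>. Z s \<omega> * Z t \<omega>)"
  by (intro integrable_mult_of_squares meas sq_int)

abbreviation "mean \<equiv> expectation (Z 1)"

abbreviation "vari \<equiv> expectation (\<lambda>\<omega>. (Z 1 \<omega> - mean)\<^sup>2)"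

lemma vari_nonneg: "vari \<ge> 0" by simp

lemma integral_zero: "t \<ge> 0 \<Longrightarrow> expectation (\<lambda>\<omega>. Z 0 \<omega> * Z t \<omega>) = 0" "expectation (Z 0) = 0"
  using zero meas by (auto intro!: integral_eq_zero_AE elim: eventually_mono)

lemma expectation_add:
  assumes "s \<ge> 0" "t \<ge> 0"
  shows "expectation (Z (s + t)) = expectation (Z s) + expectation (Z t)"
proof -
  have [measurable]: "Z s \<in> borel_measurable M" "Z t \<in> borel_measurable M" "Z (s + t) \<in> borel_measurable M"
    using assms by (auto intro: meas)
  have "expectation (\<lambda>\<omega>. Z (s + t) \<omega> - Z s \<omega>) = integral\<^sup>L (distr M borel (\<lambda>\<omega>. Z (s + t) \<omega> - Z s \<omega>)) (\<lambda>x. x)"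
    by (subst integral_distr) auto
  also have "\<dots> = expectation (Z t)"
    unfolding stationary[OF assms] by (subst integral_distr) auto
  finally show ?thesis using assms by (simp add: integrable_Z)
qed

lemma expectation_increment_sq:
  assumes "s \<ge> 0" "t \<ge> 0"
  shows "expectation (\<lambda>\<omega>. (Z (s + t) \<omega> - Z s \<omega>)\<^sup>2) = expectation (\<lambda>\<omega>. (Z t \<omega>)\<^sup>2)"
proof -
  have [measurable]: "Z s \<in> borel_measurable M" "Z t \<in> borel_measurable M" "Z (s + t) \<in> borel_measurable M"
    using assms by (auto intro: meas)
  have "expectation (\<lambda>\<omega>. (Z (s + t) \<omega> - Z s \<omega>)\<^sup>2) = integral\<^sup>L (distr M borel (\<lambda>\<omega>. Z (s + t) \<omega> - Z s \<omega>)) (\<lambda>x. x\<^sup>2)"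
    by (subst integral_distr) auto
  also have "\<dots> = expectation (\<lambda>\<omega>. (Z t \<omega>)\<^sup>2)"
    unfolding stationary[OF assms] by (subst integral_distr) auto
  finally show ?thesis .
qed

lemma expectation_mult_increment:
  assumes "s \<ge> 0" "t \<ge> 0"
  shows "expectation (\<lambda>\<omega>. Z s \<omega> * (Z (s + t) \<omega> - Z s \<omega>)) = expectation (Z s) * expectation (Z t)"
proof -
  \<comment> \<open>Independence of the increments is available for strictly increasing times only.\<close>
  consider "s = 0" | "t = 0" | "s > 0" "t > 0" using assms by linarith
  then show ?thesis
  proof cases
    case 1
    have "expectation (\<lambda>\<omega>. Z 0 \<omega> * (Z t \<omega> - Z 0 \<omega>)) = 0"
      using assms by (simp add: right_diff_distrib integrable_ZZ integral_zero)
    then show ?thesis using 1 by (simp add: integral_zero)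
  next
    case 2
    then show ?thesis by (simp add: integral_zero)
  next
    case 3
    have int: "integrable M (\<lambda>\<omega>. Z s \<omega> - Z 0 \<omega>)" "integrable M (\<lambda>\<omega>. Z (s + t) \<omega> - Z s \<omega>)"
      using assms by (auto intro!: Bochner_Integration.integrable_diff integrable_Z)
    have "expectation (\<lambda>\<omega>. Z s \<omega> * (Z (s + t) \<omega> - Z s \<omega>))
        = expectation (\<lambda>\<omega>. (Z s \<omega> - Z 0 \<omega>) * (Z (s + t) \<omega> - Z s \<omega>))"
      using assms by (intro integral_cong_AE) (use zero meas in \<open>auto elim: eventually_mono\<close>)
    also have "\<dots> = expectation (\<lambda>\<omega>. Z s \<omega> - Z 0 \<omega>) * expectation (\<lambda>\<omega>. Z (s + t) \<omega> - Z s \<omega>)"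
      using indep[of s "s + t"] 3 int by (intro indep_var_lebesgue_integral) auto
    also have "\<dots> = expectation (Z s) * expectation (Z t)"
      using assms by (simp add: integrable_Z integral_zero expectation_add)
    finally show ?thesis .
  qed
qed

lemma second_moment_add:
  assumes "s \<ge> 0" "t \<ge> 0"
  shows "expectation (\<lambda>\<omega>. (Z (s + t) \<omega>)\<^sup>2) = expectation (\<lambda>\<omega>. (Z s \<omega>)\<^sup>2)
    + 2 * (expectation (Z s) * expectation (Z t)) + expectation (\<lambda>\<omega>. (Z t \<omega>)\<^sup>2)"
proof -
  have sq: "(Z (s + t) \<omega>)\<^sup>2 = (Z s \<omega>)\<^sup>2 + 2 * (Z s \<omega> * (Z (s + t) \<omega> - Z s \<omega>)) + (Z (s + t) \<omega> - Z s \<omega>)\<^sup>2" for \<omega>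
    by (simp add: power2_eq_square algebra_simps)
  have 1: "integrable M (\<lambda>\<omega>. Z s \<omega> * (Z (s + t) \<omega> - Z s \<omega>))"
    using assms by (simp add: right_diff_distrib integrable_ZZ)
  have 2: "integrable M (\<lambda>\<omega>. (Z (s + t) \<omega> - Z s \<omega>)\<^sup>2)"
    using assms by (simp add: power2_eq_square algebra_simps integrable_ZZ)
  show ?thesis
    unfolding sq using assms 1 2
    by (simp add: sq_int expectation_mult_increment expectation_increment_sq)
qed

lemma variance_Z:
  assumes t: "t \<ge> 0"
  shows "expectation (\<lambda>\<omega>. (Z t \<omega> - expectation (Z t))\<^sup>2) = t * vari"
proof -
  define V where "V t = expectation (\<lambda>\<omega>. (Z t \<omega> - expectation (Z t))\<^sup>2)" for t
  have V: "V t = expectation (\<lambda>\<omega>. (Z t \<omega>)\<^sup>2) - (expectation (Z t))\<^sup>2" if "t \<ge> 0" for t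
    unfolding V_def using that by (intro variance_eq integrable_Z sq_int)
  have add: "V (s + t) = V s + V t" if "s \<ge> 0" "t \<ge> 0" for s t
    using that by (simp add: V second_moment_add expectation_add power2_sum)
  \<comment> \<open>A nonnegative additive function is increasing, hence bounded on \<open>(0, 1)\<close>.\<close>
  have "\<bar>V t\<bar> \<le> V 1" if "0 < t" "t < 1" for t
    using add[of t "1 - t"] that by (simp add: V_def)
  then have "V t = t * V 1" using additive_bounded_imp_linear[of V 1 "V 1" t] add t by simp
  then show ?thesis by (simp add: V_def)
qed

text \<open>
  By Chebyshev's inequality \<open>Z t\<close> is close to its mean with large probability, and by stochastic
  continuity it is close to \<open>0\<close>; hence the mean is bounded for small \<open>t\<close>.
\<close>

lemma expectation_Z:
  assumes t: "t \<ge> 0"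
  shows "expectation (Z t) = t * mean"
proof -
  have "eventually (\<lambda>t. prob {\<omega> \<in> space M. \<bar>Z t \<omega>\<bar> > 1} < 1 / 2) (at_right 0)"
    using order_tendstoD(2)[OF small[of 1], of "1 / 2"] by simp
  then obtain d where d: "d > 0" "\<And>t. 0 < t \<Longrightarrow> t < d \<Longrightarrow> prob {\<omega> \<in> space M. \<bar>Z t \<omega>\<bar> > 1} < 1 / 2"
    unfolding eventually_at_right_field by auto
  define e where "e = min d (1 / (1 + vari))"
  have e: "e > 0" using d vari_nonneg by (simp add: e_def add_pos_nonneg)
  have bd: "\<bar>expectation (Z t)\<bar> \<le> 3" if t: "0 < t" "t < e" for t
  proof (rule ccontr)
    assume "\<not> ?thesis"
    then have big: "\<bar>expectation (Z t)\<bar> > 3" by simp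
    have [measurable]: "Z t \<in> borel_measurable M" using t by (intro meas) auto
    let ?A = "{\<omega> \<in> space M. \<bar>Z t \<omega>\<bar> > 1}" and ?B = "{\<omega> \<in> space M. 2 \<le> \<bar>Z t \<omega> - expectation (Z t)\<bar>}"
    have "prob ?B \<le> expectation (\<lambda>\<omega>. (Z t \<omega> - expectation (Z t))\<^sup>2) / 2\<^sup>2"
      using t by (intro Chebyshev_inequality sq_int) auto
    also have "\<dots> = t * vari / 4" using variance_Z[of t] t by simp
    also have "\<dots> \<le> 1 / 4"
    proof -
      have "u * v / 4 \<le> 1 / 4" if "0 < u" "u < 1 / (1 + v)" "0 \<le> v" for u v :: real
      proof -
        have "u * (1 + v) < 1" using that by (subst (asm) pos_less_divide_eq) auto
        then show ?thesis using that by (simp add: distrib_left)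
      qed
      then show ?thesis using t vari_nonneg by (simp only: e_def min_less_iff_conj)
    qed
    finally have B: "prob ?B \<le> 1 / 4" .
    have A: "prob ?A < 1 / 2" using t by (intro d) (auto simp: e_def)
    have "space M \<subseteq> ?A \<union> ?B" using big by auto
    then have "prob (space M) \<le> prob (?A \<union> ?B)" by (intro finite_measure_mono) auto
    also have "\<dots> \<le> prob ?A + prob ?B" by (intro measure_Un_le) auto
    finally show False using A B prob_space by simp
  qed
  show ?thesis
    by (rule additive_bounded_imp_linear[of "\<lambda>t. expectation (Z t)", OF expectation_add e bd t])
qed

text \<open>
  For \<open>s \<le> t\<close> the increment \<open>Z t - Z s\<close> is uncorrelated with \<open>Z s\<close>.
\<close>

lemma covariance:
  assumes "s \<ge> 0" "t \<ge> 0"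
  shows "expectation (\<lambda>\<omega>. Z s \<omega> * Z t \<omega>) = vari * min s t + mean\<^sup>2 * s * t"
proof -
  have le: "expectation (\<lambda>\<omega>. Z s \<omega> * Z t \<omega>) = vari * s + mean\<^sup>2 * s * t" if "0 \<le> s" "s \<le> t" for s t
  proof -
    have sq: "expectation (\<lambda>\<omega>. (Z s \<omega>)\<^sup>2) = s * vari + (s * mean)\<^sup>2"
      using variance_eq[OF integrable_Z sq_int, of s] variance_Z[of s] expectation_Z[of s] that by simp
    have "expectation (\<lambda>\<omega>. Z s \<omega> * (Z (s + (t - s)) \<omega> - Z s \<omega>)) = expectation (Z s) * expectation (Z (t - s))"
      using that by (intro expectation_mult_increment) auto
    then have "expectation (\<lambda>\<omega>. Z s \<omega> * Z t \<omega>) - expectation (\<lambda>\<omega>. (Z s \<omega>)\<^sup>2) = s * mean * ((t - s) * mean)"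
      using that expectation_Z[of s] expectation_Z[of "t - s"]
      by (simp add: right_diff_distrib integrable_ZZ power2_eq_square)
    then show ?thesis unfolding sq by (simp add: power2_eq_square algebra_simps)
  qed
  show ?thesis
  proof (cases "s \<le> t")
    case True
    then show ?thesis using le[of s t] assms by (simp add: min_def)
  next
    case False
    then show ?thesis using le[of t s] assms by (simp add: min_def mult.commute mult.left_commute)
  qed
qed

end


section \<open>The stochastic integral\<close>

text \<open>
  Pairs of an elementary integral and its integrand, built from the pairs \<open>Z u\<close> and \<open>1_(0,u]\<close>.
  Since second moments are bilinear in such pairs, the isometry needs no common refinement of the
  partitions of two step functions.
\<close>

inductive elementary :: "(real \<Rightarrow> 'w \<Rightarrow> real) \<Rightarrow> real \<Rightarrow> ('w \<Rightarrow> real) \<Rightarrow> (real \<Rightarrow> real) \<Rightarrow> bool"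
  for Z t where
  zero: "elementary Z t (\<lambda>\<omega>. 0) (\<lambda>r. 0)"
| add: "elementary Z t Y G \<Longrightarrow> 0 \<le> u \<Longrightarrow> u \<le> t \<Longrightarrow>
    elementary Z t (\<lambda>\<omega>. Y \<omega> + c * Z u \<omega>) (\<lambda>r. G r + c * indicator {0<..u} r)"

lemma elementary_diff:
  assumes "elementary Z t Y G" "elementary Z t Y' G'"
  shows "elementary Z t (\<lambda>\<omega>. Y \<omega> - Y' \<omega>) (\<lambda>r. G r - G' r)"
  using assms(2)
proof induction
  case zero
  then show ?case using assms(1) by simp
next
  case (add Y' G' u c)
  then show ?case
    using elementary.add[OF add.IH add.hyps(2,3), of "- c"] by (simp add: algebra_simps)
qed

text \<open>
  For \<open>0 \<le> a \<le> b\<close> the indicator of \<open>(a,b]\<close> is \<open>1_(0,b] - 1_(0,a]\<close>.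
\<close>

lemma elementary_step:
  assumes "0 \<le> s 0" "\<And>i. i < n \<Longrightarrow> s i \<le> s (Suc i)" "s n \<le> t"
  shows "elementary Z t (step_integral Z n s c) (step_function n s c)"
proof -
  have nonneg: "i \<le> n \<Longrightarrow> 0 \<le> s i" for i
    by (induction i) (use assms in \<open>auto intro: order_trans\<close>)
  have le_n: "s (n - i) \<le> t" for i
  proof (induction i)
    case (Suc i)
    show ?case
    proof (cases "i < n")
      case True
      then have "s (n - Suc i) \<le> s (Suc (n - Suc i))" by (intro assms) auto
      then show ?thesis using Suc True by (simp add: Suc_diff_Suc)
    qed (use Suc in simp)
  qed (use assms in simp)
  have le_t: "s i \<le> t" if "i \<le> n" for i using le_n[of "n - i"] that by simp
  have "k \<le> n \<Longrightarrow> elementary Z t (step_integral Z k s c) (step_function k s c)" for k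
  proof (induction k)
    case 0
    then show ?case by (simp add: step_integral_def[abs_def] step_function_def[abs_def] elementary.zero)
  next
    case (Suc k)
    then have k: "0 \<le> s k" "0 \<le> s (Suc k)" "s k \<le> t" "s (Suc k) \<le> t" "s k \<le> s (Suc k)"
      using nonneg le_t assms by auto
    have "elementary Z t (step_integral Z k s c) (step_function k s c)" using Suc by simp
    from elementary.add[OF elementary.add[OF this k(2,4), of "c k"] k(1,3), of "- c k"]
    have "elementary Z t (\<lambda>\<omega>. step_integral Z k s c \<omega> + c k * Z (s (Suc k)) \<omega> + - c k * Z (s k) \<omega>)
      (\<lambda>r. step_function k s c r + c k * indicator {0<..s (Suc k)} r + - c k * indicator {0<..s k} r)" .
    moreover have "(\<lambda>\<omega>. step_integral Z k s c \<omega> + c k * Z (s (Suc k)) \<omega> + - c k * Z (s k) \<omega>) = step_integral Z (Suc k) s c"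
      by (simp add: step_integral_def fun_eq_iff algebra_simps)
    moreover have "(\<lambda>r. step_function k s c r + c k * indicator {0<..s (Suc k)} r + - c k * indicator {0<..s k} r) = step_function (Suc k) s c"
      using k by (auto simp: step_function_def fun_eq_iff indicator_def)
    ultimately show ?case by simp
  qed
  then show ?thesis by simp
qed

lemma elementary_support: "elementary Z t Y G \<Longrightarrow> r \<notin> {0<..t} \<Longrightarrow> G r = 0"
  by (induction rule: elementary.induct) (auto simp: indicator_def)

lemma elementary_integrand:
  assumes "elementary Z t Y G"
  shows "G \<in> borel_measurable borel \<and> integrable lborel G \<and> integrable lborel (\<lambda>r. (G r)\<^sup>2)
    \<and> (\<forall>w. integrable lborel (\<lambda>r. G r * indicator {0<..w} r))"
  using assms
proof induction
  case (add Y G u c)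
  have ind: "integrable lborel (indicator {0<..w::real} :: real \<Rightarrow> real)" for w
    by (cases "0 \<le> w") (auto intro!: integrable_real_indicator)
  have ind2: "indicator {0<..u} r * indicator {0<..w} r = (indicator {0<..min u w} r :: real)" for r w
    by (auto simp: indicator_def)
  have "(G r + c * indicator {0<..u} r)\<^sup>2 = (G r)\<^sup>2 + 2 * c * (G r * indicator {0<..u} r) + c\<^sup>2 * indicator {0<..u} r" for r
    by (auto simp: power2_eq_square indicator_def algebra_simps)
  moreover have "(\<lambda>r. G r + c * indicator {0<..u} r) \<in> borel_measurable borel"
    using add.IH by (intro borel_measurable_add borel_measurable_times) auto
  ultimately show ?case using add ind by (simp add: distrib_right mult.assoc ind2)
qed simp

context square_integrable_levy
begin

text \<open>
  For the pair \<open>Z u\<close>, \<open>1_(0,u]\<close> this is the covariance formula, as \<open>min u w\<close> is the integral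
  of \<open>1_(0,u] 1_(0,w]\<close>; the general case follows by linearity.
\<close>

lemma elementary_covariance:
  assumes "elementary Z t Y G" and w: "w \<ge> 0"
  shows "integrable M (\<lambda>\<omega>. Y \<omega> * Z w \<omega>) \<and> expectation (\<lambda>\<omega>. Y \<omega> * Z w \<omega>)
    = vari * (LBINT r. G r * indicator {0<..w} r) + mean\<^sup>2 * w * (LBINT r. G r)"
  using assms(1)
proof induction
  case (add Y G u c)
  have ind2: "indicator {0<..u} r * indicator {0<..w} r = (indicator {0<..min u w} r :: real)" for r
    by (auto simp: indicator_def)
  have m: "(LBINT r. indicator {0<..v} r) = v" if "0 \<le> v" for v :: real using that by simp
  have ind: "integrable lborel (indicator {0<..w::real} :: real \<Rightarrow> real)" for w
    by (cases "0 \<le> w") (auto intro!: integrable_real_indicator)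
  have G: "integrable lborel G" "integrable lborel (\<lambda>r. G r * indicator {0<..w} r)"
    using elementary_integrand[OF add.hyps(1)] by auto
  have 1: "(LBINT r. (G r + c * indicator {0<..u} r) * indicator {0<..w} r)
      = (LBINT r. G r * indicator {0<..w} r) + c * min u w"
    using G add.hyps w by (simp add: distrib_right mult.assoc ind2 ind m)
  have 2: "(LBINT r. G r + c * indicator {0<..u} r) = (LBINT r. G r) + c * u"
    using G add.hyps by (simp add: ind m)
  have 3: "integrable M (\<lambda>\<omega>. c * (Z u \<omega> * Z w \<omega>))" using integrable_ZZ[of u w] add.hyps w by simp
  have 4: "expectation (\<lambda>\<omega>. (Y \<omega> + c * Z u \<omega>) * Z w \<omega>)
      = expectation (\<lambda>\<omega>. Y \<omega> * Z w \<omega>) + c * expectation (\<lambda>\<omega>. Z u \<omega> * Z w \<omega>)"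
    using add.IH 3 by (simp add: distrib_right mult.assoc)
  show ?case
    using add.IH 3 unfolding 1 2 4 covariance[OF add.hyps(2) w]
    by (simp add: distrib_right mult.assoc algebra_simps)
qed simp

text \<open>
  The Ito isometry for a process with drift: the square of a sum is expanded one summand at a time.
\<close>

lemma elementary_second_moment:
  assumes "elementary Z t Y G"
  shows "Y \<in> borel_measurable M \<and> integrable M (\<lambda>\<omega>. (Y \<omega>)\<^sup>2) \<and> expectation (\<lambda>\<omega>. (Y \<omega>)\<^sup>2)
    = vari * (LBINT r. (G r)\<^sup>2) + mean\<^sup>2 * (LBINT r. G r)\<^sup>2"
  using assms
proof induction
  case (add Y G u c)
  have m: "(LBINT r. indicator {0<..u} r) = u" using add.hyps by simp
  have ind: "integrable lborel (indicator {0<..u} :: real \<Rightarrow> real)"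
    using add.hyps by (auto intro!: integrable_real_indicator)
  note G = elementary_integrand[OF add.hyps(1)]
  have sqG: "(G r + c * indicator {0<..u} r)\<^sup>2 = (G r)\<^sup>2 + 2 * c * (G r * indicator {0<..u} r) + c\<^sup>2 * indicator {0<..u} r" for r
    by (auto simp: power2_eq_square indicator_def algebra_simps)
  have 1: "(LBINT r. (G r + c * indicator {0<..u} r)\<^sup>2)
      = (LBINT r. (G r)\<^sup>2) + 2 * c * (LBINT r. G r * indicator {0<..u} r) + c\<^sup>2 * u"
    unfolding sqG using G add.hyps ind m by simp
  have 2: "(LBINT r. G r + c * indicator {0<..u} r) = (LBINT r. G r) + c * u"
    using G add.hyps ind m by simp
  have sqY: "(Y \<omega> + c * Z u \<omega>)\<^sup>2 = (Y \<omega>)\<^sup>2 + 2 * c * (Y \<omega> * Z u \<omega>) + c\<^sup>2 * (Z u \<omega>)\<^sup>2" for \<omega>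
    by (simp add: power2_eq_square algebra_simps)
  note YZ = elementary_covariance[OF add.hyps(1,2)]
  have 3: "expectation (\<lambda>\<omega>. (Y \<omega> + c * Z u \<omega>)\<^sup>2)
      = expectation (\<lambda>\<omega>. (Y \<omega>)\<^sup>2) + 2 * c * expectation (\<lambda>\<omega>. Y \<omega> * Z u \<omega>) + c\<^sup>2 * expectation (\<lambda>\<omega>. (Z u \<omega>)\<^sup>2)"
    unfolding sqY using add.IH YZ sq_int[OF add.hyps(2)] by simp
  have ZZ: "expectation (\<lambda>\<omega>. (Z u \<omega>)\<^sup>2) = vari * u + mean\<^sup>2 * u * u"
    using covariance[OF add.hyps(2,2)] by (simp add: power2_eq_square)
  have int: "integrable M (\<lambda>\<omega>. (Y \<omega> + c * Z u \<omega>)\<^sup>2)"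
    unfolding sqY using add.IH YZ sq_int[OF add.hyps(2)] by simp
  have meas: "(\<lambda>\<omega>. Y \<omega> + c * Z u \<omega>) \<in> borel_measurable M"
    using add.IH meas[OF add.hyps(2)] by (intro borel_measurable_add borel_measurable_times) auto
  have eq: "v * A + m\<^sup>2 * B\<^sup>2 + 2 * c * (v * D + m\<^sup>2 * u * B) + c\<^sup>2 * (v * u + m\<^sup>2 * u * u)
      = v * (A + 2 * c * D + c\<^sup>2 * u) + m\<^sup>2 * (B + c * u)\<^sup>2" for v m A B D :: real
    by (simp add: power2_eq_square algebra_simps)
  have "expectation (\<lambda>\<omega>. (Y \<omega> + c * Z u \<omega>)\<^sup>2)
      = vari * (LBINT r. (G r + c * indicator {0<..u} r)\<^sup>2) + mean\<^sup>2 * (LBINT r. G r + c * indicator {0<..u} r)\<^sup>2"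
    unfolding 1 2 3 ZZ conjunct2[OF YZ] conjunct2[OF conjunct2[OF add.IH]] by (rule eq)
  with int meas show ?case by blast
qed simp

text \<open>The drift contributes through the mean, which costs a factor \<open>t\<close> by Cauchy--Schwarz.\<close>

lemma elementary_bound:
  assumes E: "elementary Z t Y G" and t: "t \<ge> 0"
  shows "(\<integral>\<^sup>+\<omega>. ennreal ((Y \<omega>)\<^sup>2) \<partial>M)
    \<le> ennreal (vari + t * mean\<^sup>2) * (\<integral>\<^sup>+r\<in>{0..t}. ennreal ((G r)\<^sup>2) \<partial>lborel)"
proof -
  note G = elementary_integrand[OF E]
  note Y = elementary_second_moment[OF E]
  have CS: "(LBINT r. G r)\<^sup>2 \<le> t * (LBINT r. (G r)\<^sup>2)"
  proof (cases "t = 0")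
    case True
    then have "G r = 0" for r using elementary_support[OF E, of r] by simp
    then show ?thesis by simp
  next
    case False
    \<comment> \<open>The mean value of \<open>G\<close> over \<open>(0,t]\<close>; the integral of \<open>(G - a)\<^sup>2\<close> over this interval is nonnegative.\<close>
    define a where "a = (LBINT r. G r) / t"
    have ind: "integrable lborel (indicator {0<..t} :: real \<Rightarrow> real)"
      using t by (auto intro!: integrable_real_indicator)
    have sq: "(G r - a * indicator {0<..t} r)\<^sup>2 = (G r)\<^sup>2 - 2 * a * G r + a\<^sup>2 * indicator {0<..t} r" for r
      using elementary_support[OF E, of r] by (auto simp: power2_eq_square indicator_def algebra_simps)
    have "0 \<le> (LBINT r. (G r - a * indicator {0<..t} r)\<^sup>2)" by simp
    also have "\<dots> = (LBINT r. (G r)\<^sup>2) - 2 * a * (LBINT r. G r) + a\<^sup>2 * t"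
      unfolding sq using G ind t by simp
    finally show ?thesis using False t unfolding a_def
      by (simp add: field_simps power2_eq_square)
  qed
  have "(\<integral>\<^sup>+\<omega>. ennreal ((Y \<omega>)\<^sup>2) \<partial>M) = ennreal (expectation (\<lambda>\<omega>. (Y \<omega>)\<^sup>2))"
    using Y by (intro nn_integral_eq_integral) auto
  also have "\<dots> \<le> ennreal ((vari + t * mean\<^sup>2) * (LBINT r. (G r)\<^sup>2))"
  proof (rule ennreal_leI)
    have "mean\<^sup>2 * (LBINT r. G r)\<^sup>2 \<le> mean\<^sup>2 * (t * (LBINT r. (G r)\<^sup>2))" by (intro mult_left_mono CS) simp
    then show "expectation (\<lambda>\<omega>. (Y \<omega>)\<^sup>2) \<le> (vari + t * mean\<^sup>2) * (LBINT r. (G r)\<^sup>2)"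
      using conjunct2[OF conjunct2[OF Y]] by (simp add: distrib_right mult.assoc mult.left_commute)
  qed
  also have "\<dots> = ennreal (vari + t * mean\<^sup>2) * (\<integral>\<^sup>+r. ennreal ((G r)\<^sup>2) \<partial>lborel)"
  proof -
    have "(\<integral>\<^sup>+r. ennreal ((G r)\<^sup>2) \<partial>lborel) = ennreal (LBINT r. (G r)\<^sup>2)"
      using G by (intro nn_integral_eq_integral) auto
    moreover have "0 \<le> vari + t * mean\<^sup>2" using t by (intro add_nonneg_nonneg vari_nonneg) auto
    ultimately show ?thesis by (simp add: ennreal_mult)
  qed
  also have "(\<integral>\<^sup>+r. ennreal ((G r)\<^sup>2) \<partial>lborel) = (\<integral>\<^sup>+r\<in>{0..t}. ennreal ((G r)\<^sup>2) \<partial>lborel)"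
    using elementary_support[OF E] by (intro nn_integral_cong) (auto simp: indicator_def)
  finally show ?thesis .
qed

end


lemma step_function_uniform_grid:
  assumes h: "h > 0" and r: "0 < r" "r \<le> real n * h"
  obtains i where "i < n" "real i * h < r" "r \<le> real (Suc i) * h"
    "\<And>c. step_function n (\<lambda>i. real i * h) c r = c i"
proof -
  \<comment> \<open>The cells are open on the left, hence the ceiling.\<close>
  define i where "i = nat (\<lceil>r / h\<rceil> - 1)"
  have "real i < r / h \<and> r / h \<le> real i + 1"
  proof -
    have "0 < r / h" using h r by simp
    then have "\<lceil>r / h\<rceil> \<ge> 1" by simp
    then have "real i = real_of_int \<lceil>r / h\<rceil> - 1" by (simp add: i_def)
    then show ?thesis by linarith
  qed
  then have i: "real i * h < r" "r \<le> real (Suc i) * h"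
    using h by (simp_all add: field_simps)
  then have "real i * h < real n * h" using r by linarith
  then have i_n: "i < n" using h by simp
  have unique: "j = i" if "r \<in> {real j * h<..real (Suc j) * h}" for j
  proof -
    have "real j * h < real (Suc i) * h" "real i * h < real (Suc j) * h" using i that by auto
    then show ?thesis using h by (simp only: mult_less_cancel_right_pos of_nat_less_iff)
  qed
  have ind: "indicator {real j * h<..real (Suc j) * h} r = (if j = i then 1 else 0 :: real)" for j
  proof (cases "j = i")
    case True
    then show ?thesis using i by simp
  next
    case False
    then have "r \<notin> {real j * h<..real (Suc j) * h}" using unique by blast
    then show ?thesis using False by simp
  qed
  have "step_function n (\<lambda>i. real i * h) c r = c i" for c
    unfolding step_function_def ind using i_n by (simp add: if_distrib cong: if_cong)
  then show ?thesis by (rule that[OF i_n i])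
qed

lemma power2_diff_le: "(a - b)\<^sup>2 \<le> 2 * (a - c)\<^sup>2 + 2 * (c - b)\<^sup>2" for a b c :: real
proof -
  have "2 * (a - c)\<^sup>2 + 2 * (c - b)\<^sup>2 - (a - b)\<^sup>2 = (a - c - (c - b))\<^sup>2"
    by (simp add: power2_eq_square algebra_simps)
  then show ?thesis using zero_le_power2[of "a - c - (c - b)"] by linarith
qed

lemma nn_integral_power2_diff_le:
  fixes f g u :: "'a \<Rightarrow> real"
  assumes [measurable]: "f \<in> borel_measurable M" "g \<in> borel_measurable M" "u \<in> borel_measurable M" "A \<in> sets M"
  shows "(\<integral>\<^sup>+x\<in>A. ennreal ((f x - g x)\<^sup>2) \<partial>M)
    \<le> 2 * (\<integral>\<^sup>+x\<in>A. ennreal ((f x - u x)\<^sup>2) \<partial>M) + 2 * (\<integral>\<^sup>+x\<in>A. ennreal ((u x - g x)\<^sup>2) \<partial>M)"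
proof -
  have "ennreal ((f x - g x)\<^sup>2) * indicator A x
      \<le> 2 * (ennreal ((f x - u x)\<^sup>2) * indicator A x) + 2 * (ennreal ((u x - g x)\<^sup>2) * indicator A x)" for x
  proof -
    have "ennreal ((f x - g x)\<^sup>2) \<le> ennreal (2 * (f x - u x)\<^sup>2 + 2 * (u x - g x)\<^sup>2)"
      by (intro ennreal_leI power2_diff_le)
    also have "\<dots> = 2 * ennreal ((f x - u x)\<^sup>2) + 2 * ennreal ((u x - g x)\<^sup>2)"
      by (simp add: ennreal_mult)
    finally show ?thesis by (simp add: indicator_def)
  qed
  then have "(\<integral>\<^sup>+x\<in>A. ennreal ((f x - g x)\<^sup>2) \<partial>M)
      \<le> (\<integral>\<^sup>+x. 2 * (ennreal ((f x - u x)\<^sup>2) * indicator A x) + 2 * (ennreal ((u x - g x)\<^sup>2) * indicator A x) \<partial>M)"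
    by (intro nn_integral_mono) auto
  also have "\<dots> = 2 * (\<integral>\<^sup>+x\<in>A. ennreal ((f x - u x)\<^sup>2) \<partial>M) + 2 * (\<integral>\<^sup>+x\<in>A. ennreal ((u x - g x)\<^sup>2) \<partial>M)"
    by (simp add: nn_integral_add nn_integral_cmult)
  finally show ?thesis .
qed

context square_integrable_levy
begin

text \<open>
  The elementary integrals that approximate \<open>I\<close> are compared with \<open>Y\<close> by the isometry.  The
  factor \<open>4\<close> comes from inserting them twice with \<open>(a - b)\<^sup>2 \<le> 2 (a - c)\<^sup>2 + 2 (c - b)\<^sup>2\<close>,
  between \<open>I\<close> and \<open>Y\<close> and between \<open>f\<close> and \<open>G\<close>.
\<close>

lemma stoch_integral_elementary_bound:
  assumes I: "is_stoch_integral M Z t f I" and E: "elementary Z t Y G" and t: "t \<ge> 0"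
    and f [measurable]: "f \<in> borel_measurable borel"
  shows "(\<integral>\<^sup>+\<omega>. ennreal ((I \<omega> - Y \<omega>)\<^sup>2) \<partial>M)
    \<le> ennreal (4 * (vari + t * mean\<^sup>2)) * (\<integral>\<^sup>+r\<in>{0..t}. ennreal ((f r - G r)\<^sup>2) \<partial>lborel)"
proof -
  obtain n s c where
    s: "\<forall>j. 0 \<le> s j 0 \<and> (\<forall>i<n j. s j i \<le> s j (Suc i)) \<and> s j (n j) \<le> t"
    and lim_f: "(\<lambda>j. \<integral>\<^sup>+r\<in>{0..t}. ennreal ((f r - step_function (n j) (s j) (c j) r)\<^sup>2) \<partial>lborel) \<longlonglongrightarrow> 0"
    and lim_I: "(\<lambda>j. L2_norm M abs_norm (\<lambda>\<omega>. I \<omega> - step_integral Z (n j) (s j) (c j) \<omega>)) \<longlonglongrightarrow> 0"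
    and I_meas [measurable]: "I \<in> borel_measurable M"
    using I unfolding is_stoch_integral_def by blast
  define Ij where "Ij j = step_integral Z (n j) (s j) (c j)" for j
  define fj where "fj j = step_function (n j) (s j) (c j)" for j
  have Ej: "elementary Z t (Ij j) (fj j)" for j
    unfolding Ij_def fj_def using s by (intro elementary_step) auto
  define K where "K = ennreal (vari + t * mean\<^sup>2)"
  define B where "B = (\<integral>\<^sup>+r\<in>{0..t}. ennreal ((f r - G r)\<^sup>2) \<partial>lborel)"
  define a where "a j = (\<integral>\<^sup>+\<omega>. ennreal ((I \<omega> - Ij j \<omega>)\<^sup>2) \<partial>M)" for j
  define b where "b j = (\<integral>\<^sup>+r\<in>{0..t}. ennreal ((f r - fj j r)\<^sup>2) \<partial>lborel)" for j
  have [measurable]: "Y \<in> borel_measurable M" "G \<in> borel_measurable borel"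
    using elementary_second_moment[OF E] elementary_integrand[OF E] by auto
  have [measurable]: "Ij j \<in> borel_measurable M" "fj j \<in> borel_measurable borel" for j
    using elementary_second_moment[OF Ej] elementary_integrand[OF Ej] by auto
  have bound: "(\<integral>\<^sup>+\<omega>. ennreal ((I \<omega> - Y \<omega>)\<^sup>2) \<partial>M) \<le> 2 * a j + 2 * (K * (2 * b j + 2 * B))" for j
  proof -
    have "(\<integral>\<^sup>+\<omega>. ennreal ((I \<omega> - Y \<omega>)\<^sup>2) \<partial>M) \<le> 2 * a j + 2 * (\<integral>\<^sup>+\<omega>. ennreal ((Ij j \<omega> - Y \<omega>)\<^sup>2) \<partial>M)"
    proof -
      have sp: "(\<integral>\<^sup>+\<omega>\<in>space M. u \<omega> \<partial>M) = integral\<^sup>N M u" for u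
        by (intro nn_integral_cong) auto
      show ?thesis using nn_integral_power2_diff_le[of I M Y "Ij j" "space M"] by (simp add: a_def sp)
    qed
    also have "(\<integral>\<^sup>+\<omega>. ennreal ((Ij j \<omega> - Y \<omega>)\<^sup>2) \<partial>M)
        \<le> K * (\<integral>\<^sup>+r\<in>{0..t}. ennreal ((fj j r - G r)\<^sup>2) \<partial>lborel)"
      unfolding K_def by (rule elementary_bound[OF elementary_diff[OF Ej E] t])
    also have "(\<integral>\<^sup>+r\<in>{0..t}. ennreal ((fj j r - G r)\<^sup>2) \<partial>lborel) \<le> 2 * b j + 2 * B"
    proof -
      have "(\<integral>\<^sup>+r\<in>{0..t}. ennreal ((fj j r - f r)\<^sup>2) \<partial>lborel) = b j"
        unfolding b_def by (simp add: power2_commute)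
      then show ?thesis using nn_integral_power2_diff_le[of "fj j" lborel G f "{0..t}"] by (simp add: B_def)
    qed
    finally show ?thesis by (simp add: mult_left_mono)
  qed
  have a_lim: "a \<longlonglongrightarrow> 0"
  proof -
    have sq: "a j = (L2_norm M abs_norm (\<lambda>\<omega>. I \<omega> - Ij j \<omega>)) * (L2_norm M abs_norm (\<lambda>\<omega>. I \<omega> - Ij j \<omega>))" for j
      unfolding power2_eq_square[symmetric] L2_norm_power2 abs_norm_power2 a_def ..
    show ?thesis
      unfolding sq[THEN ext] using tendsto_mult_ennreal[OF lim_I lim_I] by (simp add: Ij_def)
  qed
  have b_lim: "b \<longlonglongrightarrow> 0" using lim_f by (simp add: b_def[abs_def] fj_def)
  have "(\<lambda>j. 2 * a j + 2 * (K * (2 * b j + 2 * B))) \<longlonglongrightarrow> 2 * 0 + 2 * (K * (2 * 0 + 2 * B))"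
    by (intro tendsto_add ennreal_tendsto_cmult tendsto_const a_lim b_lim) (auto simp: K_def)
  then have "(\<integral>\<^sup>+\<omega>. ennreal ((I \<omega> - Y \<omega>)\<^sup>2) \<partial>M) \<le> 2 * 0 + 2 * (K * (2 * 0 + 2 * B))"
    by (rule LIMSEQ_le_const) (use bound in auto)
  also have "\<dots> = ennreal (4 * (vari + t * mean\<^sup>2)) * B"
  proof -
    have "ennreal (4 * (vari + t * mean\<^sup>2)) = 4 * K"
      unfolding K_def using t vari_nonneg by (simp add: ennreal_mult' )
    then show ?thesis by (simp add: mult_ac)
  qed
  finally show ?thesis by (simp add: B_def)
qed

text \<open>
  The differences of consecutive dyadic elementary integrals are summable in expectation, so these
  integrals converge almost surely; Fatou's lemma turns this into convergence in mean square.
\<close>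

lemma stoch_integral_exists:
  assumes t: "t > 0" and \<Lambda>: "\<Lambda> \<ge> 0"
    and lip: "\<And>x y. x \<in> {0..t} \<Longrightarrow> y \<in> {0..t} \<Longrightarrow> \<bar>f x - f y\<bar> \<le> \<Lambda> * \<bar>x - y\<bar>"
  shows "\<exists>I. is_stoch_integral M Z t f I"
proof -
  define h where "h j = t / 2 ^ j" for j :: nat
  define n where "n j = (2::nat) ^ j" for j :: nat
  define s where "s j i = real i * h j" for j i
  define c where "c j i = f (s j i)" for j i
  define Ij where "Ij j = step_integral Z (n j) (s j) (c j)" for j
  define fj where "fj j = step_function (n j) (s j) (c j)" for j
  have h: "h j > 0" "real (n j) * h j = t" for j using t by (simp_all add: h_def n_def)
  have h_mono: "h k \<le> h j" if "j \<le> k" for j k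
    unfolding h_def using t that by (intro divide_left_mono) (auto intro: power_increasing)
  have s: "0 \<le> s j 0" "s j i \<le> s j (Suc i)" "s j (n j) \<le> t" for i j
    using h[of j] by (auto simp: s_def distrib_right)
  have Ej: "elementary Z t (Ij j) (fj j)" for j
    unfolding Ij_def fj_def using s by (intro elementary_step) auto
  have meas_Ij [measurable]: "Ij j \<in> borel_measurable M" for j
    using elementary_second_moment[OF Ej] by auto
  have approx: "\<bar>f r - fj j r\<bar> \<le> \<Lambda> * h j" if r: "0 < r" "r \<le> t" for r j
  proof -
    obtain i where i: "i < n j" "real i * h j < r" "r \<le> real (Suc i) * h j" "fj j r = f (real i * h j)"
      using step_function_uniform_grid[of "h j" r "n j"] h[of j] r
      unfolding fj_def s_def[abs_def] c_def[abs_def] by metis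
    have "\<bar>f r - f (real i * h j)\<bar> \<le> \<Lambda> * \<bar>r - real i * h j\<bar>"
      using i r h[of j] by (intro lip) auto
    also have "\<dots> \<le> \<Lambda> * h j" using i \<Lambda> by (intro mult_left_mono) (auto simp: distrib_right)
    finally show ?thesis using i by simp
  qed
  define K where "K = vari + t * mean\<^sup>2"
  have K: "K \<ge> 0" unfolding K_def using t by (intro add_nonneg_nonneg vari_nonneg) auto
  \<comment> \<open>From level \<open>j\<close> on, the step functions differ from each other by at most \<open>2 \<Lambda> t / 2 ^ j\<close>; this gives the bound \<open>A / 4 ^ j\<close> below.\<close>
  define A where "A = K * ((2 * \<Lambda> * t)\<^sup>2 * t)"
  have A: "A \<ge> 0" using K t by (simp add: A_def)
  have diff: "(\<integral>\<^sup>+\<omega>. ennreal ((Ij k \<omega> - Ij j \<omega>)\<^sup>2) \<partial>M) \<le> ennreal (A / 4 ^ j)" if jk: "j \<le> k" for j k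
  proof -
    have "(\<integral>\<^sup>+r\<in>{0..t}. ennreal ((fj k r - fj j r)\<^sup>2) \<partial>lborel)
        \<le> (\<integral>\<^sup>+r. ennreal ((2 * \<Lambda> * h j)\<^sup>2) * indicator {0..t} r \<partial>lborel)"
    proof (intro nn_integral_mono mult_right_mono ennreal_leI)
      fix r :: real
      show "(fj k r - fj j r)\<^sup>2 \<le> (2 * \<Lambda> * h j)\<^sup>2"
      proof (cases "r \<in> {0<..t}")
        case True
        then have "\<bar>f r - fj k r\<bar> \<le> \<Lambda> * h k" "\<bar>f r - fj j r\<bar> \<le> \<Lambda> * h j" by (auto intro: approx)
        moreover have "\<Lambda> * h k \<le> \<Lambda> * h j" using h_mono[OF jk] \<Lambda> by (rule mult_left_mono)
        ultimately have "\<bar>fj k r - fj j r\<bar> \<le> 2 * \<Lambda> * h j" by linarith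
        then show ?thesis by (rule abs_le_square_iff[THEN iffD1, OF order_trans]) simp
      next
        case False
        then show ?thesis using elementary_support[OF Ej] by simp
      qed
    qed simp
    also have "\<dots> = ennreal ((2 * \<Lambda> * h j)\<^sup>2 * t)" using t by (simp add: nn_integral_cmult ennreal_mult)
    finally have G: "(\<integral>\<^sup>+r\<in>{0..t}. ennreal ((fj k r - fj j r)\<^sup>2) \<partial>lborel) \<le> ennreal ((2 * \<Lambda> * h j)\<^sup>2 * t)" .
    have "(\<integral>\<^sup>+\<omega>. ennreal ((Ij k \<omega> - Ij j \<omega>)\<^sup>2) \<partial>M)
        \<le> ennreal K * (\<integral>\<^sup>+r\<in>{0..t}. ennreal ((fj k r - fj j r)\<^sup>2) \<partial>lborel)"
      unfolding K_def using t by (intro elementary_bound elementary_diff Ej) simp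
    also have "\<dots> \<le> ennreal K * ennreal ((2 * \<Lambda> * h j)\<^sup>2 * t)" by (intro mult_left_mono G) simp
    also have "\<dots> = ennreal (A / 4 ^ j)"
    proof -
      have "(4::real) ^ j = (2 ^ j)\<^sup>2" by (simp add: power2_eq_square flip: power_mult_distrib)
      then have "K * ((2 * \<Lambda> * h j)\<^sup>2 * t) = A / 4 ^ j"
        by (simp add: A_def h_def power_mult_distrib power_divide)
      then show ?thesis using K t by (simp flip: ennreal_mult)
    qed
    finally show ?thesis .
  qed
  have "AE \<omega> in M. summable (\<lambda>j. Ij (Suc j) \<omega> - Ij j \<omega>)"
  proof -
    have D: "(\<integral>\<^sup>+\<omega>. ennreal \<bar>Ij (Suc j) \<omega> - Ij j \<omega>\<bar> \<partial>M) \<le> ennreal ((1 + A) * (1 / 2) ^ j)" for j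
    proof -
      \<comment> \<open>Weights that balance the constant against second moments of order \<open>4 ^ - j\<close>.\<close>
      have "\<bar>x\<bar> \<le> (1 / 2) ^ j + 2 ^ j * x\<^sup>2" for x :: real
      proof -
        define p :: real where "p = 2 ^ j"
        have p: "p > 0" by (simp add: p_def)
        have "0 \<le> (1 - p * \<bar>x\<bar>)\<^sup>2" by simp
        then have "2 * (p * \<bar>x\<bar>) \<le> 1 + p * p * x\<^sup>2" by (simp add: power2_eq_square algebra_simps)
        moreover have "0 \<le> p * \<bar>x\<bar>" using p by simp
        ultimately have "p * \<bar>x\<bar> \<le> 1 + p * p * x\<^sup>2" by linarith
        then have "\<bar>x\<bar> \<le> 1 / p + p * x\<^sup>2" using p by (simp add: field_simps)
        then show ?thesis by (simp add: p_def power_one_over)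
      qed
      then have "(\<integral>\<^sup>+\<omega>. ennreal \<bar>Ij (Suc j) \<omega> - Ij j \<omega>\<bar> \<partial>M)
          \<le> (\<integral>\<^sup>+\<omega>. ennreal ((1 / 2) ^ j) + ennreal (2 ^ j) * ennreal ((Ij (Suc j) \<omega> - Ij j \<omega>)\<^sup>2) \<partial>M)"
        by (intro nn_integral_mono) (simp add: ennreal_leI flip: ennreal_plus ennreal_mult)
      also have "\<dots> = ennreal ((1 / 2) ^ j) + ennreal (2 ^ j) * (\<integral>\<^sup>+\<omega>. ennreal ((Ij (Suc j) \<omega> - Ij j \<omega>)\<^sup>2) \<partial>M)"
        by (simp add: nn_integral_add nn_integral_cmult emeasure_space_1)
      also have "\<dots> \<le> ennreal ((1 / 2) ^ j) + ennreal (2 ^ j) * ennreal (A / 4 ^ j)"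
        by (intro add_left_mono mult_left_mono diff) auto
      also have "\<dots> = ennreal ((1 + A) * (1 / 2) ^ j)"
      proof -
        have "(4::real) ^ j = 2 ^ j * 2 ^ j" by (simp flip: power_mult_distrib)
        then have "(1 / 2) ^ j + 2 ^ j * (A / 4 ^ j) = (1 + A) * (1 / 2) ^ j"
          by (simp add: power_one_over field_simps)
        then show ?thesis using A by (simp flip: ennreal_plus ennreal_mult)
      qed
      finally show ?thesis .
    qed
    have "(\<integral>\<^sup>+\<omega>. (\<Sum>j. ennreal \<bar>Ij (Suc j) \<omega> - Ij j \<omega>\<bar>) \<partial>M) = (\<Sum>j. \<integral>\<^sup>+\<omega>. ennreal \<bar>Ij (Suc j) \<omega> - Ij j \<omega>\<bar> \<partial>M)"
      by (intro nn_integral_suminf) measurable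
    also have "\<dots> \<le> (\<Sum>j. ennreal ((1 + A) * (1 / 2) ^ j))" by (intro suminf_le D) auto
    also have "\<dots> = ennreal (\<Sum>j. (1 + A) * (1 / 2) ^ j)"
      using A by (intro suminf_ennreal2 summable_mult summable_geometric) auto
    also have "\<dots> < \<top>" by simp
    finally have "AE \<omega> in M. (\<Sum>j. ennreal \<bar>Ij (Suc j) \<omega> - Ij j \<omega>\<bar>) \<noteq> \<infinity>"
      by (intro nn_integral_PInf_AE) auto
    then show ?thesis
    proof eventually_elim
      case (elim \<omega>)
      then have "summable (\<lambda>j. \<bar>Ij (Suc j) \<omega> - Ij j \<omega>\<bar>)" by (intro summable_suminf_not_top) auto
      then show ?case by (rule summable_rabs_cancel)
    qed
  qed
  then have conv: "AE \<omega> in M. (\<lambda>j. Ij j \<omega>) \<longlonglongrightarrow> lim (\<lambda>j. Ij j \<omega>)"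
  proof eventually_elim
    case (elim \<omega>)
    then have "(\<lambda>j. \<Sum>i<j. Ij (Suc i) \<omega> - Ij i \<omega>) \<longlonglongrightarrow> (\<Sum>i. Ij (Suc i) \<omega> - Ij i \<omega>)"
      by (rule summable_LIMSEQ)
    then have "(\<lambda>j. Ij j \<omega> - Ij 0 \<omega>) \<longlonglongrightarrow> (\<Sum>i. Ij (Suc i) \<omega> - Ij i \<omega>)"
      unfolding sum_lessThan_telescope[of "\<lambda>j. Ij j \<omega>"] .
    from tendsto_add[OF this tendsto_const[of "Ij 0 \<omega>"]] have "convergent (\<lambda>j. Ij j \<omega>)"
      unfolding diff_add_cancel by (rule convergentI)
    then show ?case unfolding convergent_LIMSEQ_iff .
  qed
  define I where "I \<omega> = lim (\<lambda>j. Ij j \<omega>)" for \<omega>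
  have I_meas [measurable]: "I \<in> borel_measurable M"
    unfolding I_def[abs_def] by (intro borel_measurable_lim_metric) auto
  have I_dist: "(\<integral>\<^sup>+\<omega>. ennreal ((I \<omega> - Ij j \<omega>)\<^sup>2) \<partial>M) \<le> ennreal (A / 4 ^ j)" for j
  proof -
    have "(\<integral>\<^sup>+\<omega>. ennreal ((I \<omega> - Ij j \<omega>)\<^sup>2) \<partial>M) = (\<integral>\<^sup>+\<omega>. liminf (\<lambda>k. ennreal ((Ij k \<omega> - Ij j \<omega>)\<^sup>2)) \<partial>M)"
    proof (rule nn_integral_cong_AE, use conv in eventually_elim)
      case (elim \<omega>)
      then have "(\<lambda>k. ennreal ((Ij k \<omega> - Ij j \<omega>)\<^sup>2)) \<longlonglongrightarrow> ennreal ((I \<omega> - Ij j \<omega>)\<^sup>2)"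
        unfolding I_def by (intro tendsto_ennrealI tendsto_intros)
      from lim_imp_Liminf[OF sequentially_bot this] show ?case by (rule sym)
    qed
    also have "\<dots> \<le> liminf (\<lambda>k. \<integral>\<^sup>+\<omega>. ennreal ((Ij k \<omega> - Ij j \<omega>)\<^sup>2) \<partial>M)"
      by (intro nn_integral_liminf) measurable
    also have "\<dots> \<le> limsup (\<lambda>k. \<integral>\<^sup>+\<omega>. ennreal ((Ij k \<omega> - Ij j \<omega>)\<^sup>2) \<partial>M)"
      by (rule Liminf_le_Limsup) simp
    also have "\<dots> \<le> ennreal (A / 4 ^ j)"
      by (rule Limsup_bounded) (auto simp: eventually_sequentially intro!: exI[of _ j] diff)
    finally show ?thesis .
  qed
  have "is_stoch_integral M Z t f I"
    unfolding is_stoch_integral_def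
  proof (intro conjI exI allI impI)
    show "I \<in> borel_measurable M" by (rule I_meas)
    show "0 \<le> s j 0" "s j i \<le> s j (Suc i)" "s j (n j) \<le> t" for j i by (rule s)+
    show "(\<lambda>j. \<integral>\<^sup>+r\<in>{0..t}. ennreal ((f r - step_function (n j) (s j) (c j) r)\<^sup>2) \<partial>lborel) \<longlonglongrightarrow> 0"
    proof (rule tendsto_sandwich[OF _ _ tendsto_const])
      have "(\<integral>\<^sup>+r\<in>{0..t}. ennreal ((f r - fj j r)\<^sup>2) \<partial>lborel) \<le> ennreal ((\<Lambda> * h j)\<^sup>2 * t)" for j
      proof -
        have "AE r in lborel. ennreal ((f r - fj j r)\<^sup>2) * indicator {0..t} r
            \<le> ennreal ((\<Lambda> * h j)\<^sup>2) * indicator {0..t} r"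
          using AE_lborel_singleton[of 0]
        proof eventually_elim
          case (elim r)
          have "(f r - fj j r)\<^sup>2 \<le> (\<Lambda> * h j)\<^sup>2" if "0 < r" "r \<le> t"
            using approx[OF that, of j] by (rule abs_le_square_iff[THEN iffD1, OF order_trans]) simp
          then show ?case using elim by (auto simp: indicator_def ennreal_leI)
        qed
        then have "(\<integral>\<^sup>+r\<in>{0..t}. ennreal ((f r - fj j r)\<^sup>2) \<partial>lborel)
            \<le> (\<integral>\<^sup>+r. ennreal ((\<Lambda> * h j)\<^sup>2) * indicator {0..t} r \<partial>lborel)"
          by (rule nn_integral_mono_AE)
        then show ?thesis using t by (simp add: nn_integral_cmult ennreal_mult)
      qed
      then show "\<forall>\<^sub>F j in sequentially. (\<integral>\<^sup>+r\<in>{0..t}. ennreal ((f r - step_function (n j) (s j) (c j) r)\<^sup>2) \<partial>lborel)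
          \<le> ennreal ((\<Lambda> * h j)\<^sup>2 * t)"
        by (simp add: fj_def)
      have "h \<longlonglongrightarrow> 0" unfolding h_def[abs_def] by (rule LIMSEQ_divide_realpow_zero) simp
      then have "(\<lambda>j. ennreal ((\<Lambda> * h j)\<^sup>2 * t)) \<longlonglongrightarrow> ennreal ((\<Lambda> * 0)\<^sup>2 * t)"
        by (intro tendsto_ennrealI tendsto_intros)
      then show "(\<lambda>j. ennreal ((\<Lambda> * h j)\<^sup>2 * t)) \<longlonglongrightarrow> 0" by simp
    qed simp
    show "(\<lambda>j. L2_norm M abs_norm (\<lambda>\<omega>. I \<omega> - step_integral Z (n j) (s j) (c j) \<omega>)) \<longlonglongrightarrow> 0"
    proof (rule tendsto_sandwich[OF _ _ tendsto_const])
      have "L2_norm M abs_norm (\<lambda>\<omega>. I \<omega> - Ij j \<omega>) \<le> ennreal (sqrt A / 2 ^ j)" for j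
      proof (rule L2_norm_leI)
        have "(sqrt A / 2 ^ j)\<^sup>2 = A / 4 ^ j"
          using A by (simp add: power_divide power2_eq_square flip: power_mult_distrib)
        then show "(\<integral>\<^sup>+\<omega>. (abs_norm (I \<omega> - Ij j \<omega>))\<^sup>2 \<partial>M) \<le> (ennreal (sqrt A / 2 ^ j))\<^sup>2"
          using I_dist[of j] A by (simp add: abs_norm_power2 ennreal_power)
      qed
      then show "\<forall>\<^sub>F j in sequentially. L2_norm M abs_norm (\<lambda>\<omega>. I \<omega> - step_integral Z (n j) (s j) (c j) \<omega>)
          \<le> ennreal (sqrt A / 2 ^ j)"
        by (simp add: Ij_def)
      have "(\<lambda>j. sqrt A / 2 ^ j) \<longlonglongrightarrow> 0" by (rule LIMSEQ_divide_realpow_zero) simp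
      then show "(\<lambda>j. ennreal (sqrt A / 2 ^ j)) \<longlonglongrightarrow> 0" using tendsto_ennrealI by fastforce
    qed simp
  qed
  then show ?thesis by blast
qed

end


section \<open>Comparison of the semigroup with the Euler factors\<close>

text \<open>
  Together with \<open>1 - x \<le> exp (- x)\<close> this places \<open>exp (- x)\<close> and the factors of both Euler
  schemes between \<open>1 - x\<close> and \<open>1 - x + x\<^sup>2\<close>.
\<close>

lemma inverse_one_plus_bounds:
  fixes x :: real
  assumes "x \<ge> 0"
  shows "inverse (1 + x) \<le> 1 - x + x\<^sup>2" "1 - x \<le> inverse (1 + x)" "exp (- x) \<le> inverse (1 + x)"
proof -
  have "1 \<le> (1 - x + x\<^sup>2) * (1 + x)" using assms by (simp add: power2_eq_square algebra_simps)
  then show "inverse (1 + x) \<le> 1 - x + x\<^sup>2" using assms by (simp add: inverse_eq_divide pos_divide_le_eq)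
  have "(1 - x) * (1 + x) \<le> 1" by (simp add: algebra_simps)
  then show "1 - x \<le> inverse (1 + x)" using assms by (simp add: inverse_eq_divide pos_le_divide_eq)
  show "exp (- x) \<le> inverse (1 + x)"
    using exp_ge_add_one_self[of x] assms unfolding exp_minus by (intro le_imp_inverse_le) auto
qed

lemma exp_neg_mono: "a \<ge> b \<Longrightarrow> exp (- a) \<le> exp (- b)" for a b :: real
  by simp

text \<open>
  For the backward scheme, \<open>1 / (1 + x) = 1 - x / (1 + x) \<le> exp (- x / (1 + x))\<close>, and
  \<open>x / (1 + x)\<close> is at least \<open>x / (1 + X)\<close>.  For the forward scheme, \<open>X \<le> 1\<close> makes the factor
  nonnegative, and \<open>1 - x \<le> exp (- x)\<close>.
\<close>

lemma em_factor_bounds: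
  assumes h: "h > 0" and x: "lap_eig l * h \<le> X" and S: "S = Forward \<Longrightarrow> X \<le> 1"
  shows "0 \<le> em_factor S h l"
    and "em_factor S h l \<le> exp (- (1 / (1 + X) * (lap_eig l * h)))"
    and "\<bar>exp (- (lap_eig l * h)) - em_factor S h l\<bar> \<le> (lap_eig l * h)\<^sup>2"
proof -
  define x where "x = lap_eig l * h"
  have x0: "0 \<le> x" using h lap_eig_nonneg[of l] by (simp add: x_def)
  have xX: "x \<le> X" using x by (simp add: x_def)
  have c: "1 / (1 + X) * x \<le> x / (1 + x)" "x / (1 + x) \<le> x"
    using frac_le[of x x "1 + x" "1 + X"] frac_le[of x x 1 "1 + x"] x0 xX by simp_all
  have e: "1 - x \<le> exp (- x)" using exp_ge_add_one_self[of "- x"] by simp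
  note b = inverse_one_plus_bounds[OF x0] e
  have inv: "inverse (1 + x) \<le> exp (- (x / (1 + x)))"
    using exp_ge_add_one_self[of "- (x / (1 + x))"] x0 by (simp add: field_simps)
  have "0 \<le> em_factor S h l \<and> em_factor S h l \<le> exp (- (1 / (1 + X) * x)) \<and> \<bar>exp (- x) - em_factor S h l\<bar> \<le> x\<^sup>2"
  proof (cases S)
    case Forward
    then have "x \<le> 1" using S xX by simp
    have "exp (- x) \<le> exp (- (1 / (1 + X) * x))" using c by (intro exp_neg_mono) linarith
    from order_trans[OF e this] show ?thesis using \<open>x \<le> 1\<close> b Forward by (auto simp flip: x_def)
  next
    case Backward
    have "exp (- (x / (1 + x))) \<le> exp (- (1 / (1 + X) * x))" using c by (intro exp_neg_mono) linarith
    from order_trans[OF inv this] show ?thesis using b x0 Backward by (auto simp flip: x_def)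
  qed
  then show "0 \<le> em_factor S h l"
    "em_factor S h l \<le> exp (- (1 / (1 + X) * (lap_eig l * h)))"
    "\<bar>exp (- (lap_eig l * h)) - em_factor S h l\<bar> \<le> (lap_eig l * h)\<^sup>2"
    by (auto simp: x_def)
qed

text \<open>
  Multiplied by \<open>d\<close>, which avoids the exponent \<open>p - 1\<close> in the telescoping estimate.
\<close>

lemma power_diff_le:
  fixes a b d :: real
  assumes "0 \<le> a" "0 \<le> b" "a \<le> d" "b \<le> d"
  shows "d * \<bar>a ^ p - b ^ p\<bar> \<le> real p * \<bar>a - b\<bar> * d ^ p"
proof (induction p)
  case (Suc p)
  have d: "0 \<le> d" using assms by simp
  have "\<bar>a ^ Suc p - b ^ Suc p\<bar> = \<bar>a * (a ^ p - b ^ p) + (a - b) * b ^ p\<bar>" by (simp add: algebra_simps)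
  also have "\<dots> \<le> \<bar>a * (a ^ p - b ^ p)\<bar> + \<bar>(a - b) * b ^ p\<bar>" by (rule abs_triangle_ineq)
  also have "\<dots> = a * \<bar>a ^ p - b ^ p\<bar> + \<bar>a - b\<bar> * b ^ p" using assms by (simp add: abs_mult)
  also have "\<dots> \<le> d * \<bar>a ^ p - b ^ p\<bar> + \<bar>a - b\<bar> * d ^ p"
    using assms by (intro add_mono mult_right_mono mult_left_mono power_mono) auto
  also have "\<dots> \<le> real p * \<bar>a - b\<bar> * d ^ p + \<bar>a - b\<bar> * d ^ p" using Suc by simp
  finally have "d * \<bar>a ^ Suc p - b ^ Suc p\<bar> \<le> d * (real p * \<bar>a - b\<bar> * d ^ p + \<bar>a - b\<bar> * d ^ p)"
    using d by (rule mult_left_mono)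
  then show ?case by (simp add: algebra_simps)
qed simp

text \<open>
  The telescoping estimate with \<open>d = exp (- c x)\<close>; division by \<open>d\<close> costs a factor of at most
  \<open>exp X\<close>.
\<close>

lemma exp_power_diff_le:
  fixes x \<xi> c X :: real
  assumes x: "0 \<le> x" "x \<le> X" and c: "0 < c" "c \<le> 1"
    and \<xi>: "0 \<le> \<xi>" "\<xi> \<le> exp (- (c * x))" "\<bar>exp (- x) - \<xi>\<bar> \<le> x\<^sup>2"
  shows "\<bar>exp (- (real p * x)) - \<xi> ^ p\<bar> \<le> exp X * (real p * x\<^sup>2 * exp (- (c * (real p * x))))"
proof -
  have cx: "c * x \<le> x" using x c by (simp add: mult_left_le_one_le)
  have "exp (- (c * x)) * \<bar>exp (- x) ^ p - \<xi> ^ p\<bar> \<le> real p * \<bar>exp (- x) - \<xi>\<bar> * exp (- (c * x)) ^ p"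
    using \<xi> cx by (intro power_diff_le) auto
  also have "\<dots> \<le> real p * x\<^sup>2 * exp (- (c * x)) ^ p" using \<xi> by (intro mult_right_mono mult_left_mono) auto
  finally have "exp (c * x) * (exp (- (c * x)) * \<bar>exp (- x) ^ p - \<xi> ^ p\<bar>) \<le> exp (c * x) * (real p * x\<^sup>2 * exp (- (c * x)) ^ p)"
    by (intro mult_left_mono) auto
  also have "exp (c * x) * (exp (- (c * x)) * \<bar>exp (- x) ^ p - \<xi> ^ p\<bar>) = \<bar>exp (- x) ^ p - \<xi> ^ p\<bar>"
    by (simp add: mult_exp_exp flip: mult.assoc)
  also have "exp (- x) ^ p = exp (- (real p * x))" by (simp flip: exp_of_nat_mult)
  also have "exp (- (c * x)) ^ p = exp (- (c * (real p * x)))" by (simp add: mult_ac flip: exp_of_nat_mult)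
  also have "exp (c * x) * (real p * x\<^sup>2 * exp (- (c * (real p * x)))) \<le> exp X * (real p * x\<^sup>2 * exp (- (c * (real p * x))))"
    using cx x by (intro mult_right_mono) auto
  finally show ?thesis .
qed

text \<open>
  For \<open>y \<ge> 1\<close> the exponential outweighs \<open>y\<^sup>2\<close>, and for \<open>y < 1\<close> the square is below every
  power of exponent at most \<open>1\<close>.
\<close>

lemma power2_exp_le_powr:
  fixes y c \<nu> :: real
  assumes y: "0 < y" and c: "0 < c" "c \<le> 1" and \<nu>: "0 \<le> \<nu>" "\<nu> \<le> 1"
  shows "y\<^sup>2 * exp (- (c * y)) \<le> 2 / c\<^sup>2 * y powr \<nu>"
proof (cases "y \<ge> 1")
  case True
  have "(c * y)\<^sup>2 / 2 \<le> exp (c * y)" using exp_lower_Taylor_quadratic[of "c * y"] mult_pos_pos[OF c(1) y] by linarith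
  then have "c\<^sup>2 * (y\<^sup>2 * exp (- (c * y))) \<le> 2"
    by (simp add: exp_minus power_mult_distrib field_simps)
  then have "y\<^sup>2 * exp (- (c * y)) \<le> 2 / c\<^sup>2" using c by (simp add: field_simps)
  moreover have "1 \<le> y powr \<nu>" by (rule ge_one_powr_ge_zero[OF True \<nu>(1)])
  ultimately show ?thesis using c mult_left_mono[of 1 "y powr \<nu>" "2 / c\<^sup>2"] by simp
next
  case False
  have "y\<^sup>2 * exp (- (c * y)) \<le> y\<^sup>2 * 1" using y c by (intro mult_left_mono) auto
  also have "\<dots> = y powr 2" using y by simp
  also have "\<dots> \<le> y powr \<nu>" using False y \<nu> by (intro powr_mono') auto
  also have "\<dots> = 1 * y powr \<nu>" by simp
  also have "\<dots> \<le> 2 / c\<^sup>2 * y powr \<nu>"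
  proof (rule mult_right_mono)
    have "c\<^sup>2 \<le> 1" using c by (simp add: power_le_one)
    then show "1 \<le> 2 / c\<^sup>2" using c by (simp add: le_divide_eq)
  qed simp
  finally show ?thesis .
qed

text \<open>
  With \<open>t = k h\<close> and \<open>y = lam * t\<close> the error of \<open>k\<close> steps is of order
  \<open>y\<^sup>2 exp (- c y) / k\<close>, while \<open>h powr \<mu> * t powr (\<nu> - \<mu>) * lam powr \<nu>\<close> is
  \<open>k powr (- \<mu>) * y powr \<nu>\<close>.
\<close>

lemma initial_error:
  fixes lam h \<xi> c X \<nu> \<mu> :: real and k :: nat
  assumes lam: "0 \<le> lam" and h: "h > 0" and X: "lam * h \<le> X" and c: "0 < c" "c \<le> 1"
    and \<xi>: "0 \<le> \<xi>" "\<xi> \<le> exp (- (c * (lam * h)))" "\<bar>exp (- (lam * h)) - \<xi>\<bar> \<le> (lam * h)\<^sup>2"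
    and k: "k \<ge> 1" and \<nu>: "0 \<le> \<nu>" "\<nu> \<le> 1" and \<mu>: "\<mu> \<le> 1"
  shows "\<bar>exp (- lam * (real k * h)) - \<xi> ^ k\<bar>
    \<le> exp X * (2 / c\<^sup>2) * (h powr \<mu> * (real k * h) powr (\<nu> - \<mu>)) * (1 + lam) powr \<nu>"
proof (cases "lam = 0")
  case True
  then show ?thesis using \<xi>(3) by simp
next
  case False
  define y where "y = lam * (real k * h)"
  have lam: "lam > 0" using False lam by simp
  have y: "y > 0" using lam h k by (simp add: y_def)
  have k0: "real k > 0" using k by simp
  have "\<bar>exp (- (real k * (lam * h))) - \<xi> ^ k\<bar> \<le> exp X * (real k * (lam * h)\<^sup>2 * exp (- (c * (real k * (lam * h)))))"
    using lam h X by (intro exp_power_diff_le c \<xi>) auto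
  also have "real k * (lam * h)\<^sup>2 * exp (- (c * (real k * (lam * h)))) = inverse (real k) * (y\<^sup>2 * exp (- (c * y)))"
    using k0 by (simp add: y_def power2_eq_square field_simps)
  also have "exp X * (inverse (real k) * (y\<^sup>2 * exp (- (c * y))))
      \<le> exp X * (real k powr (- \<mu>) * (2 / c\<^sup>2 * y powr \<nu>))"
  proof -
    have "inverse (real k) = real k powr (- 1)" using k0 by (simp add: powr_minus)
    also have "\<dots> \<le> real k powr (- \<mu>)" using k \<mu> by (intro powr_mono) auto
    finally have "inverse (real k) \<le> real k powr (- \<mu>)" .
    from mult_mono[OF this power2_exp_le_powr[OF y c \<nu>]] show ?thesis by (intro mult_left_mono) auto
  qed
  also have "real k powr (- \<mu>) * (2 / c\<^sup>2 * y powr \<nu>)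
      = 2 / c\<^sup>2 * (h powr \<mu> * (real k * h) powr (\<nu> - \<mu>)) * lam powr \<nu>"
  proof -
    have "h powr \<mu> * h powr (\<nu> - \<mu>) = h powr \<nu>" "real k powr (\<nu> - \<mu>) = real k powr (- \<mu>) * real k powr \<nu>"
      by (simp_all flip: powr_add)
    then show ?thesis using lam h k0 by (simp add: y_def powr_mult mult_ac)
  qed
  also have "exp X * (2 / c\<^sup>2 * (h powr \<mu> * (real k * h) powr (\<nu> - \<mu>)) * lam powr \<nu>)
      \<le> exp X * (2 / c\<^sup>2 * (h powr \<mu> * (real k * h) powr (\<nu> - \<mu>)) * (1 + lam) powr \<nu>)"
    using lam \<nu> by (intro mult_left_mono powr_mono2) auto
  finally show ?thesis by (simp add: mult_ac)
qed

text \<open>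
  With \<open>x = lam * h\<close>, the variation of the kernel over one cell is at most \<open>x exp (- p x)\<close>, and
  the error of the Euler factor is of order \<open>x (q x) exp (- c q x)\<close>; half of the exponential decay
  is spent on the factor \<open>q x\<close>.  The two values of \<open>q\<close> are those of the forward and of the
  backward scheme.
\<close>

lemma kernel_error_pointwise:
  fixes lam h \<xi> c X r :: real and p q :: nat
  assumes lam: "0 \<le> lam" and h: "h > 0" and X: "lam * h \<le> X" and c: "0 < c" "c \<le> 1"
    and \<xi>: "0 \<le> \<xi>" "\<xi> \<le> exp (- (c * (lam * h)))" "\<bar>exp (- (lam * h)) - \<xi>\<bar> \<le> (lam * h)\<^sup>2"
    and r: "real p * h \<le> r" "r \<le> real (Suc p) * h" and q: "q = p \<or> q = Suc p"
  shows "\<bar>exp (- (lam * r)) - \<xi> ^ q\<bar> \<le> (exp X + exp X * (2 / c) * exp X) * (lam * h) * exp (- (c / 2 * (lam * r)))"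
proof -
  define x where "x = lam * h"
  define z where "z = lam * r"
  have x: "0 \<le> x" "x \<le> X" using lam h X by (auto simp: x_def)
  have z: "real p * x \<le> z" "z \<le> real p * x + x"
    using mult_left_mono[OF r(1) lam] mult_left_mono[OF r(2) lam] by (auto simp: x_def z_def algebra_simps)
  have z0: "0 \<le> z" using z(1) x by (meson mult_nonneg_nonneg of_nat_0_le_iff order_trans)
  have qx: "real p * x \<le> real q * x" "real q * x \<le> real p * x + x"
    using q x by (auto simp: algebra_simps)
  have 1: "\<bar>exp (- z) - exp (- (real q * x))\<bar> \<le> exp X * x * exp (- (c / 2 * z))"
  proof -
    have "exp (- (real p * x + x)) \<le> exp (- z)" "exp (- z) \<le> exp (- (real p * x))"
      "exp (- (real p * x + x)) \<le> exp (- (real q * x))" "exp (- (real q * x)) \<le> exp (- (real p * x))"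
      using z qx by (simp_all only: exp_le_cancel_iff neg_le_iff_le)
    then have "\<bar>exp (- z) - exp (- (real q * x))\<bar> \<le> exp (- (real p * x)) - exp (- (real p * x + x))"
      by linarith
    also have "\<dots> = exp (- (real p * x)) * (1 - exp (- x))" by (simp add: right_diff_distrib mult_exp_exp)
    also have "\<dots> \<le> exp (- (real p * x)) * x"
      using exp_ge_add_one_self[of "- x"] by (intro mult_left_mono) auto
    also have "exp (- (real p * x)) \<le> exp X * exp (- (c / 2 * z))"
    proof -
      have "c / 2 * z \<le> z" using c z0 by (intro mult_left_le_one_le) auto
      then show ?thesis using z x unfolding mult_exp_exp by simp
    qed
    finally show ?thesis using x by (simp add: mult_right_mono mult_ac)
  qed
  have 2: "\<bar>exp (- (real q * x)) - \<xi> ^ q\<bar> \<le> exp X * (2 / c) * exp X * x * exp (- (c / 2 * z))"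
  proof -
    have "\<bar>exp (- (real q * x)) - \<xi> ^ q\<bar> \<le> exp X * (real q * x\<^sup>2 * exp (- (c * (real q * x))))"
      using x \<xi> by (intro exp_power_diff_le c) (auto simp: x_def)
    also have "real q * x\<^sup>2 * exp (- (c * (real q * x))) \<le> 2 / c * exp X * x * exp (- (c / 2 * z))"
    proof -
      define w where "w = c / 2 * (real q * x)"
      have "w \<le> exp w" using exp_ge_add_one_self[of w] by linarith
      then have "w * exp (- w) \<le> 1" by (simp add: exp_minus field_simps)
      then have "w * exp (- w) * exp (- w) \<le> 1 * exp (- w)" by (intro mult_right_mono) auto
      also have "1 * exp (- w) \<le> exp X * exp (- (c / 2 * z))"
      proof -
        have "c / 2 * z \<le> c / 2 * (real q * x + x)" using z qx c by (intro mult_left_mono) auto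
        moreover have "c / 2 * x \<le> x" using c x by (intro mult_left_le_one_le) auto
        ultimately have "- w \<le> X + - (c / 2 * z)" using x by (simp add: w_def distrib_left)
        then show ?thesis unfolding mult_exp_exp by simp
      qed
      finally have "2 / c * x * (w * exp (- w) * exp (- w)) \<le> 2 / c * x * (exp X * exp (- (c / 2 * z)))"
        using c x by (intro mult_left_mono) auto
      moreover have "exp (- w) * exp (- w) = exp (- (c * (real q * x)))" unfolding mult_exp_exp by (simp add: w_def)
      moreover have "2 / c * x * w = real q * x\<^sup>2" using c by (simp add: w_def power2_eq_square)
      ultimately show ?thesis by (metis (no_types, lifting) mult.assoc mult.commute)
    qed
    finally show ?thesis by (simp add: mult_left_mono mult_ac)
  qed
  have "\<bar>exp (- z) - \<xi> ^ q\<bar> \<le> \<bar>exp (- z) - exp (- (real q * x))\<bar> + \<bar>exp (- (real q * x)) - \<xi> ^ q\<bar>" by linarith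
  also have "\<dots> \<le> (exp X + exp X * (2 / c) * exp X) * x * exp (- (c / 2 * z))"
    using add_mono[OF 1 2] by (simp only: distrib_right)
  finally show ?thesis by (simp add: x_def z_def)
qed


lemma nn_integral_exp_kernel:
  fixes a t :: real
  assumes a: "a > 0" and t: "t \<ge> 0"
  shows "(\<integral>\<^sup>+r\<in>{0..t}. ennreal (exp (- (a * (t - r)))) \<partial>lborel) \<le> ennreal (1 / a)"
proof -
  have "(\<integral>\<^sup>+r\<in>{0..t}. ennreal (exp (- (a * (t - r)))) \<partial>lborel)
      = ennreal (exp (- (a * (t - t))) / a - exp (- (a * (t - 0))) / a)"
    using a t by (intro nn_integral_FTC_Icc) (auto intro!: derivative_eq_intros)
  also have "\<dots> \<le> ennreal (1 / a)" using a by (intro ennreal_leI) simp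
  finally show ?thesis .
qed

text \<open>
  The square of the pointwise bound is of order \<open>(lam * h)\<^sup>2 exp (- c lam (t - r))\<close>, and the
  integral of the exponential gains the factor \<open>1 / (c lam)\<close>.  The cells are counted from \<open>0\<close> and
  the increments of the scheme from \<open>1\<close>, hence the exponent \<open>k - Suc i + \<delta>\<close>.
\<close>

lemma kernel_error_integral:
  fixes lam h \<xi> c X :: real and k \<delta> :: nat
  assumes lam: "0 \<le> lam" and h: "h > 0" and X: "lam * h \<le> X" and c: "0 < c" "c \<le> 1"
    and \<xi>: "0 \<le> \<xi>" "\<xi> \<le> exp (- (c * (lam * h)))" "\<bar>exp (- (lam * h)) - \<xi>\<bar> \<le> (lam * h)\<^sup>2"
    and \<delta>: "\<delta> \<le> 1"
  shows "(\<integral>\<^sup>+r\<in>{0..real k * h}. ennreal ((exp (- lam * (real k * h - r))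
        - step_function k (\<lambda>i. real i * h) (\<lambda>i. \<xi> ^ (k - Suc i + \<delta>)) r)\<^sup>2) \<partial>lborel)
    \<le> ennreal ((exp X + exp X * (2 / c) * exp X)\<^sup>2 / c * (lam * h\<^sup>2))"
proof -
  define K where "K = exp X + exp X * (2 / c) * exp X"
  define t where "t = real k * h"
  let ?G = "step_function k (\<lambda>i. real i * h) (\<lambda>i. \<xi> ^ (k - Suc i + \<delta>))"
  have t: "t \<ge> 0" using h by (simp add: t_def)
  have pw: "(exp (- lam * (t - r)) - ?G r)\<^sup>2 \<le> (K * (lam * h))\<^sup>2 * exp (- (c * lam * (t - r)))"
    if r: "0 < r" "r \<le> t" for r
  proof -
    obtain i where i: "i < k" "real i * h < r" "r \<le> real (Suc i) * h" "?G r = \<xi> ^ (k - Suc i + \<delta>)"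
      using step_function_uniform_grid[OF h r(1), of k] r(2) unfolding t_def by metis
    define p where "p = k - Suc i"
    have k: "real k = real p + real i + 1" using i by (simp add: p_def of_nat_diff)
    have "\<bar>exp (- (lam * (t - r))) - \<xi> ^ (p + \<delta>)\<bar> \<le> K * (lam * h) * exp (- (c / 2 * (lam * (t - r))))"
      unfolding K_def
      by (rule kernel_error_pointwise[OF lam h X c \<xi>, of p])
         (use i \<delta> in \<open>auto simp: t_def k algebra_simps\<close>)
    then have "(exp (- (lam * (t - r))) - \<xi> ^ (p + \<delta>))\<^sup>2 \<le> (K * (lam * h) * exp (- (c / 2 * (lam * (t - r)))))\<^sup>2"
      by (rule abs_le_square_iff[THEN iffD1, OF order_trans]) simp
    also have "\<dots> = (K * (lam * h))\<^sup>2 * exp (- (c * lam * (t - r)))"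
    proof -
      have "(exp (- (c / 2 * (lam * (t - r)))))\<^sup>2 = exp (- (c * lam * (t - r)))"
        unfolding power2_eq_square mult_exp_exp by (simp add: mult.assoc)
      then show ?thesis by (simp add: power_mult_distrib)
    qed
    finally show ?thesis using i by (simp add: p_def)
  qed
  have "(\<integral>\<^sup>+r\<in>{0..t}. ennreal ((exp (- lam * (t - r)) - ?G r)\<^sup>2) \<partial>lborel)
      \<le> (\<integral>\<^sup>+r. ennreal ((K * (lam * h))\<^sup>2) * (ennreal (exp (- (c * lam * (t - r)))) * indicator {0..t} r) \<partial>lborel)"
  proof (rule nn_integral_mono_AE, use AE_lborel_singleton[of 0] in eventually_elim)
    case (elim r)
    show ?case
    proof (cases "r \<in> {0..t}")
      case True
      then have "ennreal ((exp (- lam * (t - r)) - ?G r)\<^sup>2)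
          \<le> ennreal ((K * (lam * h))\<^sup>2 * exp (- (c * lam * (t - r))))"
        using elim by (intro ennreal_leI pw) auto
      then show ?thesis using True by (simp add: ennreal_mult)
    qed simp
  qed
  also have "\<dots> = ennreal ((K * (lam * h))\<^sup>2) * (\<integral>\<^sup>+r\<in>{0..t}. ennreal (exp (- (c * lam * (t - r)))) \<partial>lborel)"
    by (rule nn_integral_cmult) measurable
  also have "\<dots> \<le> ennreal (K\<^sup>2 / c * (lam * h\<^sup>2))"
  proof (cases "lam = 0")
    case False
    then have cl: "c * lam > 0" using c lam by simp
    have "ennreal ((K * (lam * h))\<^sup>2) * (\<integral>\<^sup>+r\<in>{0..t}. ennreal (exp (- (c * lam * (t - r)))) \<partial>lborel)
        \<le> ennreal ((K * (lam * h))\<^sup>2) * ennreal (1 / (c * lam))"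
      by (intro mult_left_mono nn_integral_exp_kernel cl t) simp
    also have "\<dots> = ennreal ((K * (lam * h))\<^sup>2 * (1 / (c * lam)))"
      using cl by (intro ennreal_mult[symmetric]) auto
    also have "(K * (lam * h))\<^sup>2 * (1 / (c * lam)) = K\<^sup>2 / c * (lam * h\<^sup>2)"
      using cl by (simp add: power2_eq_square)
    finally show ?thesis .
  qed simp
  finally show ?thesis unfolding K_def t_def .
qed

section \<open>The noise term of a coefficient\<close>

text \<open>
  A coefficient is a continuous linear functional, so measurability and the properties of the
  increments are inherited from \<open>L\<close>; for stochastic continuity the coefficient is bounded by the
  norm.
\<close>

lemma levy_coefficient:
  assumes M: "prob_space M"
    and L: "levy_process M (Sobolev_borel \<eta>) (Sobolev_norm \<eta>) L"
    and sq: "square_integrable_process M (Sobolev_norm \<eta>) L"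
    and m: "m \<in> {- int l..int l}"
  shows "square_integrable_levy M (\<lambda>t \<omega>. L t \<omega> l m)"
proof -
  interpret prob_space M by (rule M)
  define w where "w = (1 + lap_eig l) powr (- \<eta> / 2)"
  have w: "w > 0" using lap_eig_nonneg[of l] by (simp add: w_def)
  have coeff_le: "ennreal \<bar>a l m\<bar> \<le> ennreal w * Sobolev_norm \<eta> a" for a
    unfolding w_def by (rule coeff_le_Sobolev_norm[OF m])
  have coeff [measurable]: "(\<lambda>a. a l m) \<in> borel_measurable (Sobolev_borel \<eta>)"
    by (rule Sobolev_coeff_measurable[OF m])
  have L_meas: "L t \<in> measurable M (Sobolev_borel \<eta>)" if "t \<ge> 0" for t
    using L that unfolding levy_process_def by blast
  have Z_meas: "(\<lambda>\<omega>. L t \<omega> l m) \<in> borel_measurable M" if "t \<ge> 0" for t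
    using measurable_compose[OF L_meas[OF that] coeff] .
  have L_indep: "indep_vars (\<lambda>_. Sobolev_borel \<eta>) (\<lambda>i \<omega>. L (u (Suc i)) \<omega> - L (u i) \<omega>) {..<n}"
    if "0 \<le> u 0" "\<And>i. i < n \<Longrightarrow> u i < u (Suc i)" for u :: "nat \<Rightarrow> real" and n
    using L that unfolding levy_process_def by blast
  have incr_meas: "(\<lambda>\<omega>. L t \<omega> - L s \<omega>) \<in> measurable M (Sobolev_borel \<eta>)" if "0 \<le> s" "s < t" for s t
    using L_indep[of "\<lambda>i. if i = 0 then s else t" 1] that by (auto simp: indep_vars_def)
  have L_zero: "AE \<omega> in M. L 0 \<omega> = 0" using L unfolding levy_process_def by blast
  show ?thesis
  proof (unfold_locales)
    show "(\<lambda>\<omega>. L t \<omega> l m) \<in> borel_measurable M" if "t \<ge> 0" for t by (rule Z_meas[OF that])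
    show "AE \<omega> in M. L 0 \<omega> l m = 0" using L_zero by eventually_elim simp
    show "integrable M (\<lambda>\<omega>. (L t \<omega> l m)\<^sup>2)" if t: "t \<ge> 0" for t
    proof (rule integrableI_nonneg)
      show "(\<lambda>\<omega>. (L t \<omega> l m)\<^sup>2) \<in> borel_measurable M" using Z_meas[OF t] by measurable
      have "ennreal ((L t \<omega> l m)\<^sup>2) \<le> ennreal (w\<^sup>2) * (Sobolev_norm \<eta> (L t \<omega>))\<^sup>2" for \<omega>
        using power_mono[OF coeff_le[of "L t \<omega>"], of 2] w
        by (simp add: ennreal_power power_mult_distrib)
      then have "(\<integral>\<^sup>+\<omega>. ennreal ((L t \<omega> l m)\<^sup>2) \<partial>M) \<le> (\<integral>\<^sup>+\<omega>. ennreal (w\<^sup>2) * (Sobolev_norm \<eta> (L t \<omega>))\<^sup>2 \<partial>M)"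
        by (intro nn_integral_mono)
      also have "\<dots> = ennreal (w\<^sup>2) * (L2_norm M (Sobolev_norm \<eta>) (L t))\<^sup>2"
        unfolding L2_norm_power2
        using measurable_compose[OF L_meas[OF t] Sobolev_norm_measurable]
        by (intro nn_integral_cmult) measurable
      also have "\<dots> < \<top>"
        using sq t unfolding square_integrable_process_def
        by (auto simp: ennreal_mult_less_top power_less_top_ennreal)
      finally show "(\<integral>\<^sup>+\<omega>. ennreal ((L t \<omega> l m)\<^sup>2) \<partial>M) < \<infinity>" by simp
    qed simp
    show "indep_var borel (\<lambda>\<omega>. L s \<omega> l m - L 0 \<omega> l m) borel (\<lambda>\<omega>. L t \<omega> l m - L s \<omega> l m)"
      if st: "0 < s" "s < t" for s t
    proof -
      define u where "u i = (if i = 0 then 0 else if i = 1 then s else t)" for i :: nat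
      have "indep_vars (\<lambda>_. Sobolev_borel \<eta>) (\<lambda>i \<omega>. L (u (Suc i)) \<omega> - L (u i) \<omega>) {..<2}"
        using st by (intro L_indep) (auto simp: u_def less_Suc_eq numeral_2_eq_2)
      then have "indep_vars (\<lambda>_. borel) (\<lambda>i. (\<lambda>a. a l m) \<circ> (\<lambda>\<omega>. L (u (Suc i)) \<omega> - L (u i) \<omega>)) {..<2}"
        by (rule indep_vars_compose) (rule coeff)
      then have "indep_vars (\<lambda>_. borel) (\<lambda>i \<omega>. L (u (Suc i)) \<omega> l m - L (u i) \<omega> l m) (insert 0 {1})"
        by (simp add: comp_def lessThan_nat_numeral lessThan_Suc insert_commute numeral_2_eq_2)
      from indep_vars_sum[OF _ _ this]
      have "indep_var borel (\<lambda>\<omega>. L (u 1) \<omega> l m - L (u 0) \<omega> l m) borel (\<lambda>\<omega>. L (u 2) \<omega> l m - L (u 1) \<omega> l m)"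
        by (simp add: numeral_2_eq_2)
      then show ?thesis by (simp add: u_def)
    qed
    show "distr M borel (\<lambda>\<omega>. L (s + t) \<omega> l m - L s \<omega> l m) = distr M borel (\<lambda>\<omega>. L t \<omega> l m)"
      if st: "0 \<le> s" "0 \<le> t" for s t
    proof (cases "t = 0")
      case True
      have "distr M borel (\<lambda>\<omega>. 0 :: real) = distr M borel (\<lambda>\<omega>. L 0 \<omega> l m)"
        using L_zero Z_meas[of 0] by (intro distr_cong_AE) (auto elim: eventually_mono)
      then show ?thesis using True by simp
    next
      case False
      have "distr M (Sobolev_borel \<eta>) (\<lambda>\<omega>. L (s + t) \<omega> - L s \<omega>) = distr M (Sobolev_borel \<eta>) (L t)"
        using L st unfolding levy_process_def by blast
      then have "distr (distr M (Sobolev_borel \<eta>) (\<lambda>\<omega>. L (s + t) \<omega> - L s \<omega>)) borel (\<lambda>a. a l m)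
          = distr (distr M (Sobolev_borel \<eta>) (L t)) borel (\<lambda>a. a l m)" by simp
      then show ?thesis
        using incr_meas[of s "s + t"] L_meas[of t] st False coeff by (simp add: distr_distr comp_def)
    qed
    show "((\<lambda>t. prob {\<omega> \<in> space M. \<bar>L t \<omega> l m\<bar> > e}) \<longlongrightarrow> 0) (at_right 0)" if e: "e > 0" for e
    proof (rule tendsto_sandwich[OF _ _ tendsto_const])
      have "((\<lambda>t. prob {\<omega> \<in> space M. Sobolev_norm \<eta> (L t \<omega> - L 0 \<omega>) > ennreal (e / w)}) \<longlongrightarrow> 0) (at 0 within {0..})"
        using L e w unfolding levy_process_def by (meson divide_pos_pos order_refl)
      then show "((\<lambda>t. prob {\<omega> \<in> space M. Sobolev_norm \<eta> (L t \<omega> - L 0 \<omega>) > ennreal (e / w)}) \<longlongrightarrow> 0) (at_right 0)"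
        by (rule tendsto_within_subset) auto
      have "prob {\<omega> \<in> space M. \<bar>L t \<omega> l m\<bar> > e}
          \<le> prob {\<omega> \<in> space M. Sobolev_norm \<eta> (L t \<omega> - L 0 \<omega>) > ennreal (e / w)}" if t: "t > 0" for t
      proof (rule finite_measure_mono_AE)
        show "AE \<omega> in M. \<omega> \<in> {\<omega> \<in> space M. \<bar>L t \<omega> l m\<bar> > e}
            \<longrightarrow> \<omega> \<in> {\<omega> \<in> space M. Sobolev_norm \<eta> (L t \<omega> - L 0 \<omega>) > ennreal (e / w)}"
          using L_zero
        proof eventually_elim
          case (elim \<omega>)
          have "ennreal (e / w) < Sobolev_norm \<eta> (L t \<omega>)" if "e < \<bar>L t \<omega> l m\<bar>"
          proof (rule ccontr)
            assume "\<not> ?thesis"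
            then have "ennreal w * Sobolev_norm \<eta> (L t \<omega>) \<le> ennreal w * ennreal (e / w)"
              by (intro mult_left_mono) auto
            then have "ennreal \<bar>L t \<omega> l m\<bar> \<le> ennreal w * ennreal (e / w)"
              using coeff_le[of "L t \<omega>"] by (rule order_trans[rotated])
            also have "\<dots> = ennreal e" using w e by (simp flip: ennreal_mult)
            finally show False using that e by simp
          qed
          then show ?case using elim by simp
        qed
        have [measurable]: "(\<lambda>\<omega>. Sobolev_norm \<eta> (L t \<omega> - L 0 \<omega>)) \<in> borel_measurable M"
          using measurable_compose[OF incr_meas[of 0 t] Sobolev_norm_measurable] t by simp
        show "{\<omega> \<in> space M. Sobolev_norm \<eta> (L t \<omega> - L 0 \<omega>) > ennreal (e / w)} \<in> sets M" by measurable
      qed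
      then show "\<forall>\<^sub>F t in at_right 0. prob {\<omega> \<in> space M. \<bar>L t \<omega> l m\<bar> > e}
          \<le> prob {\<omega> \<in> space M. Sobolev_norm \<eta> (L t \<omega> - L 0 \<omega>) > ennreal (e / w)}"
        by (auto simp: eventually_at_right_less intro: eventually_at_rightI[of 0 1])
    qed simp
  qed
qed


context square_integrable_levy
begin

text \<open>
  The kernel is Lipschitz continuous with constant \<open>lam\<close>, so the choice in \<open>stoch_integral\<close> is a
  choice from a nonempty set.
\<close>

lemma stoch_integral_exp:
  assumes lam: "0 \<le> lam" and t: "t > 0"
  shows "is_stoch_integral M Z t (\<lambda>s. exp (- lam * (t - s))) (stoch_integral M Z t (\<lambda>s. exp (- lam * (t - s))))"
  unfolding stoch_integral_def
proof (rule someI_ex[of "is_stoch_integral M Z t (\<lambda>s. exp (- lam * (t - s)))"],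
    rule stoch_integral_exists[OF t lam])
  fix x y assume x: "x \<in> {0..t}" and y: "y \<in> {0..t}"
  have main: "exp (- lam * (t - b)) - exp (- lam * (t - a)) \<le> lam * (b - a)"
    if ab: "a \<le> b" "b \<le> t" for a b
  proof -
    have "exp (- lam * (t - b)) - exp (- lam * (t - a)) = exp (- lam * (t - b)) * (1 - exp (- (lam * (b - a))))"
      by (simp add: right_diff_distrib mult_exp_exp algebra_simps)
    also have "\<dots> \<le> 1 * (lam * (b - a))"
      using exp_ge_add_one_self[of "- (lam * (b - a))"] ab lam by (intro mult_mono) auto
    finally show ?thesis by simp
  qed
  have mono: "exp (- lam * (t - a)) \<le> exp (- lam * (t - b))" if "a \<le> b" for a b
    using that lam by (simp add: mult_left_mono)
  have "\<bar>exp (- lam * (t - a)) - exp (- lam * (t - b))\<bar> \<le> lam * (b - a)" if "a \<le> b" "b \<le> t" for a b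
    using main[OF that] mono[OF that(1)] by linarith
  from this[of x y] this[of y x] x y
  show "\<bar>exp (- lam * (t - x)) - exp (- lam * (t - y))\<bar> \<le> lam * \<bar>x - y\<bar>"
    by (cases "x \<le> y") (auto simp: abs_minus_commute)
qed

text \<open>
  The noise term of the scheme is itself an elementary integral, so the difference is controlled by
  that of the integrands.
\<close>

lemma noise_error:
  fixes lam h \<xi> c X T :: real and k \<delta> :: nat
  defines "t \<equiv> real k * h"
  defines "D \<equiv> \<lambda>\<omega>. stoch_integral M Z t (\<lambda>s. exp (- lam * (t - s))) \<omega>
      - (\<Sum>j=1..k. \<xi> ^ (k - j + \<delta>) * (Z (real j * h) \<omega> - Z (real (j - 1) * h) \<omega>))"
  assumes lam: "0 \<le> lam" and h: "h > 0" and X: "lam * h \<le> X" and c: "0 < c" "c \<le> 1"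
    and \<xi>: "0 \<le> \<xi>" "\<xi> \<le> exp (- (c * (lam * h)))" "\<bar>exp (- (lam * h)) - \<xi>\<bar> \<le> (lam * h)\<^sup>2"
    and \<delta>: "\<delta> \<le> 1" and k: "k \<ge> 1" and tT: "t \<le> T"
  shows "D \<in> borel_measurable M"
    and "(\<integral>\<^sup>+\<omega>. ennreal ((D \<omega>)\<^sup>2) \<partial>M)
      \<le> ennreal (4 * (1 + T) * ((exp X + exp X * (2 / c) * exp X)\<^sup>2 / c) * ((vari + mean\<^sup>2) * (lam * h\<^sup>2)))"
proof -
  define I where "I = stoch_integral M Z t (\<lambda>s. exp (- lam * (t - s)))"
  define K where "K = (exp X + exp X * (2 / c) * exp X)\<^sup>2 / c"
  define Y where "Y = step_integral Z k (\<lambda>i. real i * h) (\<lambda>i. \<xi> ^ (k - Suc i + \<delta>))"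
  define G where "G = step_function k (\<lambda>i. real i * h) (\<lambda>i. \<xi> ^ (k - Suc i + \<delta>))"
  have t: "t > 0" using h k by (simp add: t_def)
  have sum_shift: "(\<Sum>j=1..k. \<xi> ^ (k - j + \<delta>) * (Z (real j * h) \<omega> - Z (real (j - 1) * h) \<omega>)) = Y \<omega>" for \<omega>
    unfolding Y_def step_integral_def
    by (subst sum_bounds_lt_plus1[symmetric]) simp
  have D: "D = (\<lambda>\<omega>. I \<omega> - Y \<omega>)" unfolding D_def I_def sum_shift ..
  have I: "is_stoch_integral M Z t (\<lambda>s. exp (- lam * (t - s))) I"
    unfolding I_def by (rule stoch_integral_exp[OF lam t])
  have E: "elementary Z t Y G"
    unfolding Y_def G_def using h by (intro elementary_step) (auto simp: t_def distrib_right)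
  show "D \<in> borel_measurable M"
    using I elementary_second_moment[OF E] unfolding D is_stoch_integral_def by auto
  have "(\<integral>\<^sup>+\<omega>. ennreal ((D \<omega>)\<^sup>2) \<partial>M)
      \<le> ennreal (4 * (vari + t * mean\<^sup>2)) * (\<integral>\<^sup>+r\<in>{0..t}. ennreal ((exp (- lam * (t - r)) - G r)\<^sup>2) \<partial>lborel)"
    unfolding D using t by (intro stoch_integral_elementary_bound I E) auto
  also have "\<dots> \<le> ennreal (4 * ((1 + T) * (vari + mean\<^sup>2))) * ennreal (K * (lam * h\<^sup>2))"
  proof (rule mult_mono)
    have "t * mean\<^sup>2 \<le> T * mean\<^sup>2" using tT by (intro mult_right_mono) auto
    moreover have "0 \<le> T * vari" using t tT vari_nonneg by (intro mult_nonneg_nonneg) auto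
    moreover have "0 \<le> mean\<^sup>2" by simp
    ultimately have "4 * (vari + t * mean\<^sup>2) \<le> 4 * ((1 + T) * (vari + mean\<^sup>2))"
      by (simp only: distrib_left distrib_right mult_1_left)
    then show "ennreal (4 * (vari + t * mean\<^sup>2)) \<le> ennreal (4 * ((1 + T) * (vari + mean\<^sup>2)))"
      by (rule ennreal_leI)
    show "(\<integral>\<^sup>+r\<in>{0..t}. ennreal ((exp (- lam * (t - r)) - G r)\<^sup>2) \<partial>lborel) \<le> ennreal (K * (lam * h\<^sup>2))"
      unfolding G_def K_def t_def by (rule kernel_error_integral[OF lam h X c \<xi> \<delta>])
  qed auto
  also have "\<dots> = ennreal (4 * ((1 + T) * (vari + mean\<^sup>2)) * (K * (lam * h\<^sup>2)))"
    using lam c by (intro ennreal_mult[symmetric] mult_nonneg_nonneg) (use t tT vari_nonneg in \<open>auto simp: K_def intro!: add_nonneg_nonneg\<close>)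
  also have "4 * ((1 + T) * (vari + mean\<^sup>2)) * (K * (lam * h\<^sup>2)) = 4 * (1 + T) * K * ((vari + mean\<^sup>2) * (lam * h\<^sup>2))"
    by (simp only: mult_ac)
  finally show "(\<integral>\<^sup>+\<omega>. ennreal ((D \<omega>)\<^sup>2) \<partial>M)
      \<le> ennreal (4 * (1 + T) * ((exp X + exp X * (2 / c) * exp X)\<^sup>2 / c) * ((vari + mean\<^sup>2) * (lam * h\<^sup>2)))"
    unfolding K_def .
qed

end

section \<open>The rate of the noise term\<close>

text \<open>
  Since \<open>(1 + lam) * h\<close> is bounded by \<open>X + T\<close>, excess powers of \<open>1 + lam\<close> can be traded for
  powers of \<open>h\<close> if \<open>\<eta> \<le> 1\<close>.  Beyond that the rate stays at \<open>h\<^sup>2\<close>.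
\<close>

lemma noise_rate:
  fixes lam h X T \<eta> :: real
  assumes lam: "0 \<le> lam" and h: "0 < h" "h \<le> T" and X: "lam * h \<le> X"
  shows "lam * h\<^sup>2 \<le> (1 + (X + T) powr (1 - \<eta>)) * ((1 + lam) powr \<eta> * h powr min (\<eta> + 1) 2)"
proof -
  have w: "(1 + lam) powr \<eta> * h powr min (\<eta> + 1) 2 \<ge> 0" by simp
  show ?thesis
  proof (cases "\<eta> \<le> 1")
    case True
    have "lam * h\<^sup>2 \<le> (1 + lam) * h\<^sup>2" by (intro mult_right_mono) auto
    also have "(1 + lam) * h\<^sup>2 = ((1 + lam) * h) powr (1 - \<eta>) * ((1 + lam) powr \<eta> * h powr (\<eta> + 1))"
    proof -
      have "(1 + lam) powr (1 - \<eta>) * (1 + lam) powr \<eta> = 1 + lam" "h powr (1 - \<eta>) * h powr (\<eta> + 1) = h\<^sup>2"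
        using lam h by (simp_all flip: powr_add)
      then show ?thesis using lam h by (simp add: powr_mult mult_ac)
    qed
    also have "\<dots> \<le> (X + T) powr (1 - \<eta>) * ((1 + lam) powr \<eta> * h powr (\<eta> + 1))"
      using lam h X True by (intro mult_right_mono powr_mono2) (auto simp: algebra_simps)
    also have "\<dots> \<le> (1 + (X + T) powr (1 - \<eta>)) * ((1 + lam) powr \<eta> * h powr (\<eta> + 1))"
      by (intro mult_right_mono) auto
    finally show ?thesis using True by simp
  next
    case False
    have "lam \<le> (1 + lam) powr 1" using lam by simp
    also have "\<dots> \<le> (1 + lam) powr \<eta>" using False lam by (intro powr_mono) auto
    finally have "lam * h\<^sup>2 \<le> (1 + lam) powr \<eta> * h\<^sup>2" by (intro mult_right_mono) auto
    also have "(1 + lam) powr \<eta> * h\<^sup>2 = (1 + lam) powr \<eta> * h powr min (\<eta> + 1) 2"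
      using False h by (simp add: min_def)
    also have "(1 + lam) powr \<eta> * h powr min (\<eta> + 1) 2 \<le> (1 + (X + T) powr (1 - \<eta>)) * ((1 + lam) powr \<eta> * h powr min (\<eta> + 1) 2)"
      using mult_right_mono[OF _ w, of 1 "1 + (X + T) powr (1 - \<eta>)"] by simp
    finally show ?thesis .
  qed
qed

text \<open>
  There are \<open>2 l + 1\<close> coefficients at level \<open>l\<close>, and their second moments are of order
  \<open>l powr (- \<alpha>)\<close>; the series behaves like that of \<open>l powr (1 + 2 * \<eta> - \<alpha>)\<close>.
\<close>

lemma noise_scaled_summable:
  assumes meas: "\<And>l m. m \<in> {- int l..int l} \<Longrightarrow> (\<lambda>\<omega>. L 1 \<omega> l m) \<in> borel_measurable M"
    and noise: "noise_scaled M L \<alpha>" and \<eta>: "\<eta> + 1 < \<alpha> / 2"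
  shows "summable (\<lambda>l. \<Sum>m\<in>{- int l..int l}. (1 + lap_eig l) powr \<eta> * (levy_var M L l m + (levy_mean M L l m)\<^sup>2))"
proof -
  obtain a C' Lh mh vh where
    all: "\<forall>l\<ge>1. \<bar>a l\<bar> \<le> C' * real l powr (- \<alpha> / 2)"
      "\<forall>l. \<forall>m\<in>{- int l..int l}. levy_process M borel abs_norm (Lh l m)"
      "\<forall>l. \<forall>m\<in>{- int l..int l}. \<forall>t\<ge>0. integrable M (\<lambda>\<omega>. (Lh l m t \<omega>)\<^sup>2)
        \<and> (\<integral>\<omega>. Lh l m t \<omega> \<partial>M) = t * mh
        \<and> (\<integral>\<omega>. (Lh l m t \<omega> - (\<integral>\<omega>'. Lh l m t \<omega>' \<partial>M))\<^sup>2 \<partial>M) = t * vh"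
      "\<forall>l. \<forall>m\<in>{- int l..int l}. \<forall>t\<ge>0. AE \<omega> in M. L t \<omega> l m = a l * Lh l m t \<omega>"
    using noise unfolding noise_scaled_def by (elim exE conjE) (rule that)
  have a: "\<bar>a l\<bar> \<le> C' * real l powr (- \<alpha> / 2)" if "l \<ge> 1" for l using all(1) that by blast
  have levy: "levy_process M borel abs_norm (Lh l m)" if "m \<in> {- int l..int l}" for l m
    using all(2) that by blast
  have mom: "(\<integral>\<omega>. Lh l m t \<omega> \<partial>M) = t * mh
      \<and> (\<integral>\<omega>. (Lh l m t \<omega> - (\<integral>\<omega>'. Lh l m t \<omega>' \<partial>M))\<^sup>2 \<partial>M) = t * vh"
    if "m \<in> {- int l..int l}" "t \<ge> 0" for l m t
    using all(3) that by blast
  have Lh: "AE \<omega> in M. L t \<omega> l m = a l * Lh l m t \<omega>" if "m \<in> {- int l..int l}" "t \<ge> 0" for l m t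
    using all(4) that by blast
  have mean: "levy_mean M L l m = a l * mh" and var: "levy_var M L l m = (a l)\<^sup>2 * vh"
    if m: "m \<in> {- int l..int l}" for l m
  proof -
    have [measurable]: "Lh l m 1 \<in> borel_measurable M" "(\<lambda>\<omega>. L 1 \<omega> l m) \<in> borel_measurable M"
      using levy[OF m] meas[OF m] unfolding levy_process_def by auto
    have AE: "AE \<omega> in M. L 1 \<omega> l m = a l * Lh l m 1 \<omega>" by (rule Lh[OF m]) simp
    note mom = mom[OF m, of 1]
    have "levy_mean M L l m = (\<integral>\<omega>. a l * Lh l m 1 \<omega> \<partial>M)"
      unfolding levy_mean_def by (rule integral_cong_AE) (use AE in auto)
    then show mean: "levy_mean M L l m = a l * mh" using mom by simp
    have "levy_var M L l m = (\<integral>\<omega>. (a l)\<^sup>2 * (Lh l m 1 \<omega> - (\<integral>\<omega>'. Lh l m 1 \<omega>' \<partial>M))\<^sup>2 \<partial>M)"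
      unfolding levy_var_def mean
    proof (rule integral_cong_AE)
      show "AE \<omega> in M. (L 1 \<omega> l m - a l * mh)\<^sup>2 = (a l)\<^sup>2 * (Lh l m 1 \<omega> - (\<integral>\<omega>'. Lh l m 1 \<omega>' \<partial>M))\<^sup>2"
        using AE by eventually_elim (use mom in \<open>simp flip: power_mult_distrib right_diff_distrib\<close>)
    qed auto
    then show "levy_var M L l m = (a l)\<^sup>2 * vh"
      by (simp only: integral_mult_right_zero conjunct2[OF mom] mult_1_left)
  qed
  have vh: "vh \<ge> 0"
  proof -
    have "0 \<le> (\<integral>\<omega>. (Lh 0 0 1 \<omega> - (\<integral>\<omega>'. Lh 0 0 1 \<omega>' \<partial>M))\<^sup>2 \<partial>M)" by simp
    also have "\<dots> = 1 * vh" by (rule conjunct2[OF mom]) auto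
    finally show ?thesis by simp
  qed
  define V where "V = vh + mh\<^sup>2"
  have V: "V \<ge> 0" using vh by (simp add: V_def)
  have term_eq: "(\<Sum>m\<in>{- int l..int l}. (1 + lap_eig l) powr \<eta> * (levy_var M L l m + (levy_mean M L l m)\<^sup>2))
      = (2 * real l + 1) * ((1 + lap_eig l) powr \<eta> * ((a l)\<^sup>2 * V))" for l
  proof -
    have "(\<Sum>m\<in>{- int l..int l}. (1 + lap_eig l) powr \<eta> * (levy_var M L l m + (levy_mean M L l m)\<^sup>2))
        = (\<Sum>m\<in>{- int l..int l}. (1 + lap_eig l) powr \<eta> * ((a l)\<^sup>2 * V))"
      by (intro sum.cong) (auto simp: mean var V_def power_mult_distrib distrib_left)
    then show ?thesis by (simp add: nat_add_distrib)
  qed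
  show ?thesis unfolding term_eq
  proof (rule summable_comparison_test')
    show "summable (\<lambda>l. 3 * (3 powr \<bar>\<eta>\<bar> * (C'\<^sup>2 * V)) * real l powr (1 + 2 * \<eta> - \<alpha>))"
      using \<eta> by (intro summable_mult) (simp add: summable_real_powr_iff)
    fix l :: nat assume l: "l \<ge> 1"
    have l0: "real l \<ge> 1" using l by simp
    have pw: "(1 + lap_eig l) powr \<eta> \<le> 3 powr \<bar>\<eta>\<bar> * real l powr (2 * \<eta>)"
    proof -
      have ll: "real l \<le> real l * real l" using l0 by (simp add: mult_le_cancel_left1)
      have sq: "real l powr (2 * \<eta>) = (real l * real l) powr \<eta>" using l0 by (simp add: powr_mult flip: powr_add)
      have up: "1 + lap_eig l \<le> 3 * (real l * real l)" and lo: "real l * real l \<le> 1 + lap_eig l"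
        using l0 ll unfolding lap_eig_def distrib_left by linarith+
      show ?thesis
      proof (cases "\<eta> \<ge> 0")
        case True
        have "(1 + lap_eig l) powr \<eta> \<le> (3 * (real l * real l)) powr \<eta>"
          using up True lap_eig_nonneg[of l] by (intro powr_mono2) auto
        then show ?thesis using True unfolding sq by (simp add: powr_mult)
      next
        case False
        have "(1 + lap_eig l) powr \<eta> \<le> 1 * (real l * real l) powr \<eta>"
          using lo l0 False by (simp add: powr_mono2')
        also have "\<dots> \<le> 3 powr \<bar>\<eta>\<bar> * (real l * real l) powr \<eta>"
          by (intro mult_right_mono ge_one_powr_ge_zero) auto
        finally show ?thesis unfolding sq .
      qed
    qed
    have al: "(a l)\<^sup>2 \<le> C'\<^sup>2 * real l powr (- \<alpha>)"
    proof -
      have "(a l)\<^sup>2 \<le> (C' * real l powr (- \<alpha> / 2))\<^sup>2"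
        using a[OF l] by (rule abs_le_square_iff[THEN iffD1, OF order_trans]) simp
      also have "\<dots> = C'\<^sup>2 * real l powr (- \<alpha>)"
        by (simp add: power2_eq_square mult_ac flip: powr_add)
      finally show ?thesis .
    qed
    have "(2 * real l + 1) * ((1 + lap_eig l) powr \<eta> * ((a l)\<^sup>2 * V))
        \<le> (3 * real l) * ((3 powr \<bar>\<eta>\<bar> * real l powr (2 * \<eta>)) * ((C'\<^sup>2 * real l powr (- \<alpha>)) * V))"
      using l0 V by (intro mult_mono pw al) auto
    also have "\<dots> = 3 * (3 powr \<bar>\<eta>\<bar> * (C'\<^sup>2 * V)) * (real l powr 1 * real l powr (2 * \<eta>) * real l powr (- \<alpha>))"
      using l0 by simp
    also have "real l powr 1 * real l powr (2 * \<eta>) * real l powr (- \<alpha>) = real l powr (1 + 2 * \<eta> - \<alpha>)"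
      by (simp only: powr_add[symmetric]) simp
    finally show "norm ((2 * real l + 1) * ((1 + lap_eig l) powr \<eta> * ((a l)\<^sup>2 * V)))
        \<le> 3 * (3 powr \<bar>\<eta>\<bar> * (C'\<^sup>2 * V)) * real l powr (1 + 2 * \<eta> - \<alpha>)"
      using V by simp
  qed
qed


section \<open>The error estimate\<close>

lemma error_series:
  "spectral_approx M L X0 \<kappa> t \<omega> - em_approx S L X0 \<kappa> h k \<omega>
    = (\<lambda>x. \<Sum>l\<le>\<kappa>. \<Sum>m\<in>{- int l..int l}.
        ((exp (- lap_eig l * t) - em_factor S h l ^ k) * sph_coeff (X0 \<omega>) l m
         + (stoch_integral M (\<lambda>s \<omega>. L s \<omega> l m) t (\<lambda>s. exp (- lap_eig l * (t - s))) \<omega>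
            - (\<Sum>j=1..k. em_factor S h l ^ (k - j + em_shift S)
              * (L (real j * h) \<omega> l m - L (real (j - 1) * h) \<omega> l m)))) * sph_harm l m x)"
  unfolding spectral_approx_def em_approx_def
  by (simp add: fun_eq_iff algebra_simps sum.distrib sum_subtractf)

text \<open>
  Orthonormality reduces the mean square error to the sum over the coefficients; each of them
  consists of a multiple of an initial coefficient and a noise term.
\<close>

lemma mean_square_error_split:
  fixes c d :: "'w \<Rightarrow> nat \<Rightarrow> int \<Rightarrow> real"
  assumes c [measurable]: "\<And>l m. m \<in> {- int l..int l} \<Longrightarrow> (\<lambda>\<omega>. c \<omega> l m) \<in> borel_measurable M"
    and d [measurable]: "\<And>l m. l \<le> \<kappa> \<Longrightarrow> m \<in> {- int l..int l} \<Longrightarrow> (\<lambda>\<omega>. d \<omega> l m) \<in> borel_measurable M"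
    and a: "\<And>l. l \<le> \<kappa> \<Longrightarrow> (a l)\<^sup>2 \<le> A\<^sup>2 * (1 + lap_eig l) powr \<eta>"
  shows "(\<integral>\<^sup>+\<omega>. (sphere_L2_norm (\<lambda>x. \<Sum>l\<le>\<kappa>. \<Sum>m\<in>{- int l..int l}.
        (a l * c \<omega> l m + d \<omega> l m) * sph_harm l m x))\<^sup>2 \<partial>M)
    \<le> 2 * (ennreal (A\<^sup>2) * (L2_norm M (Sobolev_norm \<eta>) c)\<^sup>2)
      + 2 * (\<Sum>l\<le>\<kappa>. \<Sum>m\<in>{- int l..int l}. \<integral>\<^sup>+\<omega>. ennreal ((d \<omega> l m)\<^sup>2) \<partial>M)"
proof -
  have S_meas: "(\<lambda>\<omega>. (Sobolev_norm \<eta> (c \<omega>))\<^sup>2) \<in> borel_measurable M"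
    unfolding Sobolev_norm_power2 by measurable
  have D_meas: "(\<lambda>\<omega>. \<Sum>l\<le>\<kappa>. \<Sum>m\<in>{- int l..int l}. ennreal ((d \<omega> l m)\<^sup>2)) \<in> borel_measurable M"
    by (intro borel_measurable_sum measurable_compose[OF _ measurable_ennreal] borel_measurable_power d) auto
  have pw: "(\<Sum>l\<le>\<kappa>. \<Sum>m\<in>{- int l..int l}. ennreal ((a l * c \<omega> l m + d \<omega> l m)\<^sup>2))
      \<le> 2 * (ennreal (A\<^sup>2) * (Sobolev_norm \<eta> (c \<omega>))\<^sup>2)
        + 2 * (\<Sum>l\<le>\<kappa>. \<Sum>m\<in>{- int l..int l}. ennreal ((d \<omega> l m)\<^sup>2))" for \<omega>
  proof -
    have "ennreal ((a l * c \<omega> l m + d \<omega> l m)\<^sup>2)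
        \<le> 2 * (ennreal (A\<^sup>2) * ennreal ((1 + lap_eig l) powr \<eta> * (c \<omega> l m)\<^sup>2)) + 2 * ennreal ((d \<omega> l m)\<^sup>2)"
      if l: "l \<le> \<kappa>" for l m
    proof -
      have "(a l * c \<omega> l m + d \<omega> l m)\<^sup>2 \<le> 2 * ((a l)\<^sup>2 * (c \<omega> l m)\<^sup>2) + 2 * (d \<omega> l m)\<^sup>2"
        using power2_diff_le[of "a l * c \<omega> l m" "- d \<omega> l m" 0] by (simp add: power_mult_distrib)
      also have "(a l)\<^sup>2 * (c \<omega> l m)\<^sup>2 \<le> A\<^sup>2 * (1 + lap_eig l) powr \<eta> * (c \<omega> l m)\<^sup>2"
        by (intro mult_right_mono a l) auto
      finally have "(a l * c \<omega> l m + d \<omega> l m)\<^sup>2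
          \<le> 2 * (A\<^sup>2 * ((1 + lap_eig l) powr \<eta> * (c \<omega> l m)\<^sup>2)) + 2 * (d \<omega> l m)\<^sup>2"
        by (simp add: mult.assoc)
      then have "ennreal ((a l * c \<omega> l m + d \<omega> l m)\<^sup>2)
          \<le> ennreal (2 * (A\<^sup>2 * ((1 + lap_eig l) powr \<eta> * (c \<omega> l m)\<^sup>2)) + 2 * (d \<omega> l m)\<^sup>2)"
        by (rule ennreal_leI)
      also have "\<dots> = 2 * (ennreal (A\<^sup>2) * ennreal ((1 + lap_eig l) powr \<eta> * (c \<omega> l m)\<^sup>2)) + 2 * ennreal ((d \<omega> l m)\<^sup>2)"
        by (simp add: ennreal_mult)
      finally show ?thesis .
    qed
    then have "(\<Sum>l\<le>\<kappa>. \<Sum>m\<in>{- int l..int l}. ennreal ((a l * c \<omega> l m + d \<omega> l m)\<^sup>2))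
        \<le> (\<Sum>l\<le>\<kappa>. \<Sum>m\<in>{- int l..int l}.
            2 * (ennreal (A\<^sup>2) * ennreal ((1 + lap_eig l) powr \<eta> * (c \<omega> l m)\<^sup>2)) + 2 * ennreal ((d \<omega> l m)\<^sup>2))"
      by (intro sum_mono) auto
    also have "\<dots> = 2 * (ennreal (A\<^sup>2) * (\<Sum>l\<le>\<kappa>. \<Sum>m\<in>{- int l..int l}. ennreal ((1 + lap_eig l) powr \<eta> * (c \<omega> l m)\<^sup>2)))
        + 2 * (\<Sum>l\<le>\<kappa>. \<Sum>m\<in>{- int l..int l}. ennreal ((d \<omega> l m)\<^sup>2))"
      by (simp only: sum.distrib sum_distrib_left)
    also have "\<dots> \<le> 2 * (ennreal (A\<^sup>2) * (Sobolev_norm \<eta> (c \<omega>))\<^sup>2)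
        + 2 * (\<Sum>l\<le>\<kappa>. \<Sum>m\<in>{- int l..int l}. ennreal ((d \<omega> l m)\<^sup>2))"
      by (intro add_right_mono mult_left_mono sum_le_Sobolev_norm_power2) auto
    finally show ?thesis .
  qed
  have "(\<integral>\<^sup>+\<omega>. (sphere_L2_norm (\<lambda>x. \<Sum>l\<le>\<kappa>. \<Sum>m\<in>{- int l..int l}.
        (a l * c \<omega> l m + d \<omega> l m) * sph_harm l m x))\<^sup>2 \<partial>M)
      \<le> (\<integral>\<^sup>+\<omega>. 2 * (ennreal (A\<^sup>2) * (Sobolev_norm \<eta> (c \<omega>))\<^sup>2)
        + 2 * (\<Sum>l\<le>\<kappa>. \<Sum>m\<in>{- int l..int l}. ennreal ((d \<omega> l m)\<^sup>2)) \<partial>M)"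
    unfolding sphere_L2_norm_sph_harm_sum by (intro nn_integral_mono pw)
  also have "\<dots> = 2 * (ennreal (A\<^sup>2) * (\<integral>\<^sup>+\<omega>. (Sobolev_norm \<eta> (c \<omega>))\<^sup>2 \<partial>M))
        + 2 * (\<integral>\<^sup>+\<omega>. (\<Sum>l\<le>\<kappa>. \<Sum>m\<in>{- int l..int l}. ennreal ((d \<omega> l m)\<^sup>2)) \<partial>M)"
    using S_meas D_meas by (subst nn_integral_add) (auto simp: nn_integral_cmult)
  also have "(\<integral>\<^sup>+\<omega>. (\<Sum>l\<le>\<kappa>. \<Sum>m\<in>{- int l..int l}. ennreal ((d \<omega> l m)\<^sup>2)) \<partial>M)
      = (\<Sum>l\<le>\<kappa>. \<Sum>m\<in>{- int l..int l}. \<integral>\<^sup>+\<omega>. ennreal ((d \<omega> l m)\<^sup>2) \<partial>M)"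
    by (subst nn_integral_sum; (intro sum.cong refl nn_integral_sum)?)
       (auto intro!: borel_measurable_sum measurable_compose[OF _ measurable_ennreal] borel_measurable_power d)
  finally show ?thesis unfolding L2_norm_power2 .
qed

theorem theorem4p2:
  fixes M :: "'w measure" and F :: "real \<Rightarrow> 'w measure"
    and L :: "real \<Rightarrow> 'w \<Rightarrow> sph_series" and X0 :: "'w \<Rightarrow> real ^ 3 \<Rightarrow> real"
    and T \<eta>\<^sub>0 \<gamma> \<mu> \<beta> C\<^sub>c :: real and S :: euler_scheme
  assumes "T > 0"
    and "complete_filtered_prob_space M F T"
    and "\<eta>\<^sub>0 > -1"
    and "levy_process M (Sobolev_borel \<eta>\<^sub>0) (Sobolev_norm \<eta>\<^sub>0) L"
    and "square_integrable_process M (Sobolev_norm \<eta>\<^sub>0) L"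
    and "X0 \<in> measurable (F 0) sphere_L2_borel"
    and "L2_norm M sphere_L2_norm X0 < \<top>"
    and "independent_of_process M sphere_L2_borel X0 (Sobolev_borel \<eta>\<^sub>0) L"
    and "\<gamma> \<ge> 0"
    and "L2_norm M (Sobolev_norm \<gamma>) (\<lambda>\<omega>. sph_coeff (X0 \<omega>)) < \<top>"
    and "S = Forward \<Longrightarrow> C\<^sub>c \<le> 1"
    and "0 < \<mu>" and "\<mu> \<le> 1"
    and "(\<exists>\<eta>>-1. noise_regular M L \<eta> \<and> \<beta> = \<eta> + 1)
         \<or> (\<exists>\<alpha>>0. noise_scaled M L \<alpha> \<and> \<beta> < \<alpha> / 2)"
  shows "\<exists>C::real. C \<ge> 0 \<and>
    (\<forall>(\<kappa>::nat) (n::nat) (h::real) (k::nat) (t\<^sub>k::real).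
       \<kappa> \<ge> 1 \<longrightarrow> n \<ge> 1 \<longrightarrow> h = T / real n \<longrightarrow> real \<kappa> * (real \<kappa> + 1) * h \<le> C\<^sub>c \<longrightarrow>
       k \<in> {1..n} \<longrightarrow> t\<^sub>k = real k * h \<longrightarrow>
       L2_norm M sphere_L2_norm
         (\<lambda>\<omega>. spectral_approx M L X0 \<kappa> t\<^sub>k \<omega> - em_approx S L X0 \<kappa> h k \<omega>)
       \<le> ennreal C *
          (ennreal (h powr \<mu> * t\<^sub>k powr (min 1 (\<gamma> / 2) - \<mu>))
             * L2_norm M (Sobolev_norm (min 2 \<gamma>)) (\<lambda>\<omega>. sph_coeff (X0 \<omega>))
           + ennreal (h powr (min (\<beta> / 2) 1))))"
proof -
  interpret prob_space M using assms(2) by (simp add: complete_filtered_prob_space_def)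
  \<comment> \<open>The maximum ensures \<open>0 < c \<le> 1\<close> whatever the sign of \<open>C\<^sub>c\<close>.\<close>
  define X where "X = max C\<^sub>c 0"
  define c where "c = 1 / (1 + X)"
  have X0: "X \<ge> 0" by (simp add: X_def)
  have c: "0 < c" "c \<le> 1" using X0 by (simp_all add: c_def)
  have XS: "S = Forward \<Longrightarrow> X \<le> 1" using assms(11) by (simp add: X_def)
  have coeff_levy: "square_integrable_levy M (\<lambda>t \<omega>. L t \<omega> l m)" if "m \<in> {- int l..int l}" for l m
    by (rule levy_coefficient[OF prob_space_axioms assms(4,5) that])
  have X0_meas: "(\<lambda>\<omega>. sph_coeff (X0 \<omega>) l m) \<in> borel_measurable M" if "m \<in> {- int l..int l}" for l m
  proof -
    have "subalgebra M (F 0)" using assms(1,2) by (simp add: complete_filtered_prob_space_def)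
    then have "X0 \<in> measurable M sphere_L2_borel" using assms(6) by (rule measurable_from_subalg)
    then show ?thesis using sph_coeff_measurable[OF that] by (rule measurable_compose)
  qed
  define V where "V l m = levy_var M L l m + (levy_mean M L l m)\<^sup>2" for l m
  have V: "V l m \<ge> 0" for l m by (simp add: V_def levy_var_def)
  obtain \<eta> where \<beta>: "\<beta> = \<eta> + 1"
    and summ: "summable (\<lambda>l. \<Sum>m\<in>{- int l..int l}. (1 + lap_eig l) powr \<eta> * V l m)"
  proof -
    from assms(14) show thesis
    proof
      assume "\<exists>\<eta>>-1. noise_regular M L \<eta> \<and> \<beta> = \<eta> + 1"
      then show thesis using that unfolding noise_regular_def V_def by blast
    next
      assume "\<exists>\<alpha>>0. noise_scaled M L \<alpha> \<and> \<beta> < \<alpha> / 2"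
      then obtain \<alpha> where \<alpha>: "noise_scaled M L \<alpha>" "\<beta> < \<alpha> / 2" by blast
      have "(\<lambda>\<omega>. L 1 \<omega> l m) \<in> borel_measurable M" if "m \<in> {- int l..int l}" for l m
        using square_integrable_levy.meas[OF coeff_levy[OF that], of 1] by simp
      from noise_scaled_summable[OF this \<alpha>(1), of "\<beta> - 1"] \<alpha>(2) show thesis
        by (intro that[of "\<beta> - 1"]) (simp_all add: V_def)
    qed
  qed
  define W where "W = (\<Sum>l. \<Sum>m\<in>{- int l..int l}. (1 + lap_eig l) powr \<eta> * V l m)"
  have W_le: "(\<Sum>l\<le>\<kappa>. \<Sum>m\<in>{- int l..int l}. (1 + lap_eig l) powr \<eta> * V l m) \<le> W" for \<kappa>
    unfolding W_def by (intro sum_le_suminf summ) (auto intro!: sum_nonneg mult_nonneg_nonneg V)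
  have W: "W \<ge> 0" using W_le[of 0] sum_nonneg[of "{..0::nat}"] by (rule order_trans[rotated]) (auto intro!: sum_nonneg mult_nonneg_nonneg V)
  define K\<^sub>0 where "K\<^sub>0 = exp X * (2 / c\<^sup>2)"
  define K\<^sub>1 where "K\<^sub>1 = 4 * (1 + T) * ((exp X + exp X * (2 / c) * exp X)\<^sup>2 / c)"
  define Q where "Q = 1 + (X + T) powr (1 - \<eta>)"
  define K\<^sub>2 where "K\<^sub>2 = K\<^sub>1 * (Q * W)"
  have K: "K\<^sub>0 \<ge> 0" "K\<^sub>1 \<ge> 0" "Q \<ge> 0" "K\<^sub>2 \<ge> 0"
    using c assms(1) W by (simp_all add: K\<^sub>0_def K\<^sub>1_def Q_def K\<^sub>2_def)
  \<comment> \<open>One constant whose square dominates those of the initial and of the noise part.\<close>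
  define C where "C = 2 * K\<^sub>0 + 2 * sqrt K\<^sub>2"
  have C: "C \<ge> 0" "2 * K\<^sub>0\<^sup>2 \<le> C\<^sup>2" "2 * K\<^sub>2 \<le> C\<^sup>2"
  proof -
    show "C \<ge> 0" using K by (simp add: C_def)
    have "C\<^sup>2 = 4 * K\<^sub>0\<^sup>2 + 8 * (K\<^sub>0 * sqrt K\<^sub>2) + 4 * (sqrt K\<^sub>2)\<^sup>2"
      by (simp add: C_def power2_eq_square algebra_simps)
    moreover have "0 \<le> K\<^sub>0 * sqrt K\<^sub>2" "0 \<le> K\<^sub>0\<^sup>2" "(sqrt K\<^sub>2)\<^sup>2 = K\<^sub>2" using K by simp_all
    ultimately show "2 * K\<^sub>0\<^sup>2 \<le> C\<^sup>2" "2 * K\<^sub>2 \<le> C\<^sup>2" using K by linarith+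
  qed
  show ?thesis
  proof (intro exI[of _ C] conjI C(1) allI impI)
    fix \<kappa> n :: nat and h :: real and k :: nat and t :: real
    assume n: "1 \<le> n" and h_def: "h = T / real n" and coupling: "real \<kappa> * (real \<kappa> + 1) * h \<le> C\<^sub>c"
      and k: "k \<in> {1..n}" and t_def: "t = real k * h"
    have h: "0 < h" "h \<le> T" using n assms(1) by (simp_all add: h_def field_simps)
    have tT: "t \<le> T"
    proof -
      have "real k * T \<le> real n * T" using k assms(1) by (intro mult_right_mono) auto
      then show ?thesis using n by (simp add: t_def h_def field_simps)
    qed
    have lam_X: "lap_eig l * h \<le> X" if "l \<le> \<kappa>" for l
    proof -
      have "lap_eig l \<le> real \<kappa> * (real \<kappa> + 1)" unfolding lap_eig_def using that by (intro mult_mono) auto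
      then have "lap_eig l * h \<le> real \<kappa> * (real \<kappa> + 1) * h" using h by (intro mult_right_mono) auto
      then show ?thesis using coupling by (simp add: X_def)
    qed
    have factor: "0 \<le> em_factor S h l" "em_factor S h l \<le> exp (- (c * (lap_eig l * h)))"
      "\<bar>exp (- (lap_eig l * h)) - em_factor S h l\<bar> \<le> (lap_eig l * h)\<^sup>2" if "l \<le> \<kappa>" for l
      unfolding c_def using em_factor_bounds[OF h(1) lam_X[OF that], of S] XS by auto
    define R where "R = h powr \<mu> * t powr (min 1 (\<gamma> / 2) - \<mu>)"
    define N where "N = L2_norm M (Sobolev_norm (min 2 \<gamma>)) (\<lambda>\<omega>. sph_coeff (X0 \<omega>))"
    define H where "H = h powr min (\<beta> / 2) 1"
    define d where "d \<omega> l m = stoch_integral M (\<lambda>s \<omega>. L s \<omega> l m) t (\<lambda>s. exp (- lap_eig l * (t - s))) \<omega>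
        - (\<Sum>j=1..k. em_factor S h l ^ (k - j + em_shift S)
            * (L (real j * h) \<omega> l m - L (real (j - 1) * h) \<omega> l m))" for \<omega> l m
    have a: "(exp (- lap_eig l * t) - em_factor S h l ^ k)\<^sup>2 \<le> (K\<^sub>0 * R)\<^sup>2 * (1 + lap_eig l) powr min 2 \<gamma>"
      if l: "l \<le> \<kappa>" for l
    proof -
      have "\<bar>exp (- lap_eig l * t) - em_factor S h l ^ k\<bar> \<le> K\<^sub>0 * R * (1 + lap_eig l) powr min 1 (\<gamma> / 2)"
        unfolding K\<^sub>0_def R_def t_def
        by (rule initial_error[OF lap_eig_nonneg h(1) lam_X[OF l] c factor[OF l]])
           (use k assms in auto)
      then have "(exp (- lap_eig l * t) - em_factor S h l ^ k)\<^sup>2 \<le> (K\<^sub>0 * R * (1 + lap_eig l) powr min 1 (\<gamma> / 2))\<^sup>2"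
        by (rule abs_le_square_iff[THEN iffD1, OF order_trans]) simp
      also have "\<dots> = (K\<^sub>0 * R)\<^sup>2 * (1 + lap_eig l) powr (min 1 (\<gamma> / 2) + min 1 (\<gamma> / 2))"
        by (simp only: power_mult_distrib power2_eq_square powr_add mult_ac)
      also have "min 1 (\<gamma> / 2) + min 1 (\<gamma> / 2) = min 2 \<gamma>" by (simp add: min_def)
      finally show ?thesis .
    qed
    have \<delta>: "em_shift S \<le> 1" by (cases S) auto
    have d_meas: "(\<lambda>\<omega>. d \<omega> l m) \<in> borel_measurable M"
      and d_bound: "(\<integral>\<^sup>+\<omega>. ennreal ((d \<omega> l m)\<^sup>2) \<partial>M) \<le> ennreal (K\<^sub>1 * (V l m * (lap_eig l * h\<^sup>2)))"
      if l: "l \<le> \<kappa>" and m: "m \<in> {- int l..int l}" for l m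
    proof -
      have k1: "1 \<le> k" and tT': "real k * h \<le> T" using k tT by (auto simp: t_def)
      note err = square_integrable_levy.noise_error[OF coeff_levy[OF m] lap_eig_nonneg h(1) lam_X[OF l] c
          factor[OF l] \<delta> k1 tT']
      show "(\<lambda>\<omega>. d \<omega> l m) \<in> borel_measurable M" unfolding d_def t_def by (rule err(1))
      show "(\<integral>\<^sup>+\<omega>. ennreal ((d \<omega> l m)\<^sup>2) \<partial>M) \<le> ennreal (K\<^sub>1 * (V l m * (lap_eig l * h\<^sup>2)))"
        using err(2) unfolding d_def t_def K\<^sub>1_def V_def levy_var_def levy_mean_def .
    qed
    have H2: "H\<^sup>2 = h powr min (\<eta> + 1) 2"
    proof -
      have "H\<^sup>2 = h powr (min (\<beta> / 2) 1 + min (\<beta> / 2) 1)" by (simp only: H_def power2_eq_square powr_add)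
      also have "min (\<beta> / 2) 1 + min (\<beta> / 2) 1 = min (\<eta> + 1) 2" by (simp add: \<beta> min_def)
      finally show ?thesis .
    qed
    have noise: "(\<Sum>l\<le>\<kappa>. \<Sum>m\<in>{- int l..int l}. \<integral>\<^sup>+\<omega>. ennreal ((d \<omega> l m)\<^sup>2) \<partial>M) \<le> ennreal (K\<^sub>2 * H\<^sup>2)"
    proof -
      have "(\<Sum>l\<le>\<kappa>. \<Sum>m\<in>{- int l..int l}. \<integral>\<^sup>+\<omega>. ennreal ((d \<omega> l m)\<^sup>2) \<partial>M)
          \<le> (\<Sum>l\<le>\<kappa>. \<Sum>m\<in>{- int l..int l}. ennreal (K\<^sub>1 * (V l m * (Q * ((1 + lap_eig l) powr \<eta> * H\<^sup>2)))))"
      proof (intro sum_mono)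
        fix l m assume l: "l \<in> {..\<kappa>}" and m: "m \<in> {- int l..int l}"
        have "lap_eig l * h\<^sup>2 \<le> Q * ((1 + lap_eig l) powr \<eta> * H\<^sup>2)"
          unfolding Q_def H2 using l by (intro noise_rate lap_eig_nonneg h lam_X) auto
        then have "K\<^sub>1 * (V l m * (lap_eig l * h\<^sup>2)) \<le> K\<^sub>1 * (V l m * (Q * ((1 + lap_eig l) powr \<eta> * H\<^sup>2)))"
          by (intro mult_left_mono K V)
        then show "(\<integral>\<^sup>+\<omega>. ennreal ((d \<omega> l m)\<^sup>2) \<partial>M) \<le> ennreal (K\<^sub>1 * (V l m * (Q * ((1 + lap_eig l) powr \<eta> * H\<^sup>2))))"
          using d_bound[of l m] l m by (auto intro: order_trans ennreal_leI)
      qed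
      also have "\<dots> = ennreal (\<Sum>l\<le>\<kappa>. \<Sum>m\<in>{- int l..int l}. K\<^sub>1 * (V l m * (Q * ((1 + lap_eig l) powr \<eta> * H\<^sup>2))))"
        using K V by (simp add: sum_nonneg)
      also have "(\<Sum>l\<le>\<kappa>. \<Sum>m\<in>{- int l..int l}. K\<^sub>1 * (V l m * (Q * ((1 + lap_eig l) powr \<eta> * H\<^sup>2))))
          = (K\<^sub>1 * Q * H\<^sup>2) * (\<Sum>l\<le>\<kappa>. \<Sum>m\<in>{- int l..int l}. (1 + lap_eig l) powr \<eta> * V l m)"
        by (simp add: sum_distrib_left mult_ac)
      also have "ennreal ((K\<^sub>1 * Q * H\<^sup>2) * (\<Sum>l\<le>\<kappa>. \<Sum>m\<in>{- int l..int l}. (1 + lap_eig l) powr \<eta> * V l m))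
          \<le> ennreal ((K\<^sub>1 * Q * H\<^sup>2) * W)"
        using K by (intro ennreal_leI mult_left_mono W_le) auto
      also have "(K\<^sub>1 * Q * H\<^sup>2) * W = K\<^sub>2 * H\<^sup>2" by (simp add: K\<^sub>2_def)
      finally show ?thesis .
    qed
    have "(\<integral>\<^sup>+\<omega>. (sphere_L2_norm (spectral_approx M L X0 \<kappa> t \<omega> - em_approx S L X0 \<kappa> h k \<omega>))\<^sup>2 \<partial>M)
        \<le> 2 * (ennreal ((K\<^sub>0 * R)\<^sup>2) * N\<^sup>2)
          + 2 * (\<Sum>l\<le>\<kappa>. \<Sum>m\<in>{- int l..int l}. \<integral>\<^sup>+\<omega>. ennreal ((d \<omega> l m)\<^sup>2) \<partial>M)"
      unfolding error_series d_def[symmetric] N_def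
      by (rule mean_square_error_split) (use X0_meas d_meas a in auto)
    also have "\<dots> \<le> 2 * (ennreal ((K\<^sub>0 * R)\<^sup>2) * N\<^sup>2) + 2 * ennreal (K\<^sub>2 * H\<^sup>2)"
      by (intro add_left_mono mult_left_mono noise) auto
    also have "\<dots> = ennreal (2 * K\<^sub>0\<^sup>2) * (ennreal (R\<^sup>2) * N\<^sup>2) + ennreal (2 * K\<^sub>2) * ennreal (H\<^sup>2)"
      using K by (simp add: ennreal_mult power_mult_distrib mult.assoc)
    also have "\<dots> \<le> ennreal (C\<^sup>2) * (ennreal (R\<^sup>2) * N\<^sup>2) + ennreal (C\<^sup>2) * ennreal (H\<^sup>2)"
      by (intro add_mono mult_right_mono ennreal_leI C) auto
    also have "\<dots> = (ennreal C)\<^sup>2 * ((ennreal R * N)\<^sup>2 + (ennreal H)\<^sup>2)"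
      using C by (simp add: ennreal_power power_mult_distrib distrib_left R_def H_def)
    also have "\<dots> \<le> (ennreal C)\<^sup>2 * (ennreal R * N + ennreal H)\<^sup>2"
    proof (rule mult_left_mono)
      show "(ennreal R * N)\<^sup>2 + (ennreal H)\<^sup>2 \<le> (ennreal R * N + ennreal H)\<^sup>2"
        unfolding power2_eq_square distrib_left distrib_right
        by (intro add_mono) (auto simp: add_increasing add_increasing2)
    qed simp
    also have "\<dots> = (ennreal C * (ennreal R * N + ennreal H))\<^sup>2" by (simp add: power_mult_distrib)
    finally show "L2_norm M sphere_L2_norm (\<lambda>\<omega>. spectral_approx M L X0 \<kappa> t \<omega> - em_approx S L X0 \<kappa> h k \<omega>)
        \<le> ennreal C * (ennreal (h powr \<mu> * t powr (min 1 (\<gamma> / 2) - \<mu>))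
            * L2_norm M (Sobolev_norm (min 2 \<gamma>)) (\<lambda>\<omega>. sph_coeff (X0 \<omega>)) + ennreal (h powr min (\<beta> / 2) 1))"
      unfolding R_def N_def H_def by (rule L2_norm_leI[where Z = "\<lambda>\<omega>. spectral_approx M L X0 \<kappa> t \<omega> - em_approx S L X0 \<kappa> h k \<omega>"])
  qed
qed

end
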